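(* Let $p\in(1,\infty)$, $m\in\mathbb{N}$, and let $f$ be a real-valued function defined on a closed set $E\subset\mathbb{R}$ with $\#E>m$. There exists $F\in L^m_p(\mathbb{R})$ with $F|_E=f$ if and only if $(\Delta^m f)^\sharp_E\in L_p(\mathbb{R})$. Furthermore, there is a constant $C\ge1$ depending only on $m$ and $p$ such that $$C^{-1}\,\|(\Delta^m f)^\sharp_E\|_{L_p(\mathbb{R})}\le\|f\|_{L^m_p(\mathbb{R})|_E}\le C\,\|(\Delta^m f)^\sharp_E\|_{L_p(\mathbb{R})}.$$
   Context: $L^m_p(\mathbb{R})$ is the homogeneous Sobolev space of all functions $F:\mathbb{R}\to\mathbb{R}$ such that $F^{(m-1)}$ is absolutely continuous on $\mathbb{R}$ and the weak derivative $F^{(m)}$ belongs to $L_p(\mathbb{R})$, with seminorm $\|F\|_{L^m_p(\mathbb{R})}=\|F^{(m)}\|_{L_p(\mathbb{R})}$. The trace seminorm of $f:E\to\mathbb{R}$ is $\|f\|_{L^m_p(\mathbb{R})|_E}=\inf\{\|F\|_{L^m_p(\mathbb{R})}: F\in L^m_p(\mathbb{R}),\ F|_E=f\}$. For a set $\{z_0,\dots,z_k\}$ of $k+1$ distinct points, $\Delta^k f[z_0,\dots,z_k]=\sum_{i=0}^k f(z_i)/\prod_{j\ne i}(z_i-z_j)$ is the $k$-th order divided difference (with $\Delta^0f[z_0]=f(z_0)$). For $f:E\to\mathbb{R}$, the sharp maximal function is $$(\Delta^m f)^\sharp_E(x)=\sup_{\substack{\{x_0,\dots,x_m\}\subset E\\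 x_0<x_1<\dots<x_m}}\frac{|\Delta^{m-1}f[x_0,\dots,x_{m-1}]-\Delta^{m-1}f[x_1,\dots,x_m]|}{|x-x_0|+|x-x_m|},\qquad x\in\mathbb{R}.$$ *)

theory Defs
  imports "HOL-Analysis.Analysis"
begin

text \<open>\<open>L\<^sub>p\<close>-norms are taken with values in \<open>[0, \<infinity>]\<close>, since the sharp maximal function is a supremum
  that may be infinite. The power below is only used with exponents \<open>a > 0\<close>, so \<open>\<infinity>\<close> is mapped
  to \<open>\<infinity>\<close>.\<close>

definition epowr :: "ennreal \<Rightarrow> real \<Rightarrow> ennreal" where
  "epowr x a = (if x = \<infinity> then \<infinity> else ennreal (enn2real x powr a))"

definition Lp_norm :: "real \<Rightarrow> (real \<Rightarrow> ennreal) \<Rightarrow> ennreal" where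
  "Lp_norm p g = epowr (\<integral>\<^sup>+ x. epowr (g x) p \<partial>lebesgue) (1 / p)"

definition in_Lp :: "real \<Rightarrow> (real \<Rightarrow> ennreal) \<Rightarrow> bool" where
  "in_Lp p g \<longleftrightarrow> g \<in> borel_measurable lebesgue \<and> Lp_norm p g < \<infinity>"

definition times_differentiable :: "nat \<Rightarrow> (real \<Rightarrow> real) \<Rightarrow> bool" where
  "times_differentiable k F \<longleftrightarrow> (\<forall>j<k. \<forall>x. (deriv ^^ j) F field_differentiable (at x))"

definition abs_continuous_on :: "real set \<Rightarrow> (real \<Rightarrow> real) \<Rightarrow> bool" where
  "abs_continuous_on S g \<longleftrightarrow>
    (\<forall>\<epsilon>>0. \<exists>\<delta>>0. \<forall>I :: (real \<times> real) set.
       finite I \<and> (\<forall>(a, b)\<in>I. a < b \<and> {a..b} \<subseteq> S) \<and>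
       disjoint_family_on (\<lambda>(a, b). {a<..<b}) I \<and> (\<Sum>(a, b)\<in>I. b - a) < \<delta> \<longrightarrow>
       (\<Sum>(a, b)\<in>I. \<bar>g b - g a\<bar>) < \<epsilon>)"

definition test_function :: "(real \<Rightarrow> real) \<Rightarrow> bool" where
  "test_function \<phi> \<longleftrightarrow> (\<forall>k. times_differentiable k \<phi>) \<and> compact (closure {x. \<phi> x \<noteq> 0})"

definition locally_integrable :: "(real \<Rightarrow> real) \<Rightarrow> bool" where
  "locally_integrable g \<longleftrightarrow> (\<forall>a b. set_integrable lebesgue {a..b} g)"

definition has_weak_deriv :: "(real \<Rightarrow> real) \<Rightarrow> (real \<Rightarrow> real) \<Rightarrow> bool" where
  "has_weak_deriv g h \<longleftrightarrow> locally_integrable g \<and> locally_integrable h \<and>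
    (\<forall>\<phi>. test_function \<phi> \<longrightarrow>
       (LINT x|lebesgue. g x * deriv \<phi> x) = - (LINT x|lebesgue. h x * \<phi> x))"

text \<open>The weak derivative is determined up to equality almost everywhere; the choice of a
  representative does not affect its \<open>L\<^sub>p\<close>-norm.\<close>

definition weak_deriv :: "(real \<Rightarrow> real) \<Rightarrow> real \<Rightarrow> real" where
  "weak_deriv g = (SOME h. has_weak_deriv g h)"

definition sobolev :: "nat \<Rightarrow> real \<Rightarrow> (real \<Rightarrow> real) set" where
  "sobolev m p = {F. times_differentiable (m - 1) F \<and>
     abs_continuous_on UNIV ((deriv ^^ (m - 1)) F) \<and>
     (\<exists>h. has_weak_deriv ((deriv ^^ (m - 1)) F) h \<and> in_Lp p (\<lambda>x. ennreal \<bar>h x\<bar>))}"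

definition sobolev_seminorm :: "nat \<Rightarrow> real \<Rightarrow> (real \<Rightarrow> real) \<Rightarrow> ennreal" where
  "sobolev_seminorm m p F = Lp_norm p (\<lambda>x. ennreal \<bar>weak_deriv ((deriv ^^ (m - 1)) F) x\<bar>)"

text \<open>A function on \<open>E\<close> is represented by a total function of which only the values on \<open>E\<close>
  are used. The infimum is \<open>\<infinity>\<close> if \<open>f\<close> has no extension in the Sobolev space.\<close>

definition trace_seminorm :: "nat \<Rightarrow> real \<Rightarrow> real set \<Rightarrow> (real \<Rightarrow> real) \<Rightarrow> ennreal" where
  "trace_seminorm m p E f =
    (INF F\<in>{F \<in> sobolev m p. \<forall>x\<in>E. F x = f x}. sobolev_seminorm m p F)"

definition divided_diff :: "nat \<Rightarrow> (real \<Rightarrow> real) \<Rightarrow> (nat \<Rightarrow> real) \<Rightarrow> real" where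
  "divided_diff k f z = (\<Sum>i\<le>k. f (z i) / (\<Prod>j\<in>{..k} - {i}. z i - z j))"

definition sharp_maximal :: "nat \<Rightarrow> real set \<Rightarrow> (real \<Rightarrow> real) \<Rightarrow> real \<Rightarrow> ennreal" where
  "sharp_maximal m E f x =
    (SUP z\<in>{z :: nat \<Rightarrow> real. strict_mono_on {..m} z \<and> z ` {..m} \<subseteq> E}.
       ennreal (\<bar>divided_diff (m - 1) f z - divided_diff (m - 1) f (\<lambda>i. z (Suc i))\<bar>
                / (\<bar>x - z 0\<bar> + \<bar>x - z m\<bar>)))"

end

(*
  Necessity: divided differences of F of order m - 1 are values of the derivative of that order up to
  a factorial, so the sharp maximal function is dominated by the Hardy-Littlewood maximal function of
  the weak derivative of order m, which is bounded on L_p.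

  Sufficiency: on a finite subset of E, glue the Lagrange polynomials of consecutive windows of m
  points by smooth steps, each located in the longest gap of the m + 1 points involved. The m-th
  derivative of the resulting interpolant is bounded pointwise by a constant multiple of the sharp
  maximal function of f on E. As this majorant does not depend on the finite subset, a limit of nearly
  minimal m-th derivatives over all finite subsets exists, and it yields an extension of f.
*)

theory Submission
  imports Defs
begin

section \<open>Smooth step functions and primitives\<close>

text \<open>A closed set may have accumulation points, where there are no consecutive windows of
  nodes; explicit interpolation is therefore confined to finite subsets. Two facts let the finite
  constructions fit together. The bound on the m-th derivative at t involves
  \<open>sharp_maximal m E f t\<close> only, so one majorant G in L_p serves all subsets. And a
  function is given by its m-th derivative h and its values at m fixed nodes of E through a formula
  affine in h, so extending f from S is a convex condition on h, stable under dominated convergence.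
  The limit is sought in a weighted L_2 space in which everything bounded by G is square integrable;
  there the parallelogram law replaces weak compactness in L_p.

  The denominator |x - x_0| + |x - x_m| serves both directions. For x inside the window it is the
  length of the window and cancels the scale of the gluing; for x outside it is at least the length
  of the hull of x and the window, so distant windows are controlled by the maximal function too.
  The constant of the upper estimate depends on m alone, that of the lower one comes from the
  maximal inequality and depends on p alone.\<close>

definition deriv_chain :: "(nat \<Rightarrow> real \<Rightarrow> real) \<Rightarrow> bool" where
  "deriv_chain D \<longleftrightarrow> (\<forall>k x. (D k has_real_derivative D (Suc k) x) (at x))"

lemma deriv_chainD: "deriv_chain D \<Longrightarrow> (D k has_real_derivative D (Suc k) x) (at x)"
  by (simp add: deriv_chain_def)

lemma deriv_chain_continuous: "deriv_chain D \<Longrightarrow> continuous_on A (D k)"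
  by (meson DERIV_continuous_on deriv_chainD has_field_derivative_at_within)

text \<open>The bridge from explicit families of derivatives to the iterated \<open>deriv\<close> of
  the definitions. Differentiability is asked only below level \<open>k\<close>, since the final
  extension comes with m - 1 classical derivatives.\<close>

lemma funpow_deriv_eq:
  assumes "\<And>j x. j < k \<Longrightarrow> (D j has_real_derivative D (Suc j) x) (at x)" "j \<le> k"
  shows "(deriv ^^ j) (D 0) = D j"
  using assms(2)
proof (induction j)
  case (Suc j)
  then have "deriv (D j) = D (Suc j)"
    using assms(1)[of j] by (auto intro!: ext DERIV_imp_deriv)
  with Suc show ?case by simp
qed simp

lemma times_differentiable_chain:
  assumes "\<And>j x. j < k \<Longrightarrow> (D j has_real_derivative D (Suc j) x) (at x)"
  shows "times_differentiable k (D 0)"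
  unfolding times_differentiable_def
proof (intro allI impI)
  fix j x assume "j < k"
  moreover from this have "(deriv ^^ j) (D 0) = D j"
    by (intro funpow_deriv_eq[where k=k] assms) auto
  ultimately show "(deriv ^^ j) (D 0) field_differentiable at x"
    using assms field_differentiable_def by metis
qed

lemma times_differentiable_DERIV:
  assumes "times_differentiable k F" "j < k"
  shows "((deriv ^^ j) F has_real_derivative (deriv ^^ Suc j) F x) (at x)"
  using assms by (simp add: times_differentiable_def DERIV_deriv_iff_field_differentiable)

text \<open>The iterated Leibniz rule without binomial coefficients: \<open>leibniz A B k 0 0\<close> is the \<open>k\<close>-th
  derivative of the product.\<close>

fun leibniz :: "(nat \<Rightarrow> real \<Rightarrow> real) \<Rightarrow> (nat \<Rightarrow> real \<Rightarrow> real) \<Rightarrow> nat \<Rightarrow> nat \<Rightarrow> nat \<Rightarrow> real \<Rightarrow> real" where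
  "leibniz A B 0 i j x = A i x * B j x"
| "leibniz A B (Suc k) i j x = leibniz A B k (Suc i) j x + leibniz A B k i (Suc j) x"

lemma leibniz_DERIV:
  assumes "deriv_chain A" "deriv_chain B"
  shows "(leibniz A B k i j has_real_derivative leibniz A B (Suc k) i j x) (at x)"
proof (induction k arbitrary: i j)
  case 0
  have "leibniz A B 0 i j = (\<lambda>x. A i x * B j x)" by auto
  then show ?case
    by (auto intro!: derivative_eq_intros deriv_chainD[OF assms(1)] deriv_chainD[OF assms(2)])
next
  case (Suc k)
  have "leibniz A B (Suc k) i j = (\<lambda>x. leibniz A B k (Suc i) j x + leibniz A B k i (Suc j) x)" by auto
  then show ?case using DERIV_add[OF Suc[of "Suc i" j] Suc[of i "Suc j"]]
    by (simp only: leibniz.simps)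
qed

lemma leibniz_eq_0:
  assumes "(\<forall>i. A i x = 0) \<or> (\<forall>j. B j x = 0)"
  shows "leibniz A B k i j x = 0"
  using assms by (induction k arbitrary: i j) auto

text \<open>A class closed under differentiation that contains the flat function exp(-1/x):
  differentiating changes only the polynomial \<open>q\<close> in y = 1/x.\<close>

definition exp_inv :: "real poly \<Rightarrow> real \<Rightarrow> real" where
  "exp_inv q x = (if x > 0 then poly q (1 / x) * exp (- 1 / x) else 0)"

lemma poly_times_exp_minus_tendsto_0: "((\<lambda>y. poly q y * exp (- y)) \<longlongrightarrow> (0::real)) at_top"
proof -
  have "((\<lambda>y. \<Sum>i\<le>degree q. coeff q i * (y ^ i / exp y)) \<longlongrightarrow> (\<Sum>i\<le>degree q. coeff q i * 0)) at_top"
    by (intro tendsto_sum tendsto_mult tendsto_const tendsto_power_div_exp_0)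
  then show ?thesis
    by (simp add: poly_altdef sum_distrib_right exp_minus divide_inverse mult.assoc)
qed

text \<open>The chain rule in y = 1/x sends \<open>q\<close> to y^2 (q - q'). At the origin the
  right difference quotient is y q(y) exp(-y) with y tending to infinity, so the derivative there is
  0.\<close>

lemma exp_inv_DERIV:
  "(exp_inv q has_real_derivative exp_inv ([:0, 0, 1:] * (q - pderiv q)) x) (at x)"
proof -
  consider "x > 0" | "x < 0" | "x = 0" by linarith
  then show ?thesis
  proof cases
    case 1
    have "((\<lambda>x. poly q (1 / x) * exp (- 1 / x)) has_real_derivative
           exp_inv ([:0, 0, 1:] * (q - pderiv q)) x) (at x)"
      using 1 unfolding exp_inv_def
      by (auto intro!: derivative_eq_intros simp: field_simps power2_eq_square)
    then show ?thesis
      by (rule has_field_derivative_transform_within_open[where S="{0<..}"])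
        (use 1 in \<open>auto simp: exp_inv_def\<close>)
  next
    case 2
    have "((\<lambda>x. 0) has_real_derivative exp_inv ([:0, 0, 1:] * (q - pderiv q)) x) (at x)"
      using 2 unfolding exp_inv_def by auto
    then show ?thesis
      by (rule has_field_derivative_transform_within_open[where S="{..<0}"])
        (use 2 in \<open>auto simp: exp_inv_def\<close>)
  next
    case 3
    have "filterlim (\<lambda>x::real. 1 / x) at_top (at_right 0)"
      using filterlim_inverse_at_top_right by (simp add: inverse_eq_divide)
    from filterlim_compose[OF poly_times_exp_minus_tendsto_0[of "[:0, 1:] * q"] this]
    have "((\<lambda>x. exp_inv q x / x) \<longlongrightarrow> 0) (at_right 0)"
      by (rule Lim_transform_eventually)
        (auto simp: exp_inv_def eventually_at_filter field_simps)
    moreover have "((\<lambda>x. exp_inv q x / x) \<longlongrightarrow> 0) (at_left 0)"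
      by (rule Lim_transform_eventually[OF tendsto_const])
        (auto simp: exp_inv_def eventually_at_filter)
    ultimately have "((\<lambda>x. exp_inv q x / x) \<longlongrightarrow> 0) (at 0)"
      by (simp add: filterlim_at_split)
    then show ?thesis using 3 by (simp add: DERIV_def exp_inv_def)
  qed
qed

text \<open>The bump is exp(-1/x) times its reflection in 1/2. At each point outside (0, 1) one
  factor vanishes to all orders, and \<open>leibniz\<close> carries this over to the derivatives of
  the product.\<close>

lemma smooth_bump_exists:
  obtains B where "deriv_chain B" "\<And>k x. x \<le> 0 \<or> 1 \<le> x \<Longrightarrow> B k x = 0"
    "\<And>x. 0 \<le> B 0 x" "B 0 (1 / 2) > 0"
proof -
  define q :: "nat \<Rightarrow> real poly" where "q k = ((\<lambda>q. [:0, 0, 1:] * (q - pderiv q)) ^^ k) 1" for k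
  define A where "A k = exp_inv (q k)" for k
  define A' where "A' k x = (- 1) ^ k * A k (1 - x)" for k x
  have A: "deriv_chain A"
    unfolding deriv_chain_def A_def using exp_inv_DERIV by (simp add: q_def)
  have A': "deriv_chain A'"
    unfolding deriv_chain_def
  proof (intro allI)
    fix k x
    have "((\<lambda>x. A k (1 - x)) has_real_derivative A (Suc k) (1 - x) * (- 1)) (at x)"
      by (rule DERIV_chain2[OF deriv_chainD[OF A]]) (auto intro!: derivative_eq_intros)
    from DERIV_cmult[OF this, of "(- 1) ^ k"]
    show "(A' k has_real_derivative A' (Suc k) x) (at x)"
      unfolding A'_def by simp
  qed
  have z: "A k x = 0" if "x \<le> 0" for k x
    using that by (simp add: A_def exp_inv_def)
  then have z': "A' k x = 0" if "x \<ge> 1" for k x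
    using that by (simp add: A'_def)
  show thesis
  proof
    show "deriv_chain (\<lambda>k. leibniz A A' k 0 0)"
      using leibniz_DERIV[OF A A'] by (simp add: deriv_chain_def)
    show "leibniz A A' k 0 0 x = 0" if "x \<le> 0 \<or> 1 \<le> x" for k x
      using that by (intro leibniz_eq_0) (auto simp: z z')
    show "0 \<le> leibniz A A' 0 0 0 x" for x
      by (simp add: A'_def A_def exp_inv_def q_def)
    show "0 < leibniz A A' 0 0 0 (1 / 2)"
      by (simp add: A'_def A_def exp_inv_def q_def)
  qed
qed

section \<open>Oriented primitives and the normalised smooth step\<close>

definition prim :: "(real \<Rightarrow> real) \<Rightarrow> real \<Rightarrow> real" where
  "prim h x = integral {0..x} h - integral {x..0} h"

lemma prim_0 [simp]: "prim h 0 = 0"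
  by (simp add: prim_def)

lemma prim_diff:
  assumes "\<And>a b. h integrable_on {a..b}" "a \<le> b"
  shows "prim h b - prim h a = integral {a..b} h"
proof -
  have c: "integral {u..v} h + integral {v..w} h = integral {u..w} h" if "u \<le> v" "v \<le> w" for u v w
    using Henstock_Kurzweil_Integration.integral_combine[OF that] assms by blast
  have z: "integral {u..v} h = 0" if "v \<le> u" for u v
    using that by (cases "u = v") auto
  consider "0 \<le> a" | "a \<le> 0" "0 \<le> b" | "b \<le> 0" by linarith
  then show ?thesis
    by cases (use assms(2) c[of 0 a b] c[of a 0 b] c[of a b 0] in \<open>auto simp: prim_def z\<close>)
qed

lemma prim_DERIV:
  assumes "continuous_on UNIV h"
  shows "(prim h has_real_derivative h x) (at x)"
proof -
  have i: "h integrable_on {a..b}" for a b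
    using assms continuous_on_subset integrable_continuous_interval by blast
  have "((\<lambda>u. integral {x - 1..u} h) has_real_derivative h x) (at x within {x - 1..x + 1})"
    by (rule integral_has_real_derivative) (use assms continuous_on_subset in auto)
  then have "((\<lambda>u. integral {x - 1..u} h) has_real_derivative h x) (at x)"
    by (simp add: at_within_Icc_at)
  then have "((\<lambda>u. integral {x - 1..u} h + prim h (x - 1)) has_real_derivative h x) (at x)"
    by (auto intro!: derivative_eq_intros)
  then show ?thesis
    by (rule has_field_derivative_transform_within_open[where S="{x - 1<..}"])
      (use prim_diff[OF i, of "x - 1", symmetric] in \<open>auto simp: less_imp_le\<close>)
qed

text \<open>The bump integrated from 0 and divided by its total mass \<open>c\<close>; the
  derivatives of positive order are rescaled derivatives of the bump.\<close>

lemma smooth_step_exists: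
  obtains \<theta> where "deriv_chain \<theta>" "\<And>k x. x \<le> 0 \<Longrightarrow> \<theta> k x = 0"
    "\<And>x. 1 \<le> x \<Longrightarrow> \<theta> 0 x = 1" "\<And>k x. 1 \<le> x \<Longrightarrow> 0 < k \<Longrightarrow> \<theta> k x = 0"
    "\<And>x. 0 \<le> \<theta> 0 x" "\<And>x. \<theta> 0 x \<le> 1" "\<And>x. 0 \<le> \<theta> 1 x"
proof -
  obtain B where B: "deriv_chain B" "\<And>k x. x \<le> 0 \<or> 1 \<le> x \<Longrightarrow> B k x = 0"
    "\<And>x. 0 \<le> B 0 x" "B 0 (1 / 2) > 0" using smooth_bump_exists by blast
  have cont: "continuous_on A (B 0)" for A using deriv_chain_continuous[OF B(1)] .
  have i: "B 0 integrable_on {a..b}" for a b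
    using cont integrable_continuous_interval by blast
  define I where "I = prim (B 0)"
  have I: "(I has_real_derivative B 0 x) (at x)" for x
    unfolding I_def by (rule prim_DERIV[OF cont])
  have mono: "I a \<le> I b" if "a \<le> b" for a b
    by (rule DERIV_nonneg_imp_nondecreasing[OF that]) (use I B(3) in blast)
  define c where "c = I 1"
  \<comment> \<open>A vanishing mass would make the monotone \<open>I\<close> constant on (0, 1),
    against \<open>B 0 (1 / 2) > 0\<close>.\<close>
  have "I 1 \<noteq> I 0"
  proof
    assume "I 1 = I 0"
    then have "I x = I 0" if "x \<in> {0<..<1}" for x
      using mono[of 0 x] mono[of x 1] that by auto
    then have "((\<lambda>x. I 0) has_real_derivative B 0 (1 / 2)) (at (1 / 2))"
      using has_field_derivative_transform_within_open[OF I[of "1/2"], of "{0<..<1}" "\<lambda>x. I 0"] by auto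
    from DERIV_unique[OF this DERIV_const] show False using B(4) by simp
  qed
  then have c: "c > 0" using mono[of 0 1] by (simp add: c_def I_def)
  define \<theta> where "\<theta> k x = (case k of 0 \<Rightarrow> I x / c | Suc k \<Rightarrow> B k x / c)" for k x
  have t0: "\<theta> 0 x = I x / c" "\<theta> (Suc k) x = B k x / c" for k x by (simp_all add: \<theta>_def)
  have I0: "I x = 0" if "x \<le> 0" for x
  proof -
    have "integral {x..0} (B 0) = integral {x..0} (\<lambda>_. 0)"
      by (rule integral_cong) (use B(2) in auto)
    then show ?thesis using that by (cases "x = 0") (auto simp: I_def prim_def)
  qed
  have I1: "I x = c" if "x \<ge> 1" for x
  proof -
    have "I x - I 1 = integral {1..x} (B 0)" unfolding I_def by (rule prim_diff[OF i that])
    also have "\<dots> = integral {1..x} (\<lambda>_. 0)"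
      by (rule integral_cong) (use B(2) in auto)
    finally show ?thesis by (simp add: c_def)
  qed
  show thesis
  proof
    show "deriv_chain \<theta>"
      unfolding deriv_chain_def
    proof (intro allI)
      fix k x
      show "(\<theta> k has_real_derivative \<theta> (Suc k) x) (at x)"
        using DERIV_cdivide[OF I] DERIV_cdivide[OF deriv_chainD[OF B(1)]]
        by (cases k) (simp_all add: \<theta>_def[abs_def])
    qed
    show "\<theta> k x = 0" if "x \<le> 0" for k x
      using that I0 B(2) by (cases k) (auto simp: t0)
    show "\<theta> 0 x = 1" if "1 \<le> x" for x using that I1 c by (simp add: t0)
    show "\<theta> k x = 0" if "1 \<le> x" "0 < k" for k x
      using that B(2) by (cases k) (auto simp: t0)
    show "0 \<le> \<theta> 0 x" for x using I0 mono[of 0 x] c I0[of 0] I0[of x] by (cases "x \<ge> 0") (auto simp: t0)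
    show "\<theta> 0 x \<le> 1" for x
    proof -
      have "I x \<le> c" using I1[of x] mono[of x 1] by (cases "x \<ge> 1") (auto simp: c_def)
      then show ?thesis using c by (simp add: t0)
    qed
    show "0 \<le> \<theta> 1 x" for x using B(3) c by (simp add: t0 One_nat_def)
  qed
qed

section \<open>Weak derivatives\<close>

lemma DERIV_everywhere_imp_continuous_on:
  "(\<And>x. (f has_real_derivative f' x) (at x)) \<Longrightarrow> continuous_on A f"
  by (blast intro: DERIV_continuous_on has_field_derivative_at_within)

lemma AE_lebesgue_integral_cong:
  fixes f g :: "real \<Rightarrow> real"
  assumes "AE x in lebesgue. f x = g x"
  shows "integral S f = integral S g"
proof -
  obtain N where "N \<in> null_sets lebesgue" "{x. f x \<noteq> g x} \<subseteq> N"
    using assms by (auto simp: eventually_ae_filter)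
  then show ?thesis
    by (intro integral_spike[of N]) (force simp: negligible_iff_null_sets)+
qed

lemma locally_integrable_imp_integrable_on: "locally_integrable h \<Longrightarrow> h integrable_on {a..b}"
  by (simp add: locally_integrable_def set_lebesgue_integral_eq_integral(1))

lemma locally_integrable_continuous: "continuous_on UNIV h \<Longrightarrow> locally_integrable h"
  using continuous_on_subset[of UNIV h] absolutely_integrable_continuous_real
  by (auto simp: locally_integrable_def)

lemma locally_integrable_measurable:
  assumes "locally_integrable h"
  shows "h \<in> borel_measurable lebesgue"
proof (rule borel_measurable_LIMSEQ_real)
  fix x
  obtain N :: nat where "\<bar>x\<bar> \<le> real N" using real_arch_simple by blast
  then have "indicat_real {- real n..real n} x * h x = h x" if "n \<ge> N" for n
    using that by (auto simp: indicator_def abs_le_iff)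
  then have "\<forall>\<^sub>F n in sequentially. indicat_real {- real n..real n} x * h x = h x"
    unfolding eventually_sequentially by blast
  then show "(\<lambda>n. indicat_real {- real n..real n} x * h x) \<longlonglongrightarrow> h x"
    by (rule tendsto_eventually)
next
  fix n :: nat
  have "set_integrable lebesgue {- real n..real n} h"
    using assms unfolding locally_integrable_def by blast
  then show "(\<lambda>x. indicat_real {- real n..real n} x * h x) \<in> borel_measurable lebesgue"
    by (auto simp: set_integrable_def)
qed

lemma locally_integrable_mult_continuous:
  assumes "locally_integrable h" "continuous_on UNIV \<phi>"
  shows "locally_integrable (\<lambda>x. h x * \<phi> x)"
  unfolding locally_integrable_def
proof (intro allI)
  fix a b :: real
  have "continuous_on {a..b} \<phi>" using assms(2) continuous_on_subset by blast
  then have "(\<lambda>x. \<phi> x * h x) absolutely_integrable_on {a..b}"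
    using assms(1)
    by (intro absolutely_integrable_bounded_measurable_product_real)
      (auto simp: locally_integrable_def intro!: compact_imp_bounded compact_continuous_image
        continuous_imp_measurable_on_sets_lebesgue)
  then show "(\<lambda>x. h x * \<phi> x) absolutely_integrable_on {a..b}"
    by (simp add: mult.commute)
qed

lemma locally_integrable_diff:
  "locally_integrable f \<Longrightarrow> locally_integrable g \<Longrightarrow> locally_integrable (\<lambda>x. f x - g x)"
  by (auto simp: locally_integrable_def intro!: set_integral_diff)

lemma LINT_supported:
  assumes "locally_integrable u" "\<And>x. x \<notin> {a..b} \<Longrightarrow> u x = 0"
  shows "(LINT x|lebesgue. u x) = integral {a..b} u"
proof -
  have "(LINT x|lebesgue. u x) = (LINT x:{a..b}|lebesgue. u x)"
    unfolding set_lebesgue_integral_def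
    by (rule Bochner_Integration.integral_cong) (use assms(2) in \<open>auto simp: indicator_def\<close>)
  also have "\<dots> = integral {a..b} u"
    using assms(1) by (simp add: locally_integrable_def set_lebesgue_integral_eq_integral(2))
  finally show ?thesis .
qed

text \<open>The kernel is one-sided: with r = n + 1 it lives on [c, c + 1/r], so \<open>c\<close>
  may be the left endpoint \<open>a\<close> but has to stay below \<open>b\<close>. Its mass is a
  difference of two values of \<open>\<theta> 0\<close>, hence exactly 1 once 1/r < b - c.\<close>

lemma approximate_identity_tendsto:
  assumes g: "continuous_on UNIV g" and c: "a \<le> c" "c < b"
    and \<theta>: "deriv_chain \<theta>" "\<And>k x. x \<le> 0 \<Longrightarrow> \<theta> k x = 0"
    "\<And>x. 1 \<le> x \<Longrightarrow> \<theta> 0 x = 1" "\<And>k x. 1 \<le> x \<Longrightarrow> 0 < k \<Longrightarrow> \<theta> k x = 0" "\<And>x. 0 \<le> \<theta> 1 x"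
  shows "(\<lambda>n. integral {a..b} (\<lambda>x. g x * (real (Suc n) * \<theta> 1 (real (Suc n) * (x - c))))) \<longlonglongrightarrow> g c"
proof (rule LIMSEQ_I)
  fix \<epsilon> :: real assume "0 < \<epsilon>"
  then obtain \<delta> where \<delta>: "\<delta> > 0" "\<And>x. \<bar>x - c\<bar> < \<delta> \<Longrightarrow> \<bar>g x - g c\<bar> < \<epsilon> / 2"
    using g unfolding continuous_on_iff dist_real_def by (metis UNIV_I half_gt_zero)
  have "min \<delta> (b - c) > 0" using \<delta> c by simp
  then obtain N where N: "inverse (real (Suc N)) < min \<delta> (b - c)"
    using reals_Archimedean by blast
  show "\<exists>no. \<forall>n\<ge>no. norm (integral {a..b} (\<lambda>x. g x * (real (Suc n) * \<theta> 1 (real (Suc n) * (x - c)))) - g c) < \<epsilon>"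
  proof (intro exI allI impI)
    fix n assume "n \<ge> N"
    define r where "r = real (Suc n)"
    define k where "k x = r * \<theta> 1 (r * (x - c))" for x
    have r: "r > 0" "r \<ge> real (Suc N)" using \<open>n \<ge> N\<close> by (auto simp: r_def)
    have "inverse r < min \<delta> (b - c)"
      using N le_imp_inverse_le[OF r(2)] by simp
    then have r': "1 \<le> r * (b - c)" "\<And>y. r * y < 1 \<Longrightarrow> y < \<delta>"
      using r(1) by (auto simp: field_simps) (metis mult.commute mult_less_cancel_left_pos order_less_trans)
    have D: "((\<lambda>x. \<theta> 0 (r * (x - c))) has_real_derivative k x) (at x)" for x
    proof -
      have "((\<lambda>x. \<theta> 0 (r * (x - c))) has_real_derivative \<theta> (Suc 0) (r * (x - c)) * r) (at x)"
        by (rule DERIV_chain2[OF deriv_chainD[OF \<theta>(1)]]) (auto intro!: derivative_eq_intros)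
      then show ?thesis by (simp add: k_def mult.commute)
    qed
    have "(k has_integral \<theta> 0 (r * (b - c)) - \<theta> 0 (r * (a - c))) {a..b}"
      by (rule fundamental_theorem_of_calculus)
        (use c D in \<open>auto simp: has_real_derivative_iff_has_vector_derivative[symmetric]
          intro: has_field_derivative_at_within\<close>)
    moreover have "r * (a - c) \<le> 0" using c r by (simp add: mult_nonneg_nonpos)
    ultimately have k1: "(k has_integral 1) {a..b}" using \<theta>(2)[of "r * (a - c)"] \<theta>(3)[OF r'(1)] by simp
    have contk: "continuous_on UNIV k"
      unfolding k_def by (intro continuous_intros continuous_on_compose2[OF deriv_chain_continuous[OF \<theta>(1)]]) auto
    have i: "(\<lambda>x. g x * k x) integrable_on {a..b}"
      by (intro integrable_continuous_interval continuous_intros continuous_on_subset[OF g] continuous_on_subset[OF contk]) auto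
    have i': "(\<lambda>x. g c * k x) integrable_on {a..b}"
      by (intro integrable_continuous_interval continuous_intros continuous_on_subset[OF contk]) auto
    have "integral {a..b} (\<lambda>x. g x * k x) - g c = integral {a..b} (\<lambda>x. g x * k x - g c * k x)"
      using integral_diff[OF i i'] integral_unique[OF has_integral_mult_right[OF k1, of "g c"]] by simp
    also have "norm \<dots> \<le> integral {a..b} (\<lambda>x. \<epsilon> / 2 * k x)"
    proof (rule Henstock_Kurzweil_Integration.integral_norm_bound_integral)
      show "(\<lambda>x. g x * k x - g c * k x) integrable_on {a..b}" using i i' by (rule integrable_diff)
      show "(\<lambda>x. \<epsilon> / 2 * k x) integrable_on {a..b}"
        using k1 by (intro integrable_on_mult_right) auto
      fix x
      have k0: "k x \<ge> 0" using r \<theta>(5) by (simp add: k_def)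
      have "k x = 0 \<or> \<bar>g x - g c\<bar> < \<epsilon> / 2"
      proof (cases "0 < r * (x - c) \<and> r * (x - c) < 1")
        case True
        then have "0 < x - c" "x - c < \<delta>" using r r'(2)[of "x - c"] by (auto simp: zero_less_mult_iff)
        then show ?thesis using \<delta>(2)[of x] by auto
      next
        case False
        then show ?thesis using \<theta>(2)[of "r * (x - c)" 1] \<theta>(4)[of "r * (x - c)" 1]
          by (auto simp: k_def not_less)
      qed
      then have "\<bar>g x - g c\<bar> * k x \<le> \<epsilon> / 2 * k x"
        by (elim disjE) (use k0 in \<open>auto intro!: mult_right_mono simp del: times_divide_eq_left\<close>)
      then show "norm (g x * k x - g c * k x) \<le> \<epsilon> / 2 * k x"
        using k0 by (simp add: abs_mult left_diff_distrib[symmetric])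
    qed
    also have "\<dots> = \<epsilon> / 2" using integral_unique[OF has_integral_mult_right[OF k1, of "\<epsilon> / 2"]] by simp
    also have "\<dots> < \<epsilon>" using \<open>0 < \<epsilon>\<close> by simp
    finally show "norm (integral {a..b} (\<lambda>x. g x * (real (Suc n) * \<theta> 1 (real (Suc n) * (x - c)))) - g c) < \<epsilon>"
      by (simp add: k_def r_def)
  qed
qed

text \<open>Test the weak derivative against smooth functions that converge to the indicator of \<open>(a, b]\<close>.\<close>

lemma weak_deriv_integral:
  assumes g: "continuous_on UNIV g" and wd: "has_weak_deriv g h" and ab: "a \<le> b"
  shows "integral {a..b} h = g b - g a"
proof -
  obtain \<theta> where \<theta>: "deriv_chain \<theta>" "\<And>k x. x \<le> 0 \<Longrightarrow> \<theta> k x = 0"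
    "\<And>x. 1 \<le> x \<Longrightarrow> \<theta> 0 x = 1" "\<And>k x. 1 \<le> x \<Longrightarrow> 0 < k \<Longrightarrow> \<theta> k x = 0"
    "\<And>x. 0 \<le> \<theta> 0 x" "\<And>x. \<theta> 0 x \<le> 1" "\<And>x. 0 \<le> \<theta> 1 x"
    using smooth_step_exists by blast
  note contt = deriv_chain_continuous[OF \<theta>(1)]
  have lh: "locally_integrable h" using wd by (simp add: has_weak_deriv_def)
  define r where "r n = real (Suc n)" for n
  \<comment> \<open>Rises from 0 to 1 just to the right of \<open>a\<close> and falls back just to
    the right of \<open>b\<close>. Both transitions have width 1 / r n \<le> 1, which keeps the
    support in [a, b + 1]; the power of \<open>r n\<close> is the inner derivative.\<close>
  define \<phi> where "\<phi> n k x = r n ^ k * (\<theta> k (r n * (x - a)) - \<theta> k (r n * (x - b)))" for n k x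
  have chain: "deriv_chain (\<phi> n)" for n
    unfolding deriv_chain_def
  proof (intro allI)
    fix k x
    have "((\<lambda>x. \<theta> k (r n * (x - c))) has_real_derivative \<theta> (Suc k) (r n * (x - c)) * r n) (at x)" for c
      by (rule DERIV_chain2[OF deriv_chainD[OF \<theta>(1)]]) (auto intro!: derivative_eq_intros)
    from DERIV_cmult[OF DERIV_diff[OF this[of a] this[of b]], of "r n ^ k"]
    show "(\<phi> n k has_real_derivative \<phi> n (Suc k) x) (at x)"
      unfolding \<phi>_def by (simp add: algebra_simps)
  qed
  have supp: "\<phi> n k x = 0" if "x \<notin> {a..b + 1}" for n k x
  proof -
    have "r n * (x - a) \<le> 0 \<and> r n * (x - b) \<le> 0 \<or> 1 \<le> r n * (x - a) \<and> 1 \<le> r n * (x - b)"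
    proof (cases "x < a")
      case True
      then show ?thesis using ab by (intro disjI1) (auto simp: r_def intro!: mult_nonneg_nonpos)
    next
      case False
      then have "x > b + 1" using that by auto
      then show ?thesis using ab mult_mono[of 1 "r n" 1 "x - a"] mult_mono[of 1 "r n" 1 "x - b"]
        by (auto simp: r_def)
    qed
    then show ?thesis using \<theta>(2-4) by (cases "k = 0") (auto simp: \<phi>_def)
  qed
  have test: "test_function (\<phi> n 0)" for n
    unfolding test_function_def
  proof (intro conjI allI)
    show "times_differentiable k (\<phi> n 0)" for k
      by (rule times_differentiable_chain) (rule deriv_chainD[OF chain])
    have "{x. \<phi> n 0 x \<noteq> 0} \<subseteq> {a..b + 1}" using supp by blast
    then show "compact (closure {x. \<phi> n 0 x \<noteq> 0})"
      by (meson bounded_closed_interval bounded_subset compact_closure)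
  qed
  have dphi: "deriv (\<phi> n 0) = \<phi> n 1" for n
    using deriv_chainD[OF chain, of n 0] by (auto intro!: ext DERIV_imp_deriv)
  have contphi: "continuous_on UNIV (\<phi> n k)" for n k
    by (rule deriv_chain_continuous[OF chain])
  have eq: "integral {a..b + 1} (\<lambda>x. g x * \<phi> n 1 x) = - integral {a..b + 1} (\<lambda>x. h x * \<phi> n 0 x)" for n
  proof -
    have "(LINT x|lebesgue. g x * \<phi> n 1 x) = - (LINT x|lebesgue. h x * \<phi> n 0 x)"
      using wd test[of n] by (auto simp: has_weak_deriv_def dphi)
    moreover have "(LINT x|lebesgue. g x * \<phi> n 1 x) = integral {a..b + 1} (\<lambda>x. g x * \<phi> n 1 x)"
      using supp g contphi by (intro LINT_supported locally_integrable_continuous continuous_intros) auto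
    moreover have "(LINT x|lebesgue. h x * \<phi> n 0 x) = integral {a..b + 1} (\<lambda>x. h x * \<phi> n 0 x)"
      using supp lh contphi by (intro LINT_supported locally_integrable_mult_continuous) auto
    ultimately show ?thesis by simp
  qed
  have lim1: "(\<lambda>n. integral {a..b + 1} (\<lambda>x. g x * \<phi> n 1 x)) \<longlonglongrightarrow> g a - g b"
  proof -
    have i: "(\<lambda>x. g x * (r n * \<theta> 1 (r n * (x - c)))) integrable_on {a..b + 1}" for n c
      by (intro integrable_continuous_interval continuous_intros continuous_on_subset[OF g]
          continuous_on_compose2[OF contt]) auto
    have "integral {a..b + 1} (\<lambda>x. g x * \<phi> n 1 x) =
      integral {a..b + 1} (\<lambda>x. g x * (r n * \<theta> 1 (r n * (x - a)))) -
      integral {a..b + 1} (\<lambda>x. g x * (r n * \<theta> 1 (r n * (x - b))))" for n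
      by (subst integral_diff[OF i i, symmetric]) (simp add: \<phi>_def algebra_simps)
    moreover have "(\<lambda>n. integral {a..b + 1} (\<lambda>x. g x * (r n * \<theta> 1 (r n * (x - c))))) \<longlonglongrightarrow> g c"
      if "a \<le> c" "c < b + 1" for c
      unfolding r_def
      by (rule approximate_identity_tendsto[OF g that \<theta>(1) \<theta>(2) \<theta>(3) \<theta>(4) \<theta>(7)]) 
    ultimately show ?thesis using ab by (auto intro!: tendsto_diff)
  qed
  define k where "k x = (if x \<in> {a<..b} then h x else 0)" for x
  have habs: "(\<lambda>x. \<bar>h x\<bar>) integrable_on {a..b + 1}"
    using lh unfolding locally_integrable_def absolutely_integrable_on_def by auto
  have "(\<lambda>n. integral {a..b + 1} (\<lambda>x. h x * \<phi> n 0 x)) \<longlonglongrightarrow> integral {a..b + 1} k"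
  proof (rule dominated_convergence(2)[where h="\<lambda>x. \<bar>h x\<bar>"])
    show "(\<lambda>x. h x * \<phi> n 0 x) integrable_on {a..b + 1}" for n
      by (intro locally_integrable_imp_integrable_on locally_integrable_mult_continuous lh contphi)
    show "(\<lambda>x. \<bar>h x\<bar>) integrable_on {a..b + 1}" by (rule habs)
    show "norm (h x * \<phi> n 0 x) \<le> \<bar>h x\<bar>" for n x
    proof -
      have "\<bar>\<theta> 0 u - \<theta> 0 v\<bar> \<le> 1" for u v
        using \<theta>(5)[of u] \<theta>(6)[of u] \<theta>(5)[of v] \<theta>(6)[of v] by linarith
      then show ?thesis by (simp add: \<phi>_def abs_mult mult_left_le)
    qed
    fix x assume "x \<in> {a..b + 1}"
    have step: "(\<lambda>n. \<theta> 0 (r n * (x - c))) \<longlonglongrightarrow> (if x \<le> c then 0 else 1)" for c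
    proof (cases "x \<le> c")
      case True
      then have "r n * (x - c) \<le> 0" for n by (simp add: r_def mult_nonneg_nonpos)
      then show ?thesis using True \<theta>(2) by simp
    next
      case False
      then obtain N where N: "inverse (real (Suc N)) < x - c"
        using reals_Archimedean[of "x - c"] by auto
      have "1 \<le> r n * (x - c)" if "n \<ge> N" for n
      proof -
        have "1 \<le> real (Suc N) * (x - c)" using N by (simp add: field_simps)
        also have "\<dots> \<le> r n * (x - c)" using that False by (intro mult_right_mono) (auto simp: r_def)
        finally show ?thesis .
      qed
      then have "\<forall>\<^sub>F n in sequentially. \<theta> 0 (r n * (x - c)) = 1"
        unfolding eventually_sequentially using \<theta>(3) by blast
      then show ?thesis using False by (auto intro!: tendsto_eventually)
    qed
    have "(\<lambda>n. h x * \<phi> n 0 x) \<longlonglongrightarrow> h x * ((if x \<le> a then 0 else 1) - (if x \<le> b then 0 else 1))"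
      unfolding \<phi>_def power_0 mult_1 by (intro tendsto_mult tendsto_const tendsto_diff step)
    also have "h x * ((if x \<le> a then 0 else 1) - (if x \<le> b then 0 else 1)) = k x"
      using ab by (auto simp: k_def)
    finally show "(\<lambda>n. h x * \<phi> n 0 x) \<longlonglongrightarrow> k x" .
  qed
  then have "(\<lambda>n. - integral {a..b + 1} (\<lambda>x. g x * \<phi> n 1 x)) \<longlonglongrightarrow> integral {a..b + 1} k"
    unfolding eq minus_minus .
  from LIMSEQ_unique[OF this tendsto_minus[OF lim1]]
  have "integral {a..b + 1} k = g b - g a" by simp
  moreover have "integral {a..b + 1} k = integral {a..b + 1} (\<lambda>x. if x \<in> {a..b} then h x else 0)"
    by (rule integral_spike[of "{a}"]) (auto simp: k_def)
  moreover have "\<dots> = integral {a..b} h"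
    by (subst integral_restrict_Int) (simp add: Int_absorb2)
  ultimately show ?thesis by simp
qed

text \<open>Fubini, equality of densities and the covering argument are carried out over
  \<open>lborel\<close>, whereas a weak derivative is only Lebesgue measurable; the passage costs a
  null set.\<close>

lemma locally_integrable_borel_representative:
  assumes u: "locally_integrable u"
  obtains v where "v \<in> borel_measurable borel" "AE x in lebesgue. u x = v x"
    "\<forall>a b. set_integrable lborel {a..b} v"
proof -
  have "u \<in> borel_measurable (completion lborel)" using locally_integrable_measurable[OF u] by simp
  then obtain v where v [measurable]: "v \<in> borel_measurable lborel" and uv: "AE x in lborel. u x = v x"
    using completion_ex_borel_measurable_real by blast
  then have uv': "AE x in lebesgue. u x = v x" by (simp add: AE_completion)
  show thesis
  proof
    show "v \<in> borel_measurable borel" using v by simp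
    show "\<forall>a b. set_integrable lborel {a..b} v"
    proof (intro allI)
      fix a b :: real
      have "integrable lebesgue (\<lambda>x. indicat_real {a..b} x * u x)"
        using u by (simp add: locally_integrable_def set_integrable_def)
      then have "integrable lebesgue (\<lambda>x. indicat_real {a..b} x * v x)"
        by (subst integrable_cong_AE[where g="\<lambda>x. indicat_real {a..b} x * u x"])
          (use uv' in \<open>auto intro!: measurable_completion\<close>)
      then show "set_integrable lborel {a..b} v"
        by (simp add: set_integrable_def integrable_completion)
    qed
  qed (rule uv')
qed

text \<open>On [-n, n] the positive and the negative part of the Borel representative are densities
  of two finite measures. These agree on all half-lines, because a half-line meets [-n, n] in an
  interval up to one point; so the measures coincide, and with them the densities.\<close>

lemma integral_interval_zero_imp_AE_zero:
  assumes u: "locally_integrable u" and zero: "\<And>a b. integral {a..b} u = 0"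
  shows "AE x in lebesgue. u x = 0"
proof -
  obtain v where [measurable]: "v \<in> borel_measurable borel" and uv: "AE x in lebesgue. u x = v x"
    and iv: "\<And>a b. set_integrable lborel {a..b} v"
    using locally_integrable_borel_representative[OF u] by blast
  have zv: "integral {a..b} v = 0" for a b
    using AE_lebesgue_integral_cong[OF uv] zero by simp
  have "AE x in lborel. x \<in> {- real n..real n} \<longrightarrow> v x = 0" for n
  proof -
    let ?I = "{- real n..real n}"
    let ?p = "\<lambda>x. ennreal (indicator ?I x * max 0 (v x))"
    let ?q = "\<lambda>x. ennreal (indicator ?I x * max 0 (- v x))"
    have int: "integrable lborel (\<lambda>x. indicator {y<..} x * (indicator ?I x * max 0 (s * v x)))"
      if "\<bar>s\<bar> = 1" for y s
      by (rule Bochner_Integration.integrable_bound[OF iv[unfolded set_integrable_def, of "- real n" "real n"]])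
        (use that in \<open>auto simp: indicator_def abs_if max_def split: if_splits\<close>)
    have "density lborel ?p = density lborel ?q"
    proof (rule measure_eqI_lessThan)
      fix y
      have "(LINT x|lborel. indicator {y<..} x * (indicator ?I x * max 0 (1 * v x)))
          - (LINT x|lborel. indicator {y<..} x * (indicator ?I x * max 0 (- 1 * v x)))
          = (LINT x|lborel. indicator {y<..} x * (indicator ?I x * v x))"
        by (subst Bochner_Integration.integral_diff[OF int int, symmetric])
          (auto intro!: Bochner_Integration.integral_cong simp: indicator_def max_def)
      also have "\<dots> = (LINT x|lborel. indicator {max y (- real n)..real n} x * v x)"
        by (rule integral_cong_AE)
          (auto intro!: AE_I[where N="{y}"] simp: indicator_def split: if_splits)
      also have "\<dots> = 0"
        using set_borel_integral_eq_integral(2)[OF iv, of "max y (- real n)" "real n"]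
        by (simp add: set_lebesgue_integral_def zv)
      finally have eq: "(LINT x|lborel. indicator {y<..} x * (indicator ?I x * max 0 (1 * v x)))
          = (LINT x|lborel. indicator {y<..} x * (indicator ?I x * max 0 (- 1 * v x)))" by simp
      have e: "emeasure (density lborel (\<lambda>x. ennreal (indicator ?I x * max 0 (s * v x)))) {y<..}
          = ennreal (LINT x|lborel. indicator {y<..} x * (indicator ?I x * max 0 (s * v x)))"
        if "\<bar>s\<bar> = 1" for s
        using nn_integral_eq_integral[OF int[OF that, of y]]
        by (auto simp: emeasure_density indicator_def mult.commute intro!: nn_integral_cong
            elim!: trans[rotated])
      show "emeasure (density lborel ?p) {y<..} < \<infinity>" using e[of 1] by simp
      show "emeasure (density lborel ?p) {y<..} = emeasure (density lborel ?q) {y<..}"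
        using e[of 1] e[of "-1"] eq by simp
    qed auto
    then have "AE x in lborel. ?p x = ?q x"
      by (subst (asm) sigma_finite_measure.density_unique_iff[OF lborel.sigma_finite_measure_axioms]) auto
    then show ?thesis
      by eventually_elim (auto simp: indicator_def max_def split: if_splits)
  qed
  then have "AE x in lborel. \<forall>n. x \<in> {- real n..real n} \<longrightarrow> v x = 0"
    by (subst AE_all_countable) blast
  then have "AE x in lebesgue. \<forall>n. x \<in> {- real n..real n} \<longrightarrow> v x = 0"
    by (rule AE_completion)
  then show ?thesis
    using uv
  proof eventually_elim
    case (elim x)
    obtain n :: nat where "\<bar>x\<bar> \<le> real n" using real_arch_simple by blast
    with elim show ?case by (auto simp: abs_le_iff)
  qed
qed

lemma has_weak_deriv_unique:
  assumes "continuous_on UNIV g" "has_weak_deriv g h" "has_weak_deriv g k"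
  shows "AE x in lebesgue. h x = k x"
proof -
  have l: "locally_integrable h" "locally_integrable k" using assms by (auto simp: has_weak_deriv_def)
  have "integral {a..b} (\<lambda>x. h x - k x) = 0" for a b
  proof (cases "a \<le> b")
    case True
    then show ?thesis
      using integral_diff[OF l[THEN locally_integrable_imp_integrable_on]] weak_deriv_integral assms by simp
  qed auto
  from integral_interval_zero_imp_AE_zero[OF locally_integrable_diff[OF l] this]
  show ?thesis by simp
qed

text \<open>Fubini on the triangle \<open>a \<le> t \<le> x \<le> b\<close>; no regularity of \<open>h\<close> is available for a classical argument.\<close>

lemma integral_by_parts_primitive:
  assumes h: "set_integrable lborel {a..b} h" and ab: "a \<le> b"
    and \<phi>: "continuous_on UNIV \<phi>'" "\<And>x. (\<phi> has_real_derivative \<phi>' x) (at x)"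
  shows "integral {a..b} (\<lambda>x. integral {a..x} h * \<phi>' x) = integral {a..b} (\<lambda>t. h t * (\<phi> b - \<phi> t))"
proof -
  define H where "H t = indicat_real {a..b} t * h t" for t
  \<comment> \<open>The integrand h(t) \<phi>'(x) on the triangle: integrated first in
    \<open>t\<close> it yields the left-hand side, first in \<open>x\<close> the right-hand
    side.\<close>
  define f where "f = (\<lambda>(t, x). if t \<le> x then H t * (indicat_real {a..b} x * \<phi>' x) else 0)"
  have H: "integrable lborel H" using h by (simp add: set_integrable_def H_def[abs_def])
  have [measurable]: "H \<in> borel_measurable borel" using H by auto
  have [measurable]: "\<phi>' \<in> borel_measurable borel" using \<phi>(1) by (rule borel_measurable_continuous_onI)
  have cb: "continuous_on {u..v} \<phi>'" for u v using \<phi>(1) continuous_on_subset by blast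
  have p: "integrable lborel (\<lambda>x. indicat_real {u..v} x * \<phi>' x)" for u v
    using borel_integrable_atLeastAtMost'[OF cb, of u v] by (simp add: set_integrable_def)
  have [measurable]: "f \<in> borel_measurable (lborel \<Otimes>\<^sub>M lborel)"
    unfolding f_def by measurable
  have "integrable (lborel \<Otimes>\<^sub>M lborel) (\<lambda>(t, x). H t * (indicat_real {a..b} x * \<phi>' x))"
    by (rule lborel_pair.Fubini_integrable)
      (use H p[of a b] in \<open>auto simp: abs_mult\<close>)
  then have fi: "integrable (lborel \<Otimes>\<^sub>M lborel) f"
    by (rule Bochner_Integration.integrable_bound) (auto simp: f_def)
  have set_eq: "integral {u..v} w = (LINT x|lborel. indicator {u..v} x * w x)" if "set_integrable lborel {u..v} w" for u v :: real and w :: "real \<Rightarrow> real"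
    using set_borel_integral_eq_integral(2)[of "{u..v}" w] that by (simp add: set_lebesgue_integral_def)
  have "(LINT x|lborel. LINT t|lborel. f (t, x)) = (LINT t|lborel. LINT x|lborel. f (t, x))"
    using lborel_pair.Fubini_integral[of "\<lambda>t x. f (t, x)"] fi by simp
  moreover have "(LINT t|lborel. f (t, x)) = indicator {a..b} x * (integral {a..x} h * \<phi>' x)" for x
  proof (cases "x \<in> {a..b}")
    case True
    have "set_integrable lborel {a..x} h"
      by (rule set_integrable_subset[OF h]) (use True in auto)
    then have "integral {a..x} h = (LINT t|lborel. indicator {a..x} t * h t)" by (rule set_eq)
    moreover have "f (t, x) = indicator {a..x} t * h t * \<phi>' x" for t
      using True by (auto simp: f_def H_def indicator_def)
    ultimately show ?thesis using True by simp
  next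
    case False
    then have "indicat_real {a..b} x = 0" by simp
    then have "f (t, x) = 0" for t unfolding f_def by simp
    then show ?thesis using False by simp
  qed
  moreover have "(LINT x|lborel. f (t, x)) = indicator {a..b} t * (h t * (\<phi> b - \<phi> t))" for t
  proof (cases "t \<in> {a..b}")
    case True
    have "(\<phi>' has_integral \<phi> b - \<phi> t) {t..b}"
      by (rule fundamental_theorem_of_calculus)
        (use True \<phi>(2) in \<open>auto simp: has_real_derivative_iff_has_vector_derivative[symmetric]
          intro: has_field_derivative_at_within\<close>)
    then have "(LINT x|lborel. indicator {t..b} x * \<phi>' x) = \<phi> b - \<phi> t"
      using set_eq[OF borel_integrable_atLeastAtMost'[OF cb]] integral_unique by metis
    moreover have "f (t, x) = h t * (indicator {t..b} x * \<phi>' x)" for x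
      using True by (auto simp: f_def H_def indicator_def)
    ultimately show ?thesis using True by simp
  next
    case False
    then have "H t = 0" unfolding H_def by simp
    then have "f (t, x) = 0" for x unfolding f_def by simp
    then show ?thesis using False by simp
  qed
  ultimately have *: "(LINT x|lborel. indicator {a..b} x * (integral {a..x} h * \<phi>' x)) =
      (LINT t|lborel. indicator {a..b} t * (h t * (\<phi> b - \<phi> t)))" by simp
  have s1: "set_integrable lborel {a..b} (\<lambda>x. integral {a..x} h * \<phi>' x)"
    by (rule borel_integrable_atLeastAtMost')
      (intro continuous_intros indefinite_integral_continuous_1 set_borel_integral_eq_integral(1) h cb)
  have s2: "set_integrable lborel {a..b} (\<lambda>t. h t * (\<phi> b - \<phi> t))"
  proof -
    have c: "continuous_on {a..b} \<phi>"
      using \<phi>(2) by (rule DERIV_everywhere_imp_continuous_on)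
    have [measurable]: "\<phi> \<in> borel_measurable borel"
      using DERIV_everywhere_imp_continuous_on[OF \<phi>(2)] by (rule borel_measurable_continuous_onI)
    have "bounded ((\<lambda>t. \<phi> b - \<phi> t) ` {a..b})"
      by (intro compact_imp_bounded compact_continuous_image continuous_intros c) auto
    then obtain B where B: "\<And>t. t \<in> {a..b} \<Longrightarrow> \<bar>\<phi> b - \<phi> t\<bar> \<le> B"
      unfolding bounded_iff by (metis image_eqI real_norm_def)
    have "integrable lborel (\<lambda>t. B * H t)" using H by simp
    then show ?thesis
      unfolding set_integrable_def
    proof (rule Bochner_Integration.integrable_bound)
      show "AE t in lborel. norm (indicator {a..b} t *\<^sub>R (h t * (\<phi> b - \<phi> t))) \<le> norm (B * H t)"
      proof (intro AE_I2)
        fix t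
        show "norm (indicator {a..b} t *\<^sub>R (h t * (\<phi> b - \<phi> t))) \<le> norm (B * H t)"
          using B[of t] mult_left_mono[of "\<bar>\<phi> b - \<phi> t\<bar>" "\<bar>B\<bar>" "\<bar>h t\<bar>"]
          by (auto simp: H_def indicator_def abs_mult mult.commute)
      qed
      have "(\<lambda>t. indicator {a..b} t *\<^sub>R (h t * (\<phi> b - \<phi> t))) = (\<lambda>t. H t * (\<phi> b - \<phi> t))"
        by (auto simp: H_def)
      then show "(\<lambda>t. indicator {a..b} t *\<^sub>R (h t * (\<phi> b - \<phi> t))) \<in> borel_measurable lborel"
        by simp
    qed
  qed
  show ?thesis using * unfolding set_eq[OF s1] set_eq[OF s2] .
qed

section \<open>Primitives of locally integrable functions\<close>

lemma continuous_on_prim: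
  assumes "\<And>a b. h integrable_on {a..b}"
  shows "continuous_on A (prim h)"
proof -
  have "isCont (prim h) x" for x
  proof -
    have "continuous_on {x - 1<..<x + 1} (\<lambda>u. prim h (x - 1) + integral {x - 1..u} h)"
      by (intro continuous_intros continuous_on_subset[OF indefinite_integral_continuous_1[OF assms[of "x - 1" "x + 1"]]]) auto
    then have "continuous_on {x - 1<..<x + 1} (prim h)"
      by (rule continuous_on_eq) (simp add: prim_diff[OF assms, of "x - 1", symmetric])
    then show ?thesis by (simp add: continuous_on_eq_continuous_at)
  qed
  then show ?thesis by (simp add: continuous_at_imp_continuous_on)
qed

text \<open>On an interval [-R, R] around the support of the test function, \<open>prim h\<close> is
  a constant plus the integral from -R. The constant pairs to 0 with \<open>deriv \<phi>\<close>,
  and \<open>integral_by_parts_primitive\<close> handles the rest.\<close>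

lemma has_weak_deriv_prim:
  assumes h: "locally_integrable h"
  shows "has_weak_deriv (\<lambda>x. c + prim h x) h"
  unfolding has_weak_deriv_def
proof (intro conjI allI impI)
  note ih = locally_integrable_imp_integrable_on[OF h]
  have contg: "continuous_on UNIV (\<lambda>x. c + prim h x)"
    by (intro continuous_intros continuous_on_prim ih)
  show "locally_integrable (\<lambda>x. c + prim h x)" by (rule locally_integrable_continuous[OF contg])
  show "locally_integrable h" by fact
  fix \<phi> assume "test_function \<phi>"
  then have td: "times_differentiable k \<phi>" and cp: "compact (closure {x. \<phi> x \<noteq> 0})" for k
    by (auto simp: test_function_def)
  have d: "(\<phi> has_real_derivative deriv \<phi> x) (at x)" for x
    using times_differentiable_DERIV[OF td, of 0 1] by simp
  have d2: "(deriv \<phi> has_real_derivative deriv (deriv \<phi>) x) (at x)" for x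
    using times_differentiable_DERIV[OF td, of 1 2] by simp
  have c1: "continuous_on UNIV \<phi>" "continuous_on UNIV (deriv \<phi>)"
    using DERIV_everywhere_imp_continuous_on d d2 by blast+
  obtain r where r: "r > 0" "\<And>x. \<phi> x \<noteq> 0 \<Longrightarrow> \<bar>x\<bar> \<le> r"
    using compact_imp_bounded[OF cp] closure_subset[of "{x. \<phi> x \<noteq> 0}"]
    by (auto simp: bounded_pos subset_iff)
  \<comment> \<open>One unit beyond the support, so that \<open>\<phi>\<close> vanishes at the
    endpoints -R and R themselves.\<close>
  define R where "R = r + 1"
  have R: "\<phi> x = 0" if "\<bar>x\<bar> \<ge> R" for x using that r(2)[of x] by (auto simp: R_def)
  have R': "deriv \<phi> x = 0" if "x \<notin> {-R..R}" for x
  proof -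
    have "\<phi> y = 0" if "y \<in> - {-R..R}" for y using that by (intro R) auto
    then have "(\<phi> has_real_derivative 0) (at x)"
      by (intro has_field_derivative_transform_within_open[of "\<lambda>_. 0" 0 x "- {-R..R}" \<phi>])
        (use that in \<open>simp_all add: open_Compl\<close>)
    then show ?thesis by (rule DERIV_imp_deriv)
  qed
  have "R > 0" using r by (simp add: R_def)
  obtain v where "v \<in> borel_measurable borel" and v: "AE x in lebesgue. h x = v x"
      "\<And>a b. set_integrable lborel {a..b} v"
    using locally_integrable_borel_representative[OF h] by blast
  have iv: "v integrable_on {a..b}" for a b using set_borel_integral_eq_integral(1)[OF v(2)] .
  have hv: "integral S h = integral S v" for S by (rule AE_lebesgue_integral_cong[OF v(1)])
  have hv': "integral S (\<lambda>x. h x * \<phi> x) = integral S (\<lambda>x. v x * \<phi> x)" for S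
    by (rule AE_lebesgue_integral_cong) (use v(1) in auto)
  have "(LINT x|lebesgue. (c + prim h x) * deriv \<phi> x) = integral {-R..R} (\<lambda>x. (c + prim h x) * deriv \<phi> x)"
    using contg c1 R' by (intro LINT_supported locally_integrable_continuous continuous_on_mult) auto
  also have "\<dots> = integral {-R..R} (\<lambda>x. (c + prim h (-R)) * deriv \<phi> x + integral {-R..x} v * deriv \<phi> x)"
  proof (rule integral_cong)
    fix x assume "x \<in> {-R..R}"
    then have "prim h x = prim h (-R) + integral {-R..x} v"
      using prim_diff[OF ih, of "-R" x] hv by simp
    then show "(c + prim h x) * deriv \<phi> x = (c + prim h (-R)) * deriv \<phi> x + integral {-R..x} v * deriv \<phi> x"
      by (simp add: algebra_simps)
  qed
  also have "\<dots> = integral {-R..R} (\<lambda>x. (c + prim h (-R)) * deriv \<phi> x) + integral {-R..R} (\<lambda>x. integral {-R..x} v * deriv \<phi> x)"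
    by (intro Henstock_Kurzweil_Integration.integral_add integrable_continuous_interval continuous_intros
        indefinite_integral_continuous_1 iv continuous_on_subset[OF c1(2)]) auto
  also have "integral {-R..R} (\<lambda>x. (c + prim h (-R)) * deriv \<phi> x) = 0"
  proof -
    have "(deriv \<phi> has_integral \<phi> R - \<phi> (-R)) {-R..R}"
      by (rule fundamental_theorem_of_calculus)
        (use \<open>R > 0\<close> d in \<open>auto simp: has_real_derivative_iff_has_vector_derivative[symmetric]
          intro: has_field_derivative_at_within\<close>)
    then show ?thesis using R[of R] R[of "-R"] \<open>R > 0\<close> by (simp add: integral_unique)
  qed
  also have "integral {-R..R} (\<lambda>x. integral {-R..x} v * deriv \<phi> x) = integral {-R..R} (\<lambda>t. v t * (\<phi> R - \<phi> t))"
    by (rule integral_by_parts_primitive) (use v(2) \<open>R > 0\<close> c1 d in auto)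
  also have "\<dots> = - integral {-R..R} (\<lambda>x. h x * \<phi> x)"
    using R[of R] \<open>R > 0\<close> by (simp add: hv')
  also have "integral {-R..R} (\<lambda>x. h x * \<phi> x) = (LINT x|lebesgue. h x * \<phi> x)"
    by (rule LINT_supported[symmetric])
      (use R in \<open>auto intro!: locally_integrable_mult_continuous[OF h c1(1)]\<close>)
  finally show "(LINT x|lebesgue. (c + prim h x) * deriv \<phi> x) = - (LINT x|lebesgue. h x * \<phi> x)" by simp
qed

section \<open>The maximal inequality\<close>

text \<open>Lower semicontinuity: a supremum of continuous functions has open superlevel sets,
  however large the index set. By \<open>a i < b i\<close> no denominator vanishes.\<close>

lemma borel_measurable_SUP_quotient [measurable]:
  fixes a b c :: "'i \<Rightarrow> real"
  assumes "\<And>i. i \<in> I \<Longrightarrow> a i < b i"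
  shows "(\<lambda>x. SUP i\<in>I. ennreal (c i / (\<bar>x - a i\<bar> + \<bar>x - b i\<bar>))) \<in> borel_measurable borel"
proof (rule borel_measurableI_greater)
  fix y :: ennreal
  have "open {x. y < ennreal (c i / (\<bar>x - a i\<bar> + \<bar>x - b i\<bar>))}" if "i \<in> I" for i
  proof (rule open_Collect_less)
    have "\<bar>x - a i\<bar> + \<bar>x - b i\<bar> \<noteq> 0" for x using assms[OF that] by auto
    then show "continuous_on UNIV (\<lambda>x. ennreal (c i / (\<bar>x - a i\<bar> + \<bar>x - b i\<bar>)))"
      by (intro continuous_on_ennreal continuous_intros) auto
  qed simp
  then have "open (\<Union>i\<in>I. {x. y < ennreal (c i / (\<bar>x - a i\<bar> + \<bar>x - b i\<bar>))})" by blast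
  moreover have "{x \<in> space borel. y < (SUP i\<in>I. ennreal (c i / (\<bar>x - a i\<bar> + \<bar>x - b i\<bar>)))} =
      (\<Union>i\<in>I. {x. y < ennreal (c i / (\<bar>x - a i\<bar> + \<bar>x - b i\<bar>))})"
    by (auto simp: less_SUP_iff)
  ultimately show "{x \<in> space borel. y < (SUP i\<in>I. ennreal (c i / (\<bar>x - a i\<bar> + \<bar>x - b i\<bar>)))} \<in> sets borel"
    by simp
qed

lemma borel_measurable_sharp_maximal [measurable]:
  assumes "1 \<le> m"
  shows "sharp_maximal m E f \<in> borel_measurable borel"
  unfolding sharp_maximal_def
  by (rule borel_measurable_SUP_quotient) (use assms in \<open>auto simp: strict_mono_on_def\<close>)

text \<open>For x in [a, b] the denominator is b - a; for x outside it is at least the length of the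
  hull of x and [a, b]. For locally integrable \<open>h\<close> this is thus the uncentred
  Hardy-Littlewood maximal function, written with the denominator of
  \<open>sharp_maximal\<close>.\<close>

definition hl_max :: "(real \<Rightarrow> real) \<Rightarrow> real \<Rightarrow> ennreal" where
  "hl_max h x = (SUP I\<in>{(a, b). a < b}.
    ennreal (integral {fst I..snd I} (\<lambda>t. \<bar>h t\<bar>) / (\<bar>x - fst I\<bar> + \<bar>x - snd I\<bar>)))"

lemma borel_measurable_hl_max [measurable]: "hl_max h \<in> borel_measurable borel"
  unfolding hl_max_def by (rule borel_measurable_SUP_quotient) auto

text \<open>Stated for a countable index set because the covering lemma delivers a countable set of
  centres, not a sequence.\<close>

lemma emeasure_UN_countable_subadditive:
  assumes [measurable]: "\<And>i. i \<in> I \<Longrightarrow> X i \<in> sets M" and "countable I"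
  shows "emeasure M (\<Union>i\<in>I. X i) \<le> (\<integral>\<^sup>+i. emeasure M (X i) \<partial>count_space I)"
proof -
  have [measurable]: "(\<Union>i\<in>I. X i) \<in> sets M" using assms by (intro sets.countable_UN') auto
  have "emeasure M (\<Union>i\<in>I. X i) = (\<integral>\<^sup>+x. indicator (\<Union>i\<in>I. X i) x \<partial>M)" by simp
  also have "\<dots> \<le> (\<integral>\<^sup>+x. \<integral>\<^sup>+i. indicator (X i) x \<partial>count_space I \<partial>M)"
  proof (rule nn_integral_mono)
    fix x
    show "indicator (\<Union>i\<in>I. X i) x \<le> (\<integral>\<^sup>+i. indicator (X i) x \<partial>count_space I :: ennreal)"
    proof (cases "x \<in> (\<Union>i\<in>I. X i)")
      case True
      then obtain j where "j \<in> I" "x \<in> X j" by blast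
      then show ?thesis using nn_integral_ge_point[of j I "\<lambda>i. indicator (X i) x :: ennreal"] True by simp
    qed simp
  qed
  also have "\<dots> = (\<integral>\<^sup>+i. \<integral>\<^sup>+x. indicator (X i) x \<partial>M \<partial>count_space I)"
    by (rule nn_integral_count_space_nn_integral) (use assms in auto)
  also have "\<dots> = (\<integral>\<^sup>+i. emeasure M (X i) \<partial>count_space I)"
    by (rule nn_integral_cong) simp
  finally show ?thesis .
qed

text \<open>Vitali covering. Each point of the superlevel set has an interval [a, b] whose |h|-mass
  exceeds l r with r = |x - a| + |x - b|, and [a, b] lies in the ball of radius r around x. The
  total mass bounds the radii, so disjoint balls can be selected whose 5-fold dilates cover; a
  dilate has length 10 r, hence the factor 10 / l.\<close>

lemma hl_max_weak_type:
  assumes h: "integrable lborel h" and l: "0 < l"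
  shows "emeasure lborel {x. ennreal l < hl_max h x} \<le> ennreal (10 / l) * (\<integral>\<^sup>+x. ennreal \<bar>h x\<bar> \<partial>lborel)"
proof -
  define K where "K = {x. ennreal l < hl_max h x}"
  define A where "A = (LINT x|lborel. \<bar>h x\<bar>)"
  define \<nu> where "\<nu> = density lborel (\<lambda>x. ennreal \<bar>h x\<bar>)"
  have [measurable]: "h \<in> borel_measurable borel" using h by auto
  have nuI: "emeasure \<nu> {a..b} = ennreal (integral {a..b} (\<lambda>t. \<bar>h t\<bar>))" for a b
  proof -
    have i: "integrable lborel (\<lambda>x. indicator {a..b} x * \<bar>h x\<bar>)"
      using integrable_mult_indicator[of "{a..b}" lborel "\<lambda>x. \<bar>h x\<bar>"] h by simp
    then have "set_integrable lborel {a..b} (\<lambda>x. \<bar>h x\<bar>)" by (simp add: set_integrable_def)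
    from set_borel_integral_eq_integral(2)[OF this]
    have "integral {a..b} (\<lambda>t. \<bar>h t\<bar>) = (LINT x|lborel. indicator {a..b} x * \<bar>h x\<bar>)"
      by (simp add: set_lebesgue_integral_def)
    moreover have "emeasure \<nu> {a..b} = (\<integral>\<^sup>+x. ennreal (indicator {a..b} x * \<bar>h x\<bar>) \<partial>lborel)"
      unfolding \<nu>_def by (subst emeasure_density) (auto intro!: nn_integral_cong simp: indicator_def)
    ultimately show ?thesis using nn_integral_eq_integral[OF i] by simp
  qed
  have nuU: "emeasure \<nu> UNIV = ennreal A"
    unfolding \<nu>_def A_def using nn_integral_eq_integral[of lborel "\<lambda>x. \<bar>h x\<bar>"] h by (simp add: emeasure_density)
  have A: "A \<ge> 0" by (simp add: A_def)
  have "\<exists>a b. a < b \<and> l * (\<bar>x - a\<bar> + \<bar>x - b\<bar>) < integral {a..b} (\<lambda>t. \<bar>h t\<bar>)" if "x \<in> K" for x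
  proof -
    from that obtain a b where ab: "a < b"
      "ennreal l < ennreal (integral {a..b} (\<lambda>t. \<bar>h t\<bar>) / (\<bar>x - a\<bar> + \<bar>x - b\<bar>))"
      unfolding K_def hl_max_def by (auto simp: less_SUP_iff)
    moreover from this have "0 < \<bar>x - a\<bar> + \<bar>x - b\<bar>" by auto
    ultimately show ?thesis using l by (intro exI[of _ a] exI[of _ b]) (auto simp: ennreal_less_iff field_simps)
  qed
  then obtain a b where ab: "\<And>x. x \<in> K \<Longrightarrow> a x < b x"
    "\<And>x. x \<in> K \<Longrightarrow> l * (\<bar>x - a x\<bar> + \<bar>x - b x\<bar>) < integral {a x..b x} (\<lambda>t. \<bar>h t\<bar>)" by metis
  define r where "r x = \<bar>x - a x\<bar> + \<bar>x - b x\<bar>" for x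
  have r: "0 < r x" if "x \<in> K" for x using ab(1)[OF that] by (auto simp: r_def)
  have sub: "{a x..b x} \<subseteq> cball x (r x)" if "x \<in> K" for x
    using ab(1)[OF that] by (auto simp: r_def dist_real_def)
  have lr: "ennreal (l * r x) \<le> emeasure \<nu> (cball x (r x))" if "x \<in> K" for x
  proof -
    have "ennreal (l * r x) \<le> emeasure \<nu> {a x..b x}"
      unfolding nuI r_def using ab(2)[OF that] by (intro ennreal_leI) simp
    also have "\<dots> \<le> emeasure \<nu> (cball x (r x))"
      using sub[OF that] by (intro emeasure_mono) (auto simp: \<nu>_def)
    finally show ?thesis .
  qed
  have rB: "r x \<le> A / l" if "x \<in> K" for x
  proof -
    have "ennreal (l * r x) \<le> ennreal A"
      using order_trans[OF lr[OF that] emeasure_mono[of "cball x (r x)" UNIV \<nu>]] nuU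
      by (simp add: \<nu>_def)
    then show ?thesis using A l by (simp add: ennreal_le_iff field_simps)
  qed
  have "K \<subseteq> (\<Union>x\<in>K. cball x (r x))" using r by (force intro: less_imp_le)
  then obtain C where C: "countable C" "C \<subseteq> K"
     "pairwise (\<lambda>i j. disjnt (cball i (r i)) (cball j (r j))) C"
     "K \<subseteq> (\<Union>i\<in>C. cball i (5 * r i))"
    by (rule Vitali_covering_lemma_cballs[of K "\<lambda>x. x" r K "A / l"]) (use r rB in auto)
  have "emeasure lborel K \<le> emeasure lborel (\<Union>i\<in>C. cball i (5 * r i))"
    using C by (intro emeasure_mono sets.countable_UN') auto
  also have "\<dots> \<le> (\<integral>\<^sup>+i. emeasure lborel (cball i (5 * r i)) \<partial>count_space C)"
    by (rule emeasure_UN_countable_subadditive) (use C in auto)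
  also have "\<dots> \<le> (\<integral>\<^sup>+i. ennreal (10 / l) * emeasure \<nu> (cball i (r i)) \<partial>count_space C)"
  proof (rule nn_integral_mono)
    fix i assume "i \<in> space (count_space C)"
    then have i: "i \<in> K" using C by auto
    have "emeasure lborel (cball i (5 * r i)) = ennreal (10 / l) * ennreal (l * r i)"
      using r[OF i] l by (simp add: cball_eq_atLeastAtMost flip: ennreal_mult)
    also have "\<dots> \<le> ennreal (10 / l) * emeasure \<nu> (cball i (r i))"
      using lr[OF i] by (rule mult_left_mono) simp
    finally show "emeasure lborel (cball i (5 * r i)) \<le> ennreal (10 / l) * emeasure \<nu> (cball i (r i))" .
  qed
  also have "\<dots> = ennreal (10 / l) * (\<integral>\<^sup>+i. emeasure \<nu> (cball i (r i)) \<partial>count_space C)"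
    by (rule nn_integral_cmult) simp
  also have "(\<integral>\<^sup>+i. emeasure \<nu> (cball i (r i)) \<partial>count_space C) = emeasure \<nu> (\<Union>i\<in>C. cball i (r i))"
    using C by (intro emeasure_UN_countable[symmetric])
      (auto simp: \<nu>_def disjoint_family_on_def pairwise_def disjnt_def)
  also have "ennreal (10 / l) * \<dots> \<le> ennreal (10 / l) * emeasure \<nu> UNIV"
    by (intro mult_left_mono emeasure_mono) (auto simp: \<nu>_def)
  also have "emeasure \<nu> UNIV = (\<integral>\<^sup>+x. ennreal \<bar>h x\<bar> \<partial>lborel)"
    by (simp add: \<nu>_def emeasure_density)
  finally show ?thesis by (simp add: K_def)
qed

section \<open>From the weak type to the strong type inequality\<close>

lemma nn_integral_powr_interval:
  assumes "a > -1" "0 \<le> y"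
  shows "(\<integral>\<^sup>+x. ennreal (x powr a) * indicator {0<..<y} x \<partial>lborel) = ennreal (y powr (a + 1) / (a + 1))"
proof -
  have "((\<lambda>x. x powr a * indicator {0<..<y} x) has_integral y powr (a + 1) / (a + 1)) {0..y}"
    by (rule has_integral_spike[OF _ _ has_integral_powr_from_0[OF assms], of "{0, y}"]) auto
  then have "((\<lambda>x. x powr a * indicator {0<..<y} x) has_integral y powr (a + 1) / (a + 1)) UNIV"
    by (rule has_integral_on_superset) auto
  from nn_integral_has_integral_lborel[OF _ _ this]
  show ?thesis
    by (auto simp: ennreal_mult' ennreal_indicator indicator_def intro!: nn_integral_cong elim!: trans[rotated])
qed

text \<open>Integrating p l^(p-1) over (0, y) gives y^p for every finite y \<le> N; an infinite
  \<open>N\<close> is exhausted by such y.\<close>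

lemma epowr_le_layer_cake:
  assumes p: "1 < p"
  shows "epowr N p \<le> (\<integral>\<^sup>+l. ennreal (p * l powr (p - 1)) * indicator {l. 0 < l \<and> ennreal l < N} l \<partial>lborel)"
    (is "_ \<le> ?R")
proof -
  have *: "ennreal (y powr p) \<le> ?R" if "ennreal y \<le> N" "0 \<le> y" for y
  proof -
    have "ennreal (y powr p) = ennreal p * (\<integral>\<^sup>+x. ennreal (x powr (p - 1)) * indicator {0<..<y} x \<partial>lborel)"
      using nn_integral_powr_interval[of "p - 1" y] p that by (simp flip: ennreal_mult)
    also have "\<dots> = (\<integral>\<^sup>+x. ennreal p * (ennreal (x powr (p - 1)) * indicator {0<..<y} x) \<partial>lborel)"
      by (rule nn_integral_cmult[symmetric]) simp
    also have "\<dots> \<le> ?R"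
    proof (rule nn_integral_mono)
      fix l
      have "ennreal l < N" if "0 < l" "l < y"
        using that \<open>ennreal y \<le> N\<close> by (meson ennreal_lessI order_less_le_trans order_less_trans)
      then show "ennreal p * (ennreal (l powr (p - 1)) * indicator {0<..<y} l)
          \<le> ennreal (p * l powr (p - 1)) * indicator {l. 0 < l \<and> ennreal l < N} l"
        using p by (auto simp: indicator_def ennreal_mult')
    qed
    finally show ?thesis .
  qed
  show ?thesis
  proof (cases N)
    case (real y)
    then show ?thesis using *[of y] by (simp add: epowr_def)
  next
    case top
    have "ennreal (real n) \<le> ?R" for n
    proof -
      have "ennreal (real n) \<le> ennreal ((real n + 1) powr p)"
        using p powr_mono[of 1 p "real n + 1"] by (intro ennreal_leI) auto
      also have "\<dots> \<le> ?R" by (rule *) (auto simp: top)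
      finally show ?thesis .
    qed
    note le = this
    have "?R = top"
    proof (rule ccontr)
      assume "?R \<noteq> top"
      then obtain r where r: "?R = ennreal r" "0 \<le> r" by (cases ?R) auto
      obtain n where "r < real n" using reals_Archimedean2 by blast
      with le[of n] r show False by (simp add: ennreal_le_iff)
    qed
    then show ?thesis by simp
  qed
qed

text \<open>Cutting off the values of |h| up to l/2 changes the maximal function by at most l/2,
  since b - a never exceeds the denominator. The truncation \<open>k\<close> must then exceed level
  l/2, where the weak type bound has the factor 10 / (l/2) = 20 / l.\<close>

lemma hl_max_truncated_weak_type:
  assumes h [measurable]: "h \<in> borel_measurable borel" and p: "1 < p" and l: "0 < l"
    and fin: "(\<integral>\<^sup>+x. ennreal (\<bar>h x\<bar> powr p) \<partial>lborel) < \<infinity>"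
  shows "emeasure lborel {x. ennreal l < hl_max h x} \<le>
    ennreal (20 / l) * (\<integral>\<^sup>+x. ennreal \<bar>h x\<bar> * indicator {x. l < 2 * \<bar>h x\<bar>} x \<partial>lborel)"
proof -
  define k where "k x = h x * indicator {x. l < 2 * \<bar>h x\<bar>} x" for x
  have [measurable]: "k \<in> borel_measurable borel" by (simp add: k_def[abs_def])
  have ip: "integrable lborel (\<lambda>x. \<bar>h x\<bar> powr p)"
    using fin by (intro integrableI_nonneg) auto
  \<comment> \<open>Where |h| > l/2, the factor |h|^(1 - p) is at most (l/2)^(1 - p); so the
    truncation is dominated by a multiple of |h|^p.\<close>
  have k: "integrable lborel k"
  proof (rule Bochner_Integration.integrable_bound[OF integrable_mult_right[OF ip, of "(l / 2) powr (1 - p)"]])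
    show "AE x in lborel. norm (k x) \<le> norm ((l / 2) powr (1 - p) * \<bar>h x\<bar> powr p)"
    proof (rule AE_I2)
      fix x
      show "norm (k x) \<le> norm ((l / 2) powr (1 - p) * \<bar>h x\<bar> powr p)"
      proof (cases "l < 2 * \<bar>h x\<bar>")
        case True
        then have "\<bar>h x\<bar> powr (1 - p) \<le> (l / 2) powr (1 - p)"
          using l p by (intro powr_mono2') auto
        then have "\<bar>h x\<bar> powr (1 - p) * \<bar>h x\<bar> powr p \<le> (l / 2) powr (1 - p) * \<bar>h x\<bar> powr p"
          by (rule mult_right_mono) simp
        then show ?thesis using True l by (simp add: k_def flip: powr_add)
      qed (simp add: k_def)
    qed
  qed simp
  have int: "(\<lambda>x. \<bar>k x\<bar>) integrable_on {a..b}" "(\<lambda>x. \<bar>h x\<bar>) integrable_on {a..b}" for a b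
  proof -
    have sk: "set_integrable lborel {a..b} (\<lambda>x. \<bar>k x\<bar>)"
      unfolding set_integrable_def by (rule integrable_mult_indicator) (use k in auto)
    then show "(\<lambda>x. \<bar>k x\<bar>) integrable_on {a..b}" by (rule set_borel_integral_eq_integral)
    have "set_integrable lborel {a..b} (\<lambda>x. \<bar>k x\<bar> + l / 2)"
      by (rule set_integral_add(1)[OF sk borel_integrable_atLeastAtMost']) simp
    then have "set_integrable lborel {a..b} (\<lambda>x. \<bar>h x\<bar>)"
      by (rule set_integrable_bound) (use l in \<open>auto simp: k_def indicator_def set_borel_measurable_def\<close>)
    then show "(\<lambda>x. \<bar>h x\<bar>) integrable_on {a..b}" by (rule set_borel_integral_eq_integral)
  qed
  have le: "hl_max h x \<le> hl_max k x + ennreal (l / 2)" for x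
    unfolding hl_max_def[of h]
  proof (rule SUP_least, clarify)
    fix a b :: real assume ab: "a < b"
    define D where "D = \<bar>x - a\<bar> + \<bar>x - b\<bar>"
    have D: "D > 0" "b - a \<le> D" using ab by (auto simp: D_def)
    have "integral {a..b} (\<lambda>t. \<bar>h t\<bar>) \<le> integral {a..b} (\<lambda>t. \<bar>k t\<bar> + l / 2)"
      using l by (intro integral_le integrable_add int) (auto simp: k_def indicator_def)
    also have "\<dots> = integral {a..b} (\<lambda>t. \<bar>k t\<bar>) + l / 2 * (b - a)"
      using ab by (subst Henstock_Kurzweil_Integration.integral_add[OF int(1)]) auto
    also have "\<dots> \<le> integral {a..b} (\<lambda>t. \<bar>k t\<bar>) + l / 2 * D" using D l by simp
    finally have "integral {a..b} (\<lambda>t. \<bar>h t\<bar>) / D \<le> integral {a..b} (\<lambda>t. \<bar>k t\<bar>) / D + l / 2"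
      using D by (simp add: field_simps)
    then have "ennreal (integral {a..b} (\<lambda>t. \<bar>h t\<bar>) / D) \<le> ennreal (integral {a..b} (\<lambda>t. \<bar>k t\<bar>) / D + l / 2)"
      by (rule ennreal_leI)
    also have "\<dots> = ennreal (integral {a..b} (\<lambda>t. \<bar>k t\<bar>) / D) + ennreal (l / 2)"
      using D l int by (intro ennreal_plus divide_nonneg_nonneg integral_nonneg) auto
    also have "\<dots> \<le> hl_max k x + ennreal (l / 2)"
      unfolding hl_max_def by (intro add_right_mono SUP_upper2[of "(a, b)"]) (use ab in \<open>auto simp: D_def\<close>)
    finally show "ennreal (integral {fst (a, b)..snd (a, b)} (\<lambda>t. \<bar>h t\<bar>) /
        (\<bar>x - fst (a, b)\<bar> + \<bar>x - snd (a, b)\<bar>)) \<le> hl_max k x + ennreal (l / 2)" by (simp add: D_def)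
  qed
  have "{x. ennreal l < hl_max h x} \<subseteq> {x. ennreal (l / 2) < hl_max k x}"
  proof clarify
    fix x assume "ennreal l < hl_max h x"
    then have "ennreal (l / 2) + ennreal (l / 2) < hl_max k x + ennreal (l / 2)"
      using le[of x] l by (simp flip: ennreal_plus)
    then show "ennreal (l / 2) < hl_max k x" by (metis add_right_mono not_less)
  qed
  then have "emeasure lborel {x. ennreal l < hl_max h x} \<le> emeasure lborel {x. ennreal (l / 2) < hl_max k x}"
    by (intro emeasure_mono) measurable
  also have "\<dots> \<le> ennreal (10 / (l / 2)) * (\<integral>\<^sup>+x. ennreal \<bar>k x\<bar> \<partial>lborel)"
    using l by (intro hl_max_weak_type k) auto
  also have "(\<integral>\<^sup>+x. ennreal \<bar>k x\<bar> \<partial>lborel) = (\<integral>\<^sup>+x. ennreal \<bar>h x\<bar> * indicator {x. l < 2 * \<bar>h x\<bar>} x \<partial>lborel)"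
    by (intro nn_integral_cong) (auto simp: k_def indicator_def)
  finally show ?thesis by simp
qed

text \<open>After exchanging the integrals, the level integral of l^(p-2) over (0, 2|h|) remains. It
  converges at 0 because p > 1 and equals (2|h|)^(p-1) / (p-1), which explains the constant.\<close>

theorem hl_max_strong_type:
  assumes h [measurable]: "h \<in> borel_measurable borel" and p: "1 < p"
    and fin: "(\<integral>\<^sup>+x. ennreal (\<bar>h x\<bar> powr p) \<partial>lborel) < \<infinity>"
  shows "(\<integral>\<^sup>+x. epowr (hl_max h x) p \<partial>lborel) \<le>
    ennreal (20 * p * 2 powr (p - 1) / (p - 1)) * (\<integral>\<^sup>+x. ennreal (\<bar>h x\<bar> powr p) \<partial>lborel)"
proof -
  define w where "w l = ennreal (p * l powr (p - 1))" for l
  have [measurable]: "w \<in> borel_measurable borel" by (simp add: w_def[abs_def])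
  have "(\<integral>\<^sup>+x. epowr (hl_max h x) p \<partial>lborel) \<le>
      (\<integral>\<^sup>+x. \<integral>\<^sup>+l. w l * indicator {l. 0 < l \<and> ennreal l < hl_max h x} l \<partial>lborel \<partial>lborel)"
    unfolding w_def by (intro nn_integral_mono epowr_le_layer_cake p)
  also have "\<dots> = (\<integral>\<^sup>+l. \<integral>\<^sup>+x. w l * indicator {l. 0 < l \<and> ennreal l < hl_max h x} l \<partial>lborel \<partial>lborel)"
    by (intro lborel_pair.Fubini') measurable
  also have "\<dots> \<le> (\<integral>\<^sup>+l. \<integral>\<^sup>+x. ennreal (20 * p * \<bar>h x\<bar>) * (ennreal (l powr (p - 2)) * indicator {0<..<2 * \<bar>h x\<bar>} l) \<partial>lborel \<partial>lborel)"
  proof (rule nn_integral_mono)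
    fix l :: real
    show "(\<integral>\<^sup>+x. w l * indicator {l. 0 < l \<and> ennreal l < hl_max h x} l \<partial>lborel)
      \<le> (\<integral>\<^sup>+x. ennreal (20 * p * \<bar>h x\<bar>) * (ennreal (l powr (p - 2)) * indicator {0<..<2 * \<bar>h x\<bar>} l) \<partial>lborel)"
    proof (cases "0 < l")
      case True
      have "(\<integral>\<^sup>+x. w l * indicator {l. 0 < l \<and> ennreal l < hl_max h x} l \<partial>lborel)
          = (\<integral>\<^sup>+x. w l * indicator {x. ennreal l < hl_max h x} x \<partial>lborel)"
        using True by (intro nn_integral_cong) (auto simp: indicator_def)
      also have "\<dots> = w l * emeasure lborel {x. ennreal l < hl_max h x}"
        by (subst nn_integral_cmult) auto
      also have "\<dots> \<le> w l * (ennreal (20 / l) * (\<integral>\<^sup>+x. ennreal \<bar>h x\<bar> * indicator {x. l < 2 * \<bar>h x\<bar>} x \<partial>lborel))"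
        by (intro mult_left_mono hl_max_truncated_weak_type[OF h p True fin]) simp
      also have "\<dots> = (\<integral>\<^sup>+x. w l * ennreal (20 / l) * (ennreal \<bar>h x\<bar> * indicator {x. l < 2 * \<bar>h x\<bar>} x) \<partial>lborel)"
        by (subst nn_integral_cmult) (auto simp: mult.assoc)
      also have "\<dots> = (\<integral>\<^sup>+x. ennreal (20 * p * \<bar>h x\<bar>) * (ennreal (l powr (p - 2)) * indicator {0<..<2 * \<bar>h x\<bar>} l) \<partial>lborel)"
      proof (rule nn_integral_cong)
        fix x
        have "p * l powr (p - 1) * (20 / l) * \<bar>h x\<bar> = 20 * p * \<bar>h x\<bar> * l powr (p - 2)"
          using True by (simp add: powr_diff powr_numeral power2_eq_square field_simps)
        then have "w l * ennreal (20 / l) * ennreal \<bar>h x\<bar> = ennreal (20 * p * \<bar>h x\<bar>) * ennreal (l powr (p - 2))"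
          using True p by (simp add: w_def flip: ennreal_mult)
        then show "w l * ennreal (20 / l) * (ennreal \<bar>h x\<bar> * indicator {x. l < 2 * \<bar>h x\<bar>} x)
            = ennreal (20 * p * \<bar>h x\<bar>) * (ennreal (l powr (p - 2)) * indicator {0<..<2 * \<bar>h x\<bar>} l)"
          using True by (auto simp: indicator_def mult.assoc)
      qed
      finally show ?thesis .
    qed simp
  qed
  also have "\<dots> = (\<integral>\<^sup>+x. \<integral>\<^sup>+l. ennreal (20 * p * \<bar>h x\<bar>) * (ennreal (l powr (p - 2)) * indicator {0<..<2 * \<bar>h x\<bar>} l) \<partial>lborel \<partial>lborel)"
    unfolding indicator_def greaterThanLessThan_iff by (intro lborel_pair.Fubini') measurable
  also have "\<dots> = (\<integral>\<^sup>+x. ennreal (20 * p * 2 powr (p - 1) / (p - 1)) * ennreal (\<bar>h x\<bar> powr p) \<partial>lborel)"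
  proof (rule nn_integral_cong)
    fix x
    have "(\<integral>\<^sup>+l. ennreal (20 * p * \<bar>h x\<bar>) * (ennreal (l powr (p - 2)) * indicator {0<..<2 * \<bar>h x\<bar>} l) \<partial>lborel)
        = ennreal (20 * p * \<bar>h x\<bar>) * ennreal ((2 * \<bar>h x\<bar>) powr (p - 1) / (p - 1))"
      using nn_integral_powr_interval[of "p - 2" "2 * \<bar>h x\<bar>"] p by (subst nn_integral_cmult) auto
    also have "\<dots> = ennreal (20 * p * 2 powr (p - 1) / (p - 1) * (\<bar>h x\<bar> * \<bar>h x\<bar> powr (p - 1)))"
      using p by (subst ennreal_mult[symmetric]) (auto simp: powr_mult mult_ac)
    also have "\<bar>h x\<bar> * \<bar>h x\<bar> powr (p - 1) = \<bar>h x\<bar> powr p"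
      by (cases "h x = 0") (auto simp: powr_diff)
    finally show "(\<integral>\<^sup>+l. ennreal (20 * p * \<bar>h x\<bar>) * (ennreal (l powr (p - 2)) * indicator {0<..<2 * \<bar>h x\<bar>} l) \<partial>lborel)
        = ennreal (20 * p * 2 powr (p - 1) / (p - 1)) * ennreal (\<bar>h x\<bar> powr p)"
      using p by (subst ennreal_mult[symmetric]) auto
  qed
  also have "\<dots> = ennreal (20 * p * 2 powr (p - 1) / (p - 1)) * (\<integral>\<^sup>+x. ennreal (\<bar>h x\<bar> powr p) \<partial>lborel)"
    by (rule nn_integral_cmult) measurable
  finally show ?thesis .
qed

section \<open>Divided differences and interpolation on finite sets\<close>

text \<open>The denominators are those of \<open>divided_diff\<close> and the remaining products are
  monic, so the coefficient of degree \<open>k\<close> is visibly the divided difference.\<close>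

definition lagrange :: "nat \<Rightarrow> (real \<Rightarrow> real) \<Rightarrow> (nat \<Rightarrow> real) \<Rightarrow> real poly" where
  "lagrange k f z =
    (\<Sum>i\<le>k. smult (f (z i) / (\<Prod>j\<in>{..k} - {i}. z i - z j)) (\<Prod>j\<in>{..k} - {i}. [:- z j, 1:]))"

lemma monic_prod_linear:
  fixes z :: "nat \<Rightarrow> real"
  assumes "finite A"
  shows "degree (\<Prod>j\<in>A. [:- z j, 1:]) = card A \<and> coeff (\<Prod>j\<in>A. [:- z j, 1:]) (card A) = 1"
  using assms
proof (induction A rule: finite_induct)
  case (insert a A)
  then have "(\<Prod>j\<in>A. [:- z j, 1:]) \<noteq> 0" by (metis coeff_0 zero_neq_one)
  moreover have "lead_coeff ([:- z a, 1:] * (\<Prod>j\<in>A. [:- z j, 1:])) = 1"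
    using insert by (simp only: lead_coeff_mult) simp
  moreover have "degree ([:- z a, 1:] * (\<Prod>j\<in>A. [:- z j, 1:])) = Suc (card A)"
    using insert \<open>_ \<noteq> 0\<close> by (subst degree_mult_eq) auto
  ultimately show ?case using insert(1,2) by (simp only: prod.insert card_insert_disjoint simp_thms)
qed auto

lemma degree_lagrange: "degree (lagrange k f z) \<le> k"
  unfolding lagrange_def
  by (intro degree_sum_le order_trans[OF degree_smult_le]) (auto simp: monic_prod_linear)

lemma coeff_lagrange: "coeff (lagrange k f z) k = divided_diff k f z"
proof -
  have "coeff (\<Prod>j\<in>{..k} - {i}. [:- z j, 1:]) k = 1" if "i \<le> k" for i
    using monic_prod_linear[of "{..k} - {i}" z] that by simp
  then show ?thesis by (simp add: lagrange_def coeff_sum divided_diff_def)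
qed

lemma poly_lagrange:
  assumes z: "inj_on z {..k}" and i: "i \<le> k"
  shows "poly (lagrange k f z) (z i) = f (z i)"
proof -
  have "poly (lagrange k f z) (z i) =
    (\<Sum>l\<le>k. f (z l) / (\<Prod>j\<in>{..k} - {l}. z l - z j) * (\<Prod>j\<in>{..k} - {l}. z i - z j))"
    by (simp add: lagrange_def poly_sum poly_prod)
  also have "\<dots> = (\<Sum>l\<le>k. if l = i then f (z i) else 0)"
  proof (rule sum.cong)
    fix l assume l: "l \<in> {..k}"
    show "f (z l) / (\<Prod>j\<in>{..k} - {l}. z l - z j) * (\<Prod>j\<in>{..k} - {l}. z i - z j)
        = (if l = i then f (z i) else 0)"
    proof (cases "l = i")
      case True
      have "z i - z j \<noteq> 0" if "j \<in> {..k} - {i}" for j using z i that by (auto simp: inj_on_def)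
      then have "(\<Prod>j\<in>{..k} - {i}. z i - z j) \<noteq> 0" by simp
      then show ?thesis using True by simp
    next
      case False
      then have "(\<Prod>j\<in>{..k} - {l}. z i - z j) = 0" using i by (intro prod_zero) auto
      then show ?thesis using False by simp
    qed
  qed simp
  finally show ?thesis using i by simp
qed

text \<open>One statement for the two root counts that occur: more than \<open>k\<close> roots in
  degree at most \<open>k\<close> (uniqueness of interpolation), or \<open>k\<close> roots when the
  coefficient of degree \<open>k\<close> cancels (comparison of neighbouring windows).\<close>

lemma poly_eq_0_if_roots:
  fixes q :: "real poly" and z :: "nat \<Rightarrow> real"
  assumes "degree q \<le> k" "coeff q k = 0 \<or> card A > k" "finite A" "inj_on z A" "card A \<ge> k"
    "\<And>i. i \<in> A \<Longrightarrow> poly q (z i) = 0"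
  shows "q = 0"
proof (rule ccontr)
  assume "q \<noteq> 0"
  have "card A = card (z ` A)" using assms by (simp add: card_image)
  also have "\<dots> \<le> card {x. poly q x = 0}"
    by (intro card_mono poly_roots_finite \<open>q \<noteq> 0\<close>) (use assms in auto)
  also have "\<dots> \<le> degree q" by (rule card_poly_roots_bound) fact
  finally have "card A \<le> degree q" .
  then have "degree q = k" "coeff q k = 0" using assms by auto
  then show False using \<open>q \<noteq> 0\<close> leading_coeff_0_iff by blast
qed

lemma lagrange_unique:
  assumes "inj_on z {..k}" "degree q \<le> k" "\<And>i. i \<le> k \<Longrightarrow> poly q (z i) = f (z i)"
  shows "q = lagrange k f z"
proof -
  have "q - lagrange k f z = 0"
    by (rule poly_eq_0_if_roots[where A="{..k}" and k=k and z=z])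
      (use assms degree_lagrange poly_lagrange in \<open>auto intro: degree_diff_le\<close>)
  then show ?thesis by simp
qed

text \<open>Both interpolants take the values of \<open>f\<close> at the shared nodes z 1, ..., z (m
  - 1), so their difference is a multiple of the monic polynomial of degree m - 1 with these roots.
  The factor, a difference of leading coefficients, is up to sign the numerator in
  \<open>sharp_maximal\<close>.\<close>

lemma lagrange_Suc_shift:
  assumes z: "inj_on z {..m}" and m: "1 \<le> m"
  shows "lagrange (m - 1) f (\<lambda>i. z (Suc i)) = lagrange (m - 1) f z +
    smult (divided_diff (m - 1) f (\<lambda>i. z (Suc i)) - divided_diff (m - 1) f z) (\<Prod>j\<in>{1..<m}. [:- z j, 1:])"
    (is "?L1 = ?L0 + smult ?d ?W")
proof -
  have W: "degree ?W = m - 1" "coeff ?W (m - 1) = 1" using monic_prod_linear[of "{1..<m}" z] by auto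
  have "?L1 - ?L0 - smult ?d ?W = 0"
  proof (rule poly_eq_0_if_roots[where A="{1..<m}" and k="m - 1" and z=z])
    show "degree (?L1 - ?L0 - smult ?d ?W) \<le> m - 1"
      using W by (intro degree_diff_le degree_lagrange order_trans[OF degree_smult_le]) auto
    show "coeff (?L1 - ?L0 - smult ?d ?W) (m - 1) = 0 \<or> m - 1 < card {1..<m}"
      using W by (simp add: coeff_lagrange)
    show "inj_on z {1..<m}" using z by (rule inj_on_subset) auto
    fix i assume i: "i \<in> {1..<m}"
    have "poly ?W (z i) = 0" using i by (auto simp: poly_prod intro!: prod_zero)
    moreover have "poly ?L0 (z i) = f (z i)"
      by (rule poly_lagrange) (use i inj_on_subset[OF z] in auto)
    moreover have "inj_on (\<lambda>i. z (Suc i)) {..m - 1}"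
      using m by (intro inj_onI) (auto dest!: inj_onD[OF z])
    from poly_lagrange[OF this, of "i - 1"] have "poly ?L1 (z i) = f (z i)" using i by auto
    ultimately show "poly (?L1 - ?L0 - smult ?d ?W) (z i) = 0" by simp
  qed auto
  then show ?thesis by (simp add: algebra_simps)
qed

section \<open>The mean value theorem for divided differences\<close>

lemma Rolle_iterated:
  assumes "\<And>j x. j < k \<Longrightarrow> (D j has_real_derivative D (Suc j) x) (at x)"
    and "strict_mono_on {..k} z" and "\<And>i. i \<le> k \<Longrightarrow> D 0 (z i) = 0"
  shows "\<exists>\<xi>\<in>{z 0..z k}. D k \<xi> = 0"
  using assms
proof (induction k arbitrary: D z)
  case 0
  then show ?case by auto
next
  case (Suc k)
  have lt: "z i < z (Suc i)" if "i \<le> k" for i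
    using Suc.prems(2) that by (auto simp: strict_mono_on_def)
  have "\<exists>w. z i < w \<and> w < z (Suc i) \<and> D 1 w = 0" if "i \<le> k" for i
  proof -
    have d: "(D 0 has_real_derivative D 1 x) (at x)" for x using Suc.prems(1)[of 0] by simp
    then have "continuous_on {z i..z (Suc i)} (D 0)"
      by (auto intro!: DERIV_continuous_on intro: has_field_derivative_at_within)
    from Rolle[OF lt[OF that] _ this] Suc.prems(3)[of i] Suc.prems(3)[of "Suc i"] that
    obtain w where "z i < w" "w < z (Suc i)" "(D 0 has_real_derivative 0) (at w)"
      using d real_differentiable_def by auto
    then show ?thesis using DERIV_unique[OF d] by blast
  qed
  then obtain w where w: "\<And>i. i \<le> k \<Longrightarrow> z i < w i \<and> w i < z (Suc i) \<and> D 1 (w i) = 0"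
    by metis
  have zle: "z i \<le> z j" if "i \<le> j" "j \<le> Suc k" for i j
    using Suc.prems(2) that by (cases "i = j") (auto simp: strict_mono_on_def less_imp_le)
  have "\<exists>\<xi>\<in>{w 0..w k}. D (Suc k) \<xi> = 0"
  proof (rule Suc.IH[of "\<lambda>j. D (Suc j)"])
    show "strict_mono_on {..k} w"
    proof (rule strict_mono_onI)
      fix r s assume "r \<in> {..k}" "s \<in> {..k}" "r < s"
      then show "w r < w s" using w[of r] w[of s] zle[of "Suc r" s] by auto
    qed
  qed (use w Suc.prems in auto)
  then show ?case using w[of 0] w[of k] by fastforce
qed

text \<open>Rolle applied to \<open>D 0\<close> minus its interpolating polynomial, whose k-th
  derivative is the constant k! times the leading coefficient.\<close>

lemma divided_diff_mean_value:
  assumes D: "\<And>j x. j < k \<Longrightarrow> (D j has_real_derivative D (Suc j) x) (at x)"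
    and z: "strict_mono_on {..k} z"
  shows "\<exists>\<xi>\<in>{z 0..z k}. D k \<xi> = fact k * divided_diff k (D 0) z"
proof -
  define L where "L = lagrange k (D 0) z"
  have "\<exists>\<xi>\<in>{z 0..z k}. D k \<xi> - poly ((pderiv ^^ k) L) \<xi> = 0"
  proof (rule Rolle_iterated[where D="\<lambda>j x. D j x - poly ((pderiv ^^ j) L) x"])
    show "((\<lambda>x. D j x - poly ((pderiv ^^ j) L) x) has_real_derivative
        D (Suc j) x - poly ((pderiv ^^ Suc j) L) x) (at x)" if "j < k" for j x
      by (auto intro!: derivative_eq_intros D that)
    show "D 0 (z i) - poly ((pderiv ^^ 0) L) (z i) = 0" if "i \<le> k" for i
      using poly_lagrange[OF strict_mono_on_imp_inj_on[OF z] that] by (simp add: L_def)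
  qed fact
  moreover have "poly ((pderiv ^^ k) L) x = fact k * divided_diff k (D 0) z" for x
  proof -
    have "degree ((pderiv ^^ k) L) = 0" using degree_lagrange[of k "D 0" z] by (simp add: degree_higher_pderiv L_def)
    then have "poly ((pderiv ^^ k) L) x = coeff ((pderiv ^^ k) L) 0"
      by (auto elim!: degree_eq_zeroE)
    then show ?thesis by (simp add: coeff_higher_pderiv L_def coeff_lagrange pochhammer_fact)
  qed
  ultimately show ?thesis by auto
qed

lemma divided_diff_increment_le_integral:
  assumes D: "\<And>j x. j < m - 1 \<Longrightarrow> (D j has_real_derivative D (Suc j) x) (at x)" and m: "1 \<le> m"
    and z: "strict_mono_on {..m} z"
    and h: "\<And>a b. a \<le> b \<Longrightarrow> D (m - 1) b - D (m - 1) a = integral {a..b} h"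
    "\<And>a b. h absolutely_integrable_on {a..b}"
  shows "\<bar>divided_diff (m - 1) (D 0) z - divided_diff (m - 1) (D 0) (\<lambda>i. z (Suc i))\<bar>
    \<le> integral {z 0..z m} (\<lambda>x. \<bar>h x\<bar>)"
proof -
  have "strict_mono_on {..m - 1} z" by (rule monotone_on_subset[OF z]) auto
  from divided_diff_mean_value[where D=D, OF D this] obtain \<xi> where
    \<xi>: "\<xi> \<in> {z 0..z (m - 1)}" "D (m - 1) \<xi> = fact (m - 1) * divided_diff (m - 1) (D 0) z" by blast
  have "strict_mono_on {..m - 1} (\<lambda>i. z (Suc i))"
    using m by (intro strict_mono_onI strict_mono_onD[OF z]) auto
  from divided_diff_mean_value[where D=D, OF D this] obtain \<eta> where
    \<eta>: "\<eta> \<in> {z 1..z m}" "D (m - 1) \<eta> = fact (m - 1) * divided_diff (m - 1) (D 0) (\<lambda>i. z (Suc i))"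
    using m by auto
  have "z (m - 1) \<le> z m" "z 0 \<le> z 1" using z m by (auto simp: strict_mono_on_def less_imp_le)
  then have in01: "\<xi> \<in> {z 0..z m}" "\<eta> \<in> {z 0..z m}" using \<xi> \<eta> by auto
  have ab: "\<bar>D (m - 1) b - D (m - 1) a\<bar> \<le> integral {z 0..z m} (\<lambda>x. \<bar>h x\<bar>)"
    if "a \<le> b" "a \<in> {z 0..z m}" "b \<in> {z 0..z m}" for a b
  proof -
    have i: "h integrable_on {u..v}" "(\<lambda>x. \<bar>h x\<bar>) integrable_on {u..v}" for u v
      using h(2)[of u v] by (auto simp: absolutely_integrable_on_def)
    have "\<bar>D (m - 1) b - D (m - 1) a\<bar> \<le> integral {a..b} (\<lambda>x. \<bar>h x\<bar>)"
      using Henstock_Kurzweil_Integration.integral_norm_bound_integral[OF i(1)[of a b] i(2)[of a b]]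
      unfolding h(1)[OF that(1)] by simp
    also have "\<dots> \<le> integral {z 0..z m} (\<lambda>x. \<bar>h x\<bar>)"
      by (rule integral_subset_le) (use that i in auto)
    finally show ?thesis .
  qed
  have "\<bar>D (m - 1) \<xi> - D (m - 1) \<eta>\<bar> \<le> integral {z 0..z m} (\<lambda>x. \<bar>h x\<bar>)"
    using ab[of \<xi> \<eta>] ab[of \<eta> \<xi>] in01 by (cases "\<xi> \<le> \<eta>") (auto simp: abs_minus_commute)
  \<comment> \<open>The factorial is at least 1, so dropping it only weakens the bound.\<close>
  moreover have "\<bar>divided_diff (m - 1) (D 0) z - divided_diff (m - 1) (D 0) (\<lambda>i. z (Suc i))\<bar>
      \<le> \<bar>D (m - 1) \<xi> - D (m - 1) \<eta>\<bar>"
  proof -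
    have "\<bar>D (m - 1) \<xi> - D (m - 1) \<eta>\<bar> = fact (m - 1) *
        \<bar>divided_diff (m - 1) (D 0) z - divided_diff (m - 1) (D 0) (\<lambda>i. z (Suc i))\<bar>"
      unfolding \<xi> \<eta> by (simp add: abs_mult flip: right_diff_distrib)
    then show ?thesis using mult_right_mono[OF fact_ge_1[of "m - 1", where 'a=real]] by fastforce
  qed
  ultimately show ?thesis by linarith
qed

section \<open>Products of linear factors with a smooth step\<close>

fun step_prod :: "(nat \<Rightarrow> real \<Rightarrow> real) \<Rightarrow> real list \<Rightarrow> nat \<Rightarrow> real \<Rightarrow> real" where
  "step_prod T [] k x = T k x"
| "step_prod T (s # ss) k x = (x - s) * step_prod T ss k x + real k * step_prod T ss (k - 1) x"

text \<open>\<open>step_prod T ss k\<close> is the k-th derivative of \<open>T 0\<close> times the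
  factors x - s. Leibniz' rule for one linear factor has just two terms; at k = 0 the truncated
  \<open>k - 1\<close> is harmless because \<open>real k\<close> vanishes.\<close>

lemma deriv_chain_step_prod:
  assumes "deriv_chain T"
  shows "deriv_chain (step_prod T ss)"
proof (induction ss)
  case Nil
  then show ?case using assms by (simp add: deriv_chain_def)
next
  case (Cons s ss)
  note d = deriv_chainD[OF Cons]
  show ?case
    unfolding deriv_chain_def
  proof (intro allI)
    fix k x
    have "((\<lambda>x. (x - s) * step_prod T ss k x + real k * step_prod T ss (k - 1) x) has_real_derivative
       step_prod T (s # ss) (Suc k) x) (at x)"
      by (cases k) (auto intro!: derivative_eq_intros d simp: algebra_simps)
    moreover have "step_prod T (s # ss) k =
        (\<lambda>x. (x - s) * step_prod T ss k x + real k * step_prod T ss (k - 1) x)" by auto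
    ultimately show "(step_prod T (s # ss) k has_real_derivative step_prod T (s # ss) (Suc k) x) (at x)"
      by metis
  qed
qed

lemma step_prod_0: "step_prod T ss 0 x = (\<Prod>s\<leftarrow>ss. x - s) * T 0 x"
  by (induction ss) auto

lemma step_prod_eq_0_left: "(\<And>k. T k x = 0) \<Longrightarrow> step_prod T ss k x = 0"
  by (induction ss arbitrary: k) auto

text \<open>To the right of the step the product behaves like a polynomial of degree
  \<open>length ss\<close>, which higher derivatives annihilate.\<close>

lemma step_prod_eq_0_right: "(\<And>k. 0 < k \<Longrightarrow> T k x = 0) \<Longrightarrow> length ss < k \<Longrightarrow> step_prod T ss k x = 0"
  by (induction ss arbitrary: k) auto

text \<open>Each linear factor costs (k + 1) L: either x - s is kept, or one of the k derivatives
  falls on it, and the derivative saved on the step is worth l \<le> L.\<close>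

lemma step_prod_bound:
  assumes "\<And>j. j \<le> k \<Longrightarrow> \<bar>T j x\<bar> \<le> B / l ^ j" and "0 < l" "l \<le> L" and "\<And>s. s \<in> set ss \<Longrightarrow> \<bar>x - s\<bar> \<le> L"
    and "B \<ge> 0"
  shows "\<bar>step_prod T ss k x\<bar> \<le> B * real (k + 1) ^ length ss * L ^ length ss / l ^ k"
  using assms(1,4)
proof (induction ss arbitrary: k)
  case Nil
  then show ?case using assms by simp
next
  case (Cons s ss)
  let ?n = "length ss"
  have L: "0 < L" using assms by linarith
  have 1: "\<bar>(x - s) * step_prod T ss k x\<bar> \<le> L * (B * real (k + 1) ^ ?n * L ^ ?n / l ^ k)"
    unfolding abs_mult using L Cons.IH[of k] Cons.prems by (intro mult_mono) auto
  have 2: "\<bar>real k * step_prod T ss (k - 1) x\<bar> \<le> real k * (L * (B * real (k + 1) ^ ?n * L ^ ?n / l ^ k))"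
  proof (cases k)
    case (Suc k')
    have "\<bar>step_prod T ss k' x\<bar> \<le> B * real (k' + 1) ^ ?n * L ^ ?n / l ^ k'"
      using Cons.IH[of k'] Cons.prems Suc by simp
    also have "\<dots> = l * (B * real (k' + 1) ^ ?n * L ^ ?n / l ^ k)"
      using assms(2) by (simp add: Suc)
    also have "\<dots> \<le> L * (B * real (k + 1) ^ ?n * L ^ ?n / l ^ k)"
      using assms L by (intro mult_mono divide_right_mono mult_right_mono mult_left_mono power_mono)
        (auto simp: Suc)
    finally have "\<bar>step_prod T ss k' x\<bar> \<le> L * (B * real (k + 1) ^ ?n * L ^ ?n / l ^ k)" .
    from mult_left_mono[OF this, of "real k"] show ?thesis by (simp add: abs_mult Suc)
  qed simp
  have "\<bar>step_prod T (s # ss) k x\<bar> \<le> (1 + real k) * (L * (B * real (k + 1) ^ ?n * L ^ ?n / l ^ k))"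
    unfolding step_prod.simps distrib_right mult_1 using abs_triangle_ineq add_mono[OF 1 2] by (rule order_trans)
  also have "\<dots> = B * real (k + 1) ^ length (s # ss) * L ^ length (s # ss) / l ^ k"
    by (simp add: mult_ac)
  finally show ?case .
qed


lemma card_le_if_spread_less:
  fixes A :: "nat set"
  assumes "finite A" "\<And>i j. i \<in> A \<Longrightarrow> j \<in> A \<Longrightarrow> j < i + m"
  shows "card A \<le> m"
proof (cases "A = {}")
  case False
  have "j \<in> {Min A..<Min A + m}" if "j \<in> A" for j
    using assms(2)[of "Min A" j] Min_in[OF assms(1) False] Min_le[OF assms(1) that] that by auto
  then have "A \<subseteq> {Min A..<Min A + m}" by blast
  from card_mono[OF _ this] show ?thesis by simp
qed simp

text \<open>The m gaps add up to x (i + m) - x i, so some gap is at least their average.\<close>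

lemma large_gap_exists:
  fixes x :: "nat \<Rightarrow> real"
  assumes "1 \<le> m"
  shows "\<exists>g. i \<le> g \<and> g < i + m \<and> x (i + m) - x i \<le> real m * (x (Suc g) - x g)"
proof (rule ccontr)
  assume "\<not> ?thesis"
  then have less: "real m * (x (Suc g) - x g) < x (i + m) - x i" if "g \<in> {i..<i + m}" for g
    using that by force
  have "real m * (x (i + m) - x i) = (\<Sum>g\<in>{i..<i + m}. real m * (x (Suc g) - x g))"
    by (simp add: sum_distrib_left[symmetric] sum_Suc_diff')
  also have "\<dots> < (\<Sum>g\<in>{i..<i + m}. x (i + m) - x i)"
    by (rule sum_strict_mono) (use less assms in auto)
  finally show False by simp
qed

lemma smooth_step_bounded:
  assumes \<theta>: "deriv_chain \<theta>" "\<And>k x. x \<le> 0 \<Longrightarrow> \<theta> k x = 0"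
    "\<And>x. 1 \<le> x \<Longrightarrow> \<theta> 0 x = 1" "\<And>k x. 1 \<le> x \<Longrightarrow> 0 < k \<Longrightarrow> \<theta> k x = 0"
  shows "\<exists>B\<ge>0. \<forall>j\<le>k. \<forall>x. \<bar>\<theta> j x\<bar> \<le> B"
proof (induction k)
  have ex: "\<exists>b. \<forall>x. \<bar>\<theta> j x\<bar> \<le> b" for j
  proof -
    have "bounded (\<theta> j ` {0..1})"
      by (intro compact_imp_bounded compact_continuous_image deriv_chain_continuous[OF \<theta>(1)]) auto
    then obtain b where b: "\<And>x. x \<in> {0..1} \<Longrightarrow> \<bar>\<theta> j x\<bar> \<le> b"
      unfolding bounded_iff by (metis image_eqI real_norm_def)
    have "\<bar>\<theta> j x\<bar> \<le> max b 1" for x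
    proof (cases "x \<in> {0..1}")
      case False
      then consider "x \<le> 0" | "1 \<le> x" by force
      then show ?thesis using \<theta>(2)[of x j] \<theta>(3)[of x] \<theta>(4)[of x j] by cases (cases "j = 0"; simp)+
    qed (use b in \<open>simp add: max.coboundedI1\<close>)
    then show ?thesis by blast
  qed
  {
    case 0
    then show ?case using ex[of 0] by (metis abs_ge_zero le_zero_eq order_trans)
  next
    case (Suc k)
    then obtain B where B: "B \<ge> 0" "\<forall>j\<le>k. \<forall>x. \<bar>\<theta> j x\<bar> \<le> B" by blast
    obtain b where "\<forall>x. \<bar>\<theta> (Suc k) x\<bar> \<le> b" using ex by blast
    then show ?case using B by (intro exI[of _ "max B b"]) (auto simp: le_Suc_eq le_max_iff_disj)
  }
qed

text \<open>The Lagrange polynomials of consecutive windows of \<open>m\<close> nodes are glued inside the longest gap of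
  the union of two windows; the difference of two such polynomials vanishes at the shared nodes.\<close>

lemma finite_extension:
  fixes m :: nat
  assumes m: "1 \<le> m"
  obtains C :: real where "C \<ge> 1" "\<And>E S f. \<lbrakk>finite S; S \<subseteq> E; m < card S\<rbrakk> \<Longrightarrow>
    \<exists>D. deriv_chain D \<and> (\<forall>x\<in>S. D 0 x = f x) \<and>
      (\<forall>t s. sharp_maximal m E f t \<le> ennreal s \<longrightarrow> 0 \<le> s \<longrightarrow> \<bar>D m t\<bar> \<le> C * s)"
proof -
  obtain \<theta> where \<theta>: "deriv_chain \<theta>" "\<And>k x. x \<le> 0 \<Longrightarrow> \<theta> k x = 0"
    "\<And>x. 1 \<le> x \<Longrightarrow> \<theta> 0 x = 1" "\<And>k x. 1 \<le> x \<Longrightarrow> 0 < k \<Longrightarrow> \<theta> k x = 0"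
    using smooth_step_exists by metis
  obtain B where B: "B \<ge> 0" "\<And>j x. j \<le> m \<Longrightarrow> \<bar>\<theta> j x\<bar> \<le> B"
    using smooth_step_bounded[OF \<theta>, of m] by blast
  \<comment> \<open>\<open>B\<close> bounds the derivatives of the step up to order m, the middle
    factor comes from the m - 1 shared nodes in \<open>step_prod_bound\<close>, and m^m from the
    m-th power of window length over gap length.\<close>
  define C0 where "C0 = B * real (m + 1) ^ (m - 1) * real m ^ m"
  have C0: "C0 \<ge> 0" using B by (simp add: C0_def)
  \<comment> \<open>At most m windows overlap at a point, each contributing \<open>C0 * s\<close>;
    the summand 1 ensures C \<ge> 1.\<close>
  define C where "C = real m * C0 + 1"
  show thesis
  proof
    show "C \<ge> 1" using C0 by (simp add: C_def)
    fix E S :: "real set" and f :: "real \<Rightarrow> real"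
    assume S: "finite S" "S \<subseteq> E" "m < card S"
    \<comment> \<open>The number of windows of m + 1 consecutive nodes; the nodes are thus x 0, ...,
      x (N + m - 1).\<close>
    define N where "N = card S - m"
    define x where "x = (!) (sorted_list_of_set S)"
    have x_less: "x i < x j" if "i < j" "j < N + m" for i j
      using that S strict_sorted_list_of_set[of S] unfolding x_def
      by (intro sorted_wrt_nth_less[where P="(<)"]) (auto simp: N_def)
    have x_le: "x i \<le> x j" if "i \<le> j" "j < N + m" for i j
      using x_less[of i j] that by (cases "i = j") auto
    have xS: "x i \<in> S" if "i < N + m" for i
      using that S nth_mem[of i "sorted_list_of_set S"] unfolding x_def by (auto simp: N_def)
    have Sx: "\<exists>i<N + m. y = x i" if "y \<in> S" for y
    proof -
      have "y \<in> set (sorted_list_of_set S)" using that S by simp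
      then show ?thesis using S unfolding in_set_conv_nth by (auto simp: x_def N_def)
    qed
    have mono: "strict_mono_on {..m} (\<lambda>j. x (i + j))" if "i < N" for i
      by (intro strict_mono_onI x_less) (use that in auto)
    define P where "P i = lagrange (m - 1) f (\<lambda>j. x (i + j))" for i
    define d where "d i = divided_diff (m - 1) f (\<lambda>j. x (i + Suc j)) - divided_diff (m - 1) f (\<lambda>j. x (i + j))" for i
    have P_Suc: "P (Suc i) = P i + smult (d i) (\<Prod>j\<in>{1..<m}. [:- x (i + j), 1:])" if "i < N" for i
      using lagrange_Suc_shift[OF strict_mono_on_imp_inj_on[OF mono[OF that]] m, of f]
      by (simp add: P_def d_def)
    define g where "g i = (SOME g. i \<le> g \<and> g < i + m \<and> x (i + m) - x i \<le> real m * (x (Suc g) - x g))" for i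
    have g: "i \<le> g i" "g i < i + m" "x (i + m) - x i \<le> real m * (x (Suc (g i)) - x (g i))" for i
      using someI_ex[OF large_gap_exists[OF m, of i x]] unfolding g_def by auto
    define l where "l i = x (Suc (g i)) - x (g i)" for i
    have l: "l i > 0" "l i \<le> x (i + m) - x i" if "i < N" for i
      using x_less[of "g i" "Suc (g i)"] x_le[of i "g i"] x_le[of "Suc (g i)" "i + m"] g[of i] that
      by (auto simp: l_def)
    define T where "T i k t = \<theta> k ((t - x (g i)) / l i) / l i ^ k" for i k t
    define ss where "ss i = map (\<lambda>j. x (i + j)) [1..<m]" for i
    have chainT: "deriv_chain (T i)" for i
      unfolding deriv_chain_def
    proof (intro allI)
      fix k t
      have "((\<lambda>t. \<theta> k ((t - x (g i)) / l i)) has_real_derivative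
          \<theta> (Suc k) ((t - x (g i)) / l i) * (1 / l i)) (at t)"
        by (rule DERIV_chain2[OF deriv_chainD[OF \<theta>(1)] DERIV_cdivide])
          (auto intro!: derivative_eq_intros)
      from DERIV_cdivide[OF this, of "l i ^ k"]
      show "(T i k has_real_derivative T i (Suc k) t) (at t)"
        unfolding T_def by (simp add: field_simps)
    qed
    \<comment> \<open>The Lagrange polynomials in telescoped form: the increment from
      \<open>P i\<close> to \<open>P (Suc i)\<close> is switched on by a step inside the gap
      \<open>g i\<close>.\<close>
    define D where "D k t = poly ((pderiv ^^ k) (P 0)) t + (\<Sum>i<N. d i * step_prod (T i) (ss i) k t)" for k t
    have "deriv_chain D"
      unfolding deriv_chain_def D_def
      by (auto intro!: derivative_eq_intros DERIV_sum deriv_chainD[OF deriv_chain_step_prod[OF chainT]]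
          simp: mult.commute)
    moreover have "D 0 y = f y" if "y \<in> S" for y
    proof -
      obtain k where k: "k < N + m" "y = x k" using Sx[OF \<open>y \<in> S\<close>] by blast
      have prod: "(\<Prod>s\<leftarrow>ss i. t - s) = poly (\<Prod>j\<in>{1..<m}. [:- x (i + j), 1:]) t" for i t
        by (simp add: ss_def poly_prod prod.distinct_set_conv_list[symmetric] comp_def)
      \<comment> \<open>At the node x k exactly the increments with i + m \<le> k count in full,
        that is i < k + 1 - m. Hence D 0 agrees there with \<open>P (k + 1 - m)\<close>, whose nodes
        include x k; for k < m truncated subtraction correctly gives \<open>P 0\<close>.\<close>
      have "d i * step_prod (T i) (ss i) 0 y =
          (if i < k + 1 - m then d i * poly (\<Prod>j\<in>{1..<m}. [:- x (i + j), 1:]) y else 0)"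
        if i: "i < N" for i
      proof -
        consider "i + m \<le> k" | "k \<le> i" | "i < k" "k < i + m" by linarith
        then show ?thesis
        proof cases
          case 1
          then have "x (Suc (g i)) \<le> y" using k g[of i] by (auto intro!: x_le)
          then have "T i 0 y = 1"
            using l[OF i] unfolding T_def by (subst \<theta>(3)) (auto simp: l_def field_simps)
          then show ?thesis using 1 by (simp add: step_prod_0 prod)
        next
          case 2
          then have "y \<le> x (g i)" using i k g[of i] by (auto intro!: x_le)
          then have "T i 0 y = 0"
            using l[OF i] unfolding T_def by (subst \<theta>(2)) (auto simp: field_simps)
          then show ?thesis using 2 m by (auto simp: step_prod_0)
        next
          \<comment> \<open>The step may be anywhere between 0 and 1 here, but x k is one of the
            shared nodes, where the increment vanishes.\<close>
          case 3
          then have "poly (\<Prod>j\<in>{1..<m}. [:- x (i + j), 1:]) y = 0"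
            unfolding poly_prod k by (intro prod_zero bexI[of _ "k - i"]) auto
          then show ?thesis by (simp add: step_prod_0 prod)
        qed
      qed
      then have "D 0 y = poly (P 0) y + (\<Sum>i<N. if i < k + 1 - m then d i * poly (\<Prod>j\<in>{1..<m}. [:- x (i + j), 1:]) y else 0)"
        by (simp add: D_def)
      also have "(\<Sum>i<N. if i < k + 1 - m then d i * poly (\<Prod>j\<in>{1..<m}. [:- x (i + j), 1:]) y else 0) =
          (\<Sum>i<k + 1 - m. d i * poly (\<Prod>j\<in>{1..<m}. [:- x (i + j), 1:]) y)"
        using k by (intro sum.mono_neutral_cong_right) auto
      also have "poly (P 0) y + \<dots> = poly (P (k + 1 - m)) y"
      proof -
        have "poly (P 0) y + (\<Sum>i<n. d i * poly (\<Prod>j\<in>{1..<m}. [:- x (i + j), 1:]) y) = poly (P n) y"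
          if "n \<le> N" for n
          using that by (induction n) (auto simp: P_Suc)
        then show ?thesis using k by simp
      qed
      also have "poly (P (k + 1 - m)) (x (k + 1 - m + (k - (k + 1 - m)))) = f (x (k + 1 - m + (k - (k + 1 - m))))"
        unfolding P_def
      proof (rule poly_lagrange)
        show "inj_on (\<lambda>j. x (k + 1 - m + j)) {..m - 1}"
          using k m by (intro strict_mono_on_imp_inj_on strict_mono_onI x_less) auto
      qed (use m in auto)
      then have "poly (P (k + 1 - m)) y = f y" using m k by simp
      finally show ?thesis .
    qed
    moreover have "\<bar>D m t\<bar> \<le> C * s" if sharp: "sharp_maximal m E f t \<le> ennreal s" and s: "0 \<le> s" for t s
    proof -
      \<comment> \<open>The windows strictly around \<open>t\<close>. The gap \<open>g i\<close>
        lies in its window, so for any other window \<open>t\<close> is on one side of the step: on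
        the left the term is 0, on the right a polynomial of degree m - 1, without m-th
        derivative.\<close>
      define A where "A = {i. i < N \<and> x i < t \<and> t < x (i + m)}"
      have zero: "step_prod (T i) (ss i) m t = 0" if i: "i < N" "i \<notin> A" for i
      proof -
        consider "t \<le> x (g i)" | "x (Suc (g i)) \<le> t"
          using i x_le[of i "g i"] x_le[of "Suc (g i)" "i + m"] g[of i] by (force simp: A_def)
        then show ?thesis
        proof cases
          case 1
          then show ?thesis using l[OF i(1)]
            by (intro step_prod_eq_0_left) (auto simp: T_def \<theta>(2) field_simps)
        next
          case 2
          then have "1 \<le> (t - x (g i)) / l i" using l[OF i(1)] by (simp add: l_def field_simps)
          then show ?thesis using m by (intro step_prod_eq_0_right) (auto simp: T_def \<theta>(4) ss_def)
        qed
      qed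
      have bound: "\<bar>d i * step_prod (T i) (ss i) m t\<bar> \<le> C0 * s" if "i \<in> A" for i
      proof -
        have i: "i < N" "x i < t" "t < x (i + m)" using that by (auto simp: A_def)
        define L where "L = x (i + m) - x i"
        have L: "L > 0" "L \<le> real m * l i" using i g[of i] by (auto simp: L_def l_def)
        \<comment> \<open>For \<open>t\<close> inside the window the denominator is exactly
          \<open>L\<close>, so |d i| \<le> L s; this \<open>L\<close> cancels against the bound C0 /
          L for the step factor.\<close>
        have "ennreal (\<bar>divided_diff (m - 1) f (\<lambda>j. x (i + j)) - divided_diff (m - 1) f (\<lambda>j. x (i + Suc j))\<bar>
             / (\<bar>t - x (i + 0)\<bar> + \<bar>t - x (i + m)\<bar>)) \<le> sharp_maximal m E f t"
          unfolding sharp_maximal_def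
          by (rule SUP_upper) (use mono[OF i(1)] xS S i in auto)
        also have "\<dots> \<le> ennreal s" by (rule sharp)
        finally have "\<bar>d i\<bar> / L \<le> s"
          using s i by (simp add: ennreal_le_iff d_def L_def abs_minus_commute)
        then have d: "\<bar>d i\<bar> \<le> L * s" using L by (simp add: field_simps)
        have "\<bar>step_prod (T i) (ss i) m t\<bar> \<le> B * real (m + 1) ^ length (ss i) * L ^ length (ss i) / l i ^ m"
        proof (rule step_prod_bound)
          show "\<bar>T i j t\<bar> \<le> B / l i ^ j" if "j \<le> m" for j
            using B(2)[OF that] l[OF i(1)] by (simp add: T_def divide_right_mono)
          show "0 < l i" "l i \<le> L" using l[OF i(1)] by (auto simp: L_def)
          fix u assume "u \<in> set (ss i)"
          then have "x i \<le> u \<and> u \<le> x (i + m)" using i by (auto simp: ss_def intro!: x_le)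
          then show "\<bar>t - u\<bar> \<le> L" using i by (auto simp: L_def)
        qed (rule B)
        also have "\<dots> \<le> B * real (m + 1) ^ (m - 1) * (real m ^ m / L)"
        proof -
          have "L ^ m \<le> (real m * l i) ^ m" using L by (intro power_mono) auto
          then have "L * L ^ (m - 1) \<le> real m ^ m * l i ^ m"
            using m by (simp add: power_mult_distrib flip: power_Suc)
          then have "L ^ (m - 1) / l i ^ m \<le> real m ^ m / L"
            using L l[OF i(1)] by (simp add: field_simps)
          from mult_left_mono[OF this, of "B * real (m + 1) ^ (m - 1)"] show ?thesis
            using B by (simp add: ss_def)
        qed
        also have "\<dots> = C0 / L" by (simp add: C0_def)
        finally have "\<bar>d i\<bar> * \<bar>step_prod (T i) (ss i) m t\<bar> \<le> (L * s) * (C0 / L)"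
          using d L s by (intro mult_mono) auto
        then show ?thesis using L by (simp add: abs_mult mult.commute)
      qed
      \<comment> \<open>A window with index at least i + m begins at or after the end of window i,
        so it cannot share an interior point with it.\<close>
      have "card A \<le> m"
      proof (rule card_le_if_spread_less)
        fix i j assume "i \<in> A" "j \<in> A"
        then show "j < i + m" using x_le[of "i + m" j] by (force simp: A_def)
      qed (simp add: A_def)
      have "poly ((pderiv ^^ m) (P 0)) t = 0"
      proof -
        have "degree (P 0) < m" using degree_lagrange[of "m - 1" f "\<lambda>j. x (0 + j)"] m by (simp add: P_def)
        then have "(pderiv ^^ m) (P 0) = 0"
          by (intro poly_eqI) (simp add: coeff_higher_pderiv coeff_eq_0)
        then show ?thesis by simp
      qed
      then have "D m t = (\<Sum>i<N. d i * step_prod (T i) (ss i) m t)" by (simp add: D_def)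
      also have "\<dots> = (\<Sum>i\<in>A. d i * step_prod (T i) (ss i) m t)"
        using zero by (intro sum.mono_neutral_right) (auto simp: A_def)
      also have "\<bar>\<dots>\<bar> \<le> (\<Sum>i\<in>A. C0 * s)"
        by (rule order_trans[OF sum_abs sum_mono]) (rule bound)
      also have "\<dots> \<le> real m * (C0 * s)"
        using \<open>card A \<le> m\<close> C0 s by (auto intro!: mult_right_mono)
      also have "\<dots> \<le> C * s" using s by (simp add: C_def distrib_right)
      finally show ?thesis .
    qed
    ultimately show "\<exists>D. deriv_chain D \<and> (\<forall>x\<in>S. D 0 x = f x) \<and>
      (\<forall>t s. sharp_maximal m E f t \<le> ennreal s \<longrightarrow> 0 \<le> s \<longrightarrow> \<bar>D m t\<bar> \<le> C * s)" by blast
  qed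
qed

section \<open>Passage to the limit\<close>

text \<open>The decay 8^(-n) leaves room for a factor 4^n: the weighted squares times 4^n still have
  summable integrals, hence tend to 0 almost everywhere, and |u n x| \<le> 2^(-n) eventually. The
  positive weight can be divided out pointwise.\<close>

lemma AE_summable_if_weighted_square_le:
  fixes u :: "nat \<Rightarrow> 'a \<Rightarrow> real"
  assumes meas [measurable]: "\<And>n. u n \<in> borel_measurable M" "\<rho> \<in> borel_measurable M"
    and \<rho>: "\<And>x. x \<in> space M \<Longrightarrow> 0 < \<rho> x"
    and int: "\<And>n. integrable M (\<lambda>x. (u n x)\<^sup>2 * \<rho> x)"
    and le: "\<And>n. (LINT x|M. (u n x)\<^sup>2 * \<rho> x) \<le> 8 * (1 / 8) ^ n"
  shows "AE x in M. summable (\<lambda>n. u n x)"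
proof -
  have "(\<integral>\<^sup>+x. (\<Sum>n. ennreal (4 ^ n * ((u n x)\<^sup>2 * \<rho> x))) \<partial>M) = (\<Sum>n. \<integral>\<^sup>+x. ennreal (4 ^ n * ((u n x)\<^sup>2 * \<rho> x)) \<partial>M)"
    by (rule nn_integral_suminf) measurable
  also have "\<dots> \<le> (\<Sum>n. ennreal (8 * (1 / 2) ^ n))"
  proof (rule suminf_le)
    fix n
    have "(\<integral>\<^sup>+x. ennreal (4 ^ n * ((u n x)\<^sup>2 * \<rho> x)) \<partial>M) = ennreal (LINT x|M. 4 ^ n * ((u n x)\<^sup>2 * \<rho> x))"
      using \<rho> by (intro nn_integral_eq_integral integrable_mult_right int AE_I2) (simp add: less_imp_le)
    also have "\<dots> \<le> ennreal (4 ^ n * (8 * (1 / 8) ^ n))"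
      using le[of n] by (intro ennreal_leI) simp
    also have "4 ^ n * (8 * (1 / 8) ^ n) = 8 * (1 / 2 :: real) ^ n"
      by (simp add: power_mult_distrib[symmetric])
    finally show "(\<integral>\<^sup>+x. ennreal (4 ^ n * ((u n x)\<^sup>2 * \<rho> x)) \<partial>M) \<le> ennreal (8 * (1 / 2) ^ n)" .
  qed auto
  also have "\<dots> < top"
    by (subst suminf_ennreal2) (auto intro!: summable_mult summable_geometric)
  finally have "AE x in M. (\<Sum>n. ennreal (4 ^ n * ((u n x)\<^sup>2 * \<rho> x))) \<noteq> \<infinity>"
    by (intro nn_integral_PInf_AE) auto
  then show ?thesis
  proof (rule AE_mp, intro AE_I2 impI)
    fix x assume x: "x \<in> space M" "(\<Sum>n. ennreal (4 ^ n * ((u n x)\<^sup>2 * \<rho> x))) \<noteq> \<infinity>"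
    have "summable (\<lambda>n. 4 ^ n * ((u n x)\<^sup>2 * \<rho> x))"
      by (rule summable_suminf_not_top) (use x \<rho>[of x] in \<open>auto simp: less_imp_le\<close>)
    then have "(\<lambda>n. 4 ^ n * ((u n x)\<^sup>2 * \<rho> x)) \<longlonglongrightarrow> 0" by (rule summable_LIMSEQ_zero)
    then have "\<forall>\<^sub>F n in sequentially. 4 ^ n * ((u n x)\<^sup>2 * \<rho> x) < \<rho> x"
      using \<rho>[OF x(1)] by (rule order_tendstoD)
    then have "\<forall>\<^sub>F n in sequentially. norm (u n x) \<le> (1 / 2) ^ n"
    proof eventually_elim
      case (elim n)
      then have "(4 ^ n * (u n x)\<^sup>2) * \<rho> x < 1 * \<rho> x" by (simp add: mult.assoc)
      then have "4 ^ n * (u n x)\<^sup>2 < 1" using \<rho>[OF x(1)] by (simp only: mult_less_cancel_right_pos)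
      moreover have "(2 ^ n * \<bar>u n x\<bar>)\<^sup>2 = (2 * 2) ^ n * (u n x)\<^sup>2"
        unfolding power_mult_distrib by (simp add: power2_eq_square)
      ultimately have "(2 ^ n * \<bar>u n x\<bar>)\<^sup>2 < 1\<^sup>2" by simp
      then have "2 ^ n * \<bar>u n x\<bar> < 1" by (rule power_less_imp_less_base) simp
      then show ?case by (simp add: field_simps)
    qed
    then show "summable (\<lambda>n. u n x)"
      by (rule summable_comparison_test_ev) (simp add: summable_geometric)
  qed
qed

text \<open>Near-minimisers of a weighted \<open>L\<^sup>2\<close> norm over a downward directed family of convex sets form a
  Cauchy sequence by the parallelogram law. Since the near-minimisers over a smaller set of the family
  stay close to those over a larger one, a sequence of sets of the family that exhausts the supremum
  of the minima captures the constraints of all the others.\<close>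

lemma convex_directed_AE_limit:
  fixes K :: "'i set \<Rightarrow> ('a \<Rightarrow> real) set" and G :: "'a \<Rightarrow> real"
  assumes "sigma_finite_measure M" and [measurable]: "G \<in> borel_measurable M"
    and ne: "\<And>S. finite S \<Longrightarrow> S \<subseteq> I \<Longrightarrow> K S \<noteq> {}"
    and anti: "\<And>S T. S \<subseteq> T \<Longrightarrow> K T \<subseteq> K S"
    and meas: "\<And>S h. h \<in> K S \<Longrightarrow> h \<in> borel_measurable M"
    and bd: "\<And>S h. h \<in> K S \<Longrightarrow> AE x in M. \<bar>h x\<bar> \<le> G x"
    and conv: "\<And>S h k. h \<in> K S \<Longrightarrow> k \<in> K S \<Longrightarrow> (\<lambda>x. (h x + k x) / 2) \<in> K S"
  shows "\<exists>h\<in>borel_measurable M. (AE x in M. \<bar>h x\<bar> \<le> G x) \<and>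
    (\<forall>i\<in>I. \<exists>g. (\<forall>n. g n \<in> K {i}) \<and> (AE x in M. (\<lambda>n. g n x) \<longlonglongrightarrow> h x))"
proof -
  obtain w where [measurable]: "w \<in> borel_measurable M" and w: "integral\<^sup>N M w \<noteq> \<infinity>"
    "\<And>x. x \<in> space M \<Longrightarrow> 0 < w x \<and> w x < \<infinity>"
    using sigma_finite_measure.Ex_finite_integrable_function[OF assms(1)] by blast
  \<comment> \<open>\<open>w\<close> is positive with finite integral; the denominator makes h^2
    \<rho> \<le> w for every h bounded by \<open>G\<close>, although \<open>G\<close> itself is only
    measurable.\<close>
  define \<rho> where "\<rho> x = enn2real (w x) / (1 + (G x)\<^sup>2)" for x
  have den: "0 < 1 + y\<^sup>2" for y :: real by (simp add: add_pos_nonneg)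
  have [measurable]: "\<rho> \<in> borel_measurable M" by (simp add: \<rho>_def[abs_def])
  have \<rho>: "0 < \<rho> x" if "x \<in> space M" for x
    using w(2)[OF that] den[of "G x"] by (simp add: \<rho>_def enn2real_positive_iff)
  have wi: "integrable M (\<lambda>x. enn2real (w x))"
  proof (rule integrableI_nonneg)
    have "(\<integral>\<^sup>+x. ennreal (enn2real (w x)) \<partial>M) = integral\<^sup>N M w"
      by (rule nn_integral_cong) (use w(2) in auto)
    then show "(\<integral>\<^sup>+x. ennreal (enn2real (w x)) \<partial>M) < \<infinity>" using w(1) by (simp add: less_top)
  qed auto
  define Q where "Q h = (LINT x|M. (h x)\<^sup>2 * \<rho> x)" for h
  have bw: "(h x)\<^sup>2 * \<rho> x \<le> enn2real (w x)" if "\<bar>h x\<bar> \<le> G x" for h x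
  proof -
    have "(h x)\<^sup>2 \<le> 1 + (G x)\<^sup>2" using power_mono[OF that, of 2] by simp
    then have "(h x)\<^sup>2 * enn2real (w x) \<le> (1 + (G x)\<^sup>2) * enn2real (w x)" by (rule mult_right_mono) simp
    then show ?thesis using den[of "G x"] by (simp add: \<rho>_def field_simps)
  qed
  have qint: "integrable M (\<lambda>x. (h x)\<^sup>2 * \<rho> x)"
    if [measurable]: "h \<in> borel_measurable M" and "AE x in M. \<bar>h x\<bar> \<le> G x" for h
  proof (rule Bochner_Integration.integrable_bound[OF wi])
    show "AE x in M. norm ((h x)\<^sup>2 * \<rho> x) \<le> norm (enn2real (w x))"
      using that(2) by eventually_elim (use bw in \<open>auto simp: \<rho>_def\<close>)
  qed measurable
  have qintK: "integrable M (\<lambda>x. (h x)\<^sup>2 * \<rho> x)" if "h \<in> K S" for h S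
    using that meas bd by (intro qint) auto
  have Q0: "0 \<le> Q h" for h unfolding Q_def by (rule integral_nonneg_AE) (auto simp: \<rho>_def)
  define W where "W = (LINT x|M. enn2real (w x))"
  have QW: "Q h \<le> W" if "h \<in> K S" for h S
    unfolding Q_def W_def
    by (rule integral_mono_AE[OF qintK[OF that] wi]) (use bd[OF that] bw in \<open>auto elim: eventually_mono\<close>)
  have par: "integrable M (\<lambda>x. (h x - k x)\<^sup>2 * \<rho> x)"
      "Q (\<lambda>x. h x - k x) = 2 * Q h + 2 * Q k - 4 * Q (\<lambda>x. (h x + k x) / 2)"
    if "h \<in> K S" "k \<in> K S" for h k S
  proof -
    have eq: "(h x - k x)\<^sup>2 * \<rho> x = 2 * ((h x)\<^sup>2 * \<rho> x) + 2 * ((k x)\<^sup>2 * \<rho> x) - 4 * (((h x + k x) / 2)\<^sup>2 * \<rho> x)" for x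
      by (simp add: power2_eq_square field_simps)
    have i: "integrable M (\<lambda>x. 2 * ((h x)\<^sup>2 * \<rho> x))" "integrable M (\<lambda>x. 2 * ((k x)\<^sup>2 * \<rho> x))"
      "integrable M (\<lambda>x. 4 * (((h x + k x) / 2)\<^sup>2 * \<rho> x))"
      by (intro integrable_mult_right qintK[OF that(1)] qintK[OF that(2)] qintK[OF conv[OF that]])+
    show "integrable M (\<lambda>x. (h x - k x)\<^sup>2 * \<rho> x)"
      unfolding eq by (intro Bochner_Integration.integrable_diff Bochner_Integration.integrable_add i)
    show "Q (\<lambda>x. h x - k x) = 2 * Q h + 2 * Q k - 4 * Q (\<lambda>x. (h x + k x) / 2)"
      unfolding Q_def eq using i by simp
  qed
  define fin where "fin = {S. finite S \<and> S \<subseteq> I}"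
  define c where "c S = (INF h\<in>K S. Q h)" for S
  define cs where "cs = (SUP S\<in>fin. c S)"
  have bb: "bdd_below (Q ` K S)" for S using Q0 by (intro bdd_belowI[of _ 0]) auto
  have c_le: "c S \<le> Q h" if "h \<in> K S" for S h unfolding c_def by (rule cINF_lower[OF bb that])
  have cW: "c S \<le> W" if "S \<in> fin" for S
    using ne[of S] that c_le QW order_trans unfolding fin_def by blast
  have ba: "bdd_above (c ` fin)" using cW by (intro bdd_aboveI[of _ W]) auto
  have c_cs: "c S \<le> cs" if "S \<in> fin" for S unfolding cs_def by (rule cSUP_upper[OF that ba])
  have c_mono: "c S \<le> c T" if "S \<subseteq> T" "T \<in> fin" for S T
    unfolding c_def using that ne[of T] anti bb by (intro cINF_superset_mono) (auto simp: fin_def)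
  \<comment> \<open>The rate 1/8 is the one demanded by
    \<open>AE_summable_if_weighted_square_le\<close>.\<close>
  define e :: "nat \<Rightarrow> real" where "e n = (1 / 8) ^ n" for n
  have e: "e n > 0" "e (Suc n) \<le> e n" for n by (auto simp: e_def)
  have "\<exists>S\<in>fin. cs - e n < c S" for n
  proof -
    have "cs - e n < (SUP S\<in>fin. c S)" using e[of n] by (simp add: cs_def)
    then show ?thesis by (subst (asm) less_cSUP_iff[OF _ ba]) (auto simp: fin_def)
  qed
  then obtain S0 where S0: "\<And>n. S0 n \<in> fin" "\<And>n. cs - e n < c (S0 n)" by metis
  \<comment> \<open>Unions make the sets increasing; as \<open>c\<close> is monotone, they still
    come within \<open>e n\<close> of the supremum \<open>cs\<close>.\<close>
  define S where "S n = (\<Union>k\<le>n. S0 k)" for n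
  have S: "S n \<in> fin" for n using S0(1) by (auto simp: S_def fin_def)
  have cS: "cs - e n < c (S n)" for n
    using S0(2)[of n] c_mono[OF _ S, of "S0 n" n] by (force simp: S_def)
  have near: "\<exists>h\<in>K T. Q h < cs + e n" if "T \<in> fin" for T n
  proof -
    have "(INF h\<in>K T. Q h) < cs + e n" using c_cs[OF that] e[of n] by (simp add: c_def)
    then show ?thesis using ne[of T] that by (subst (asm) cINF_less_iff[OF _ bb]) (auto simp: fin_def)
  qed
  \<comment> \<open>The midpoint lies in \<open>K (S n)\<close>, so its energy exceeds cs - e n; the
    parallelogram law leaves 2 (cs + e n) + 2 (cs + e n) - 4 (cs - e n) = 8 e n.\<close>
  have close: "Q (\<lambda>x. h x - k x) \<le> 8 * e n" if "h \<in> K (S n)" "k \<in> K (S n)" "Q h < cs + e n" "Q k < cs + e n" for h k n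
    using par(2)[OF that(1,2)] c_le[OF conv[OF that(1,2)]] cS[of n] that by linarith
  have "\<forall>n. \<exists>h. h \<in> K (S n) \<and> Q h < cs + e n" using near[OF S] by blast
  from choice[OF this] obtain h where h: "\<And>n. h n \<in> K (S n)" "\<And>n. Q (h n) < cs + e n"
    by blast
  have hm [measurable]: "h n \<in> borel_measurable M" for n using meas h by blast
  have sum: "AE x in M. summable (\<lambda>n. u n x)"
    if u: "\<And>n. u n = (\<lambda>x. k n x - h n x)" "\<And>n. k n \<in> K (S n)" "\<And>n. Q (k n) < cs + e n" for u k
  proof (rule AE_summable_if_weighted_square_le[where \<rho>=\<rho>])
    show "u n \<in> borel_measurable M" for n unfolding u(1) using meas[OF u(2)[of n]] by measurable
    show "integrable M (\<lambda>x. (u n x)\<^sup>2 * \<rho> x)" for n unfolding u(1) by (rule par(1)[OF u(2) h(1)])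
    show "(LINT x|M. (u n x)\<^sup>2 * \<rho> x) \<le> 8 * (1 / 8) ^ n" for n
      using close[OF u(2) h(1) u(3) h(2), of n] unfolding u(1) Q_def e_def .
  qed (use \<rho> in auto)
  define H where "H x = lim (\<lambda>n. h n x)" for x
  have "h (Suc n) \<in> K (S n)" "Q (h (Suc n)) < cs + e n" for n
  proof -
    have "S n \<subseteq> S (Suc n)" by (auto simp: S_def atMost_Suc)
    then show "h (Suc n) \<in> K (S n)" using h(1)[of "Suc n"] anti by blast
    show "Q (h (Suc n)) < cs + e n" using h(2)[of "Suc n"] e(2)[of n] by simp
  qed
  from sum[OF refl this] have "AE x in M. summable (\<lambda>n. h (Suc n) x - h n x)" .
  then have lim: "AE x in M. (\<lambda>n. h n x) \<longlonglongrightarrow> H x"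
  proof eventually_elim
    case (elim x)
    then have "convergent (\<lambda>n. \<Sum>k<n. h (Suc k) x - h k x)"
      by (simp add: summable_iff_convergent)
    then have "convergent (\<lambda>n. h n x - h 0 x)" by (simp only: sum_lessThan_telescope[of "\<lambda>n. h n x"])
    from convergent_add[OF this convergent_const[of "h 0 x"]]
    have "convergent (\<lambda>n. h n x)" by simp
    then show ?case by (simp add: H_def convergent_LIMSEQ_iff)
  qed
  show ?thesis
  proof (intro bexI[of _ H] conjI ballI)
    show "H \<in> borel_measurable M" unfolding H_def by measurable
    have "AE x in M. \<forall>n. \<bar>h n x\<bar> \<le> G x" unfolding AE_all_countable using bd h by blast
    with lim show "AE x in M. \<bar>H x\<bar> \<le> G x"
      by eventually_elim (auto intro: LIMSEQ_le_const2 tendsto_rabs)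
    fix i assume "i \<in> I"
    \<comment> \<open>No minimum exceeds \<open>cs\<close>, so near-minimisers that also respect the
      constraint \<open>i\<close> have energy below cs + e n. They are therefore close to
      \<open>h n\<close> and have the same limit.\<close>
    then have "insert i (S n) \<in> fin" for n using S[of n] by (auto simp: fin_def)
    then have "\<forall>n. \<exists>k. k \<in> K (insert i (S n)) \<and> Q k < cs + e n" using near by blast
    from choice[OF this] obtain k where k: "\<And>n. k n \<in> K (insert i (S n))" "\<And>n. Q (k n) < cs + e n" by blast
    have "k n \<in> K (S n)" for n using k(1)[of n] anti[of "S n" "insert i (S n)"] by auto
    from sum[OF refl this k(2)] have "AE x in M. summable (\<lambda>n. k n x - h n x)" .
    with lim have "AE x in M. (\<lambda>n. k n x) \<longlonglongrightarrow> H x"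
    proof eventually_elim
      case (elim x)
      from tendsto_add[OF elim(1) summable_LIMSEQ_zero[OF elim(2)]] show ?case by simp
    qed
    moreover have "k n \<in> K {i}" for n using k(1)[of n] anti[of "{i}" "insert i (S n)"] by auto
    ultimately show "\<exists>g. (\<forall>n. g n \<in> K {i}) \<and> (AE x in M. (\<lambda>n. g n x) \<longlonglongrightarrow> H x)" by blast
  qed
qed

section \<open>Iterated primitives and Taylor's formula\<close>

lemma locally_integrable_prim:
  assumes "locally_integrable h"
  shows "locally_integrable (prim h)"
  by (intro locally_integrable_continuous continuous_on_prim locally_integrable_imp_integrable_on[OF assms])

lemma locally_integrable_funpow_prim: "locally_integrable h \<Longrightarrow> locally_integrable ((prim ^^ k) h)"
  by (induction k) (auto intro: locally_integrable_prim)

lemma continuous_on_funpow_prim: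
  assumes "locally_integrable h" "0 < k"
  shows "continuous_on A ((prim ^^ k) h)"
  using assms(2) by (cases k)
    (auto intro!: continuous_on_prim locally_integrable_imp_integrable_on locally_integrable_funpow_prim assms(1))

lemma funpow_prim_DERIV:
  assumes "locally_integrable h" "0 < k"
  shows "((prim ^^ Suc k) h has_real_derivative (prim ^^ k) h x) (at x)"
  using prim_DERIV[OF continuous_on_funpow_prim[OF assms]] by simp

lemma prim_average:
  assumes "locally_integrable h" "locally_integrable k"
  shows "prim (\<lambda>x. (h x + k x) / 2) = (\<lambda>x. (prim h x + prim k x) / 2)"
proof
  fix x
  have "integral {a..b} (\<lambda>x. (h x + k x) / 2) = (integral {a..b} h + integral {a..b} k) / 2" for a b
    using Henstock_Kurzweil_Integration.integral_add[OF assms[THEN locally_integrable_imp_integrable_on]] by simp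
  then show "prim (\<lambda>x. (h x + k x) / 2) x = (prim h x + prim k x) / 2"
    by (simp add: prim_def field_simps)
qed

lemma funpow_prim_average:
  assumes "locally_integrable h" "locally_integrable k"
  shows "(prim ^^ n) (\<lambda>x. (h x + k x) / 2) = (\<lambda>x. ((prim ^^ n) h x + (prim ^^ n) k x) / 2)"
  using assms by (induction n) (auto simp: prim_average locally_integrable_funpow_prim)

lemma locally_integrable_dominated:
  assumes "locally_integrable g" "f \<in> borel_measurable lebesgue" "AE x in lebesgue. \<bar>f x\<bar> \<le> g x"
  shows "locally_integrable f"
  unfolding locally_integrable_def
proof (intro allI)
  fix a b :: real
  have [measurable]: "f \<in> borel_measurable lebesgue" by fact
  have [measurable]: "{a..b} \<in> sets lebesgue" by simp
  have "set_integrable lebesgue {a..b} g" using assms(1) unfolding locally_integrable_def by blast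
  then show "set_integrable lebesgue {a..b} f"
    unfolding set_integrable_def
    by (rule Bochner_Integration.integrable_bound)
      (measurable, use assms(3) in \<open>auto elim!: eventually_mono simp: indicator_def\<close>)
qed

lemma prim_dominated_convergence:
  assumes f: "\<And>n. locally_integrable (f n)" and g: "locally_integrable g"
    and l: "l \<in> borel_measurable lebesgue"
    and le: "\<And>n. AE x in lebesgue. \<bar>f n x\<bar> \<le> g x"
    and lim: "AE x in lebesgue. (\<lambda>n. f n x) \<longlonglongrightarrow> l x"
  shows "locally_integrable l" "(\<lambda>n. prim (f n) x) \<longlonglongrightarrow> prim l x" "\<bar>prim (f n) x\<bar> \<le> \<bar>prim g x\<bar>"
proof -
  have "AE x in lebesgue. \<forall>n. \<bar>f n x\<bar> \<le> g x" unfolding AE_all_countable using le by blast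
  with lim have "AE x in lebesgue. \<bar>l x\<bar> \<le> g x"
    by eventually_elim (auto intro: LIMSEQ_le_const2 tendsto_rabs)
  then show ll: "locally_integrable l" using locally_integrable_dominated[OF g l] by blast
  have eq: "integral {a..b} u = (LINT x|lebesgue. indicator {a..b} x * u x)" if "locally_integrable u" for u a b
    using that set_lebesgue_integral_eq_integral(2)[of "{a..b}" u]
    by (simp add: locally_integrable_def set_lebesgue_integral_def)
  have gi: "integrable lebesgue (\<lambda>x. indicat_real {a..b} x * g x)" for a b
    using g by (simp add: locally_integrable_def set_integrable_def)
  have fi: "integrable lebesgue (\<lambda>x. indicat_real {a..b} x * f n x)" for a b n
    using f[of n] by (simp add: locally_integrable_def set_integrable_def)
  have li: "integrable lebesgue (\<lambda>x. indicat_real {a..b} x * l x)" for a b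
    using ll by (simp add: locally_integrable_def set_integrable_def)
  have conv: "(\<lambda>n. integral {a..b} (f n)) \<longlonglongrightarrow> integral {a..b} l" for a b
    unfolding eq[OF f] eq[OF ll]
  proof (rule integral_dominated_convergence[where w="\<lambda>x. indicator {a..b} x * g x"])
    show "AE x in lebesgue. (\<lambda>n. indicat_real {a..b} x * f n x) \<longlonglongrightarrow> indicat_real {a..b} x * l x"
      using lim by eventually_elim (intro tendsto_intros)
    show "AE x in lebesgue. norm (indicat_real {a..b} x * f n x) \<le> indicat_real {a..b} x * g x" for n
      using le[of n] by eventually_elim (auto simp: indicator_def)
  qed (use fi li gi in auto)
  show "(\<lambda>n. prim (f n) x) \<longlonglongrightarrow> prim l x"
    unfolding prim_def by (intro tendsto_diff conv)
  have abs: "\<bar>integral {a..b} (f n)\<bar> \<le> integral {a..b} g" for a b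
    unfolding eq[OF f] eq[OF g]
    by (rule order_trans[OF integral_abs_bound integral_mono_AE])
      (use fi gi le[of n] in \<open>auto elim!: eventually_mono simp: indicator_def\<close>)
  show "\<bar>prim (f n) x\<bar> \<le> \<bar>prim g x\<bar>"
    using abs[of 0 x] abs[of x 0] by (cases "x = 0"; cases "x < 0") (auto simp: prim_def)
qed

text \<open>One integration turns convergence almost everywhere into convergence at every point,
  hence \<open>0 < k\<close>. Domination is inherited: if g' dominates one stage, |prim g'|
  dominates the next.\<close>

lemma funpow_prim_tendsto:
  assumes f: "\<And>n. locally_integrable (f n)" and g: "locally_integrable g"
    and l: "l \<in> borel_measurable lebesgue"
    and le: "\<And>n. AE x in lebesgue. \<bar>f n x\<bar> \<le> g x"
    and lim: "AE x in lebesgue. (\<lambda>n. f n x) \<longlonglongrightarrow> l x"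
    and k: "0 < k"
  shows "(\<lambda>n. (prim ^^ k) (f n) x) \<longlonglongrightarrow> (prim ^^ k) l x"
proof -
  have "\<exists>g'. locally_integrable g' \<and> (\<forall>n x. \<bar>(prim ^^ Suc j) (f n) x\<bar> \<le> g' x) \<and>
      (\<forall>x. (\<lambda>n. (prim ^^ Suc j) (f n) x) \<longlonglongrightarrow> (prim ^^ Suc j) l x)" for j
  proof (induction j)
    case 0
    have "locally_integrable (\<lambda>x. \<bar>prim g x\<bar>)"
      by (intro locally_integrable_continuous continuous_intros continuous_on_prim
          locally_integrable_imp_integrable_on g)
    then show ?case
      using prim_dominated_convergence(2,3)[OF f g l le lim] by (intro exI[of _ "\<lambda>x. \<bar>prim g x\<bar>"]) auto
  next
    case (Suc j)
    then obtain g' where g': "locally_integrable g'" "\<And>n x. \<bar>(prim ^^ Suc j) (f n) x\<bar> \<le> g' x"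
      "\<And>x. (\<lambda>n. (prim ^^ Suc j) (f n) x) \<longlonglongrightarrow> (prim ^^ Suc j) l x" by blast
    have ll: "locally_integrable l" by (rule prim_dominated_convergence(1)[OF f g l le lim])
    have "locally_integrable (\<lambda>x. \<bar>prim g' x\<bar>)"
      by (intro locally_integrable_continuous continuous_intros continuous_on_prim
          locally_integrable_imp_integrable_on g')
    moreover have "(\<lambda>n. prim ((prim ^^ Suc j) (f n)) x) \<longlonglongrightarrow> prim ((prim ^^ Suc j) l) x"
      "\<bar>prim ((prim ^^ Suc j) (f n)) x\<bar> \<le> \<bar>prim g' x\<bar>" for x n
      by (rule prim_dominated_convergence[OF locally_integrable_funpow_prim[OF f] g'(1)
            locally_integrable_measurable[OF locally_integrable_funpow_prim[OF ll]] AE_I2[OF g'(2)] AE_I2[OF g'(3)]])+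
    ultimately show ?case by (intro exI[of _ "\<lambda>x. \<bar>prim g' x\<bar>"]) auto
  qed
  then show ?thesis using k by (cases k) auto
qed

text \<open>The degree bound is phrased through coefficients so that n = 0 means the zero
  polynomial, the start of the induction in Taylor's formula.\<close>

lemma poly_antiderivative_exists:
  fixes q :: "real poly"
  assumes "\<forall>i\<ge>n. coeff q i = 0"
  shows "\<exists>Q. pderiv Q = q \<and> (\<forall>i\<ge>Suc n. coeff Q i = 0)"
proof -
  define Q where "Q = (\<Sum>i\<le>degree q. monom (coeff q i / real (Suc i)) (Suc i))"
  have "coeff Q (Suc i) = coeff q i / real (Suc i)" for i
    unfolding Q_def coeff_sum by (simp add: coeff_eq_0)
  then have "pderiv Q = q" by (intro poly_eqI) (simp add: coeff_pderiv del: of_nat_Suc)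
  moreover have "coeff Q i = 0" if "i \<ge> Suc n" for i
    unfolding Q_def coeff_sum using assms that by (intro sum.neutral) auto
  ultimately show ?thesis by blast
qed

text \<open>Taylor's formula with the remainder as an iterated primitive. It allows the limit
  argument to treat the highest derivative as the unknown.\<close>

lemma deriv_chain_eq_funpow_prim:
  assumes "deriv_chain D"
  shows "\<exists>q. (\<forall>i\<ge>n. coeff q i = 0) \<and> (\<forall>x. D 0 x = (prim ^^ n) (D n) x + poly q x)"
  using assms
proof (induction n arbitrary: D)
  case 0
  then show ?case by (intro exI[of _ 0]) auto
next
  case (Suc n)
  have "deriv_chain (\<lambda>k. D (Suc k))" using Suc.prems by (simp add: deriv_chain_def)
  from Suc.IH[OF this] obtain q where q: "\<forall>i\<ge>n. coeff q i = 0"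
    "\<And>x. D 1 x = (prim ^^ n) (D (Suc n)) x + poly q x" by auto
  obtain Q where Q: "pderiv Q = q" "\<forall>i\<ge>Suc n. coeff Q i = 0"
    using poly_antiderivative_exists[OF q(1)] by blast
  have "continuous_on UNIV ((prim ^^ n) (D (Suc n)))"
    using deriv_chain_continuous[OF Suc.prems, of UNIV "Suc n"]
    by (cases "n = 0") (auto intro!: continuous_on_funpow_prim locally_integrable_continuous)
  from prim_DERIV[OF this]
  have d: "((\<lambda>x. D 0 x - (prim ^^ Suc n) (D (Suc n)) x - poly Q x) has_real_derivative
      D (Suc 0) x - (prim ^^ n) (D (Suc n)) x - poly q x) (at x)" for x
    using deriv_chainD[OF Suc.prems, of 0 x] Q(1) by (auto intro!: derivative_eq_intros)
  have "D (Suc 0) x - (prim ^^ n) (D (Suc n)) x - poly q x = 0" for x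
    using q(2)[of x] by simp
  then have "((\<lambda>x. D 0 x - (prim ^^ Suc n) (D (Suc n)) x - poly Q x) has_real_derivative 0) (at x)" for x
    using d[of x] by simp
  note const = DERIV_isconst_all[OF allI[OF this]]
  have "D 0 x = (prim ^^ Suc n) (D (Suc n)) x + poly (Q + [:D 0 0 - (prim ^^ Suc n) (D (Suc n)) 0 - poly Q 0:]) x" for x
    using const[of x 0] by simp
  moreover have "\<forall>i\<ge>Suc n. coeff (Q + [:D 0 0 - (prim ^^ Suc n) (D (Suc n)) 0 - poly Q 0:]) i = 0"
    using Q(2) by (auto simp: coeff_eq_0)
  ultimately show ?case by blast
qed

section \<open>Norm estimates and the trace theorem\<close>

lemma has_weak_deriv_weak_deriv: "has_weak_deriv g h \<Longrightarrow> has_weak_deriv g (weak_deriv g)"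
  unfolding weak_deriv_def by (rule someI[of "has_weak_deriv g"])

lemma epowr_mono: "x \<le> y \<Longrightarrow> 0 < a \<Longrightarrow> epowr x a \<le> epowr y a"
  by (cases x; cases y) (auto simp: epowr_def top_unique intro!: ennreal_leI powr_mono2)

lemma epowr_cmult:
  assumes "0 < c" "0 < a"
  shows "epowr (ennreal c * x) a = ennreal (c powr a) * epowr x a"
proof (cases x)
  case (real r)
  then show ?thesis using assms by (simp add: epowr_def powr_mult flip: ennreal_mult)
next
  case top
  then show ?thesis using assms by (simp add: epowr_def ennreal_mult_top)
qed

lemma epowr_ennreal [simp]: "0 \<le> x \<Longrightarrow> epowr (ennreal x) a = ennreal (x powr a)"
  by (simp add: epowr_def)

lemma epowr_eq_top_iff [simp]: "epowr x a = top \<longleftrightarrow> x = top"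
  by (auto simp: epowr_def)

lemma borel_measurable_epowr [measurable]:
  assumes [measurable]: "g \<in> borel_measurable M"
  shows "(\<lambda>x. epowr (g x) a) \<in> borel_measurable M"
  unfolding epowr_def by measurable

lemma Lp_norm_less_top_iff: "Lp_norm p g < top \<longleftrightarrow> (\<integral>\<^sup>+x. epowr (g x) p \<partial>lebesgue) < top"
  by (simp add: Lp_norm_def less_top[symmetric])

lemma Lp_norm_le_cmult:
  assumes p: "0 < p" and c: "0 < c" and [measurable]: "g \<in> borel_measurable lebesgue"
    and le: "AE x in lebesgue. f x \<le> ennreal c * g x"
  shows "Lp_norm p f \<le> ennreal c * Lp_norm p g"
proof -
  have "(\<integral>\<^sup>+x. epowr (f x) p \<partial>lebesgue) \<le> (\<integral>\<^sup>+x. ennreal (c powr p) * epowr (g x) p \<partial>lebesgue)"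
    using le by (intro nn_integral_mono_AE)
      (auto elim!: eventually_mono simp: epowr_cmult[OF c p, symmetric] intro: epowr_mono p)
  also have "\<dots> = ennreal (c powr p) * (\<integral>\<^sup>+x. epowr (g x) p \<partial>lebesgue)"
    by (rule nn_integral_cmult) measurable
  finally have "Lp_norm p f \<le> epowr (ennreal (c powr p) * (\<integral>\<^sup>+x. epowr (g x) p \<partial>lebesgue)) (1 / p)"
    unfolding Lp_norm_def using p by (intro epowr_mono) auto
  also have "\<dots> = ennreal c * Lp_norm p g"
    using p c by (subst epowr_cmult) (auto simp: Lp_norm_def powr_powr)
  finally show ?thesis .
qed

lemma Lp_norm_AE_cong:
  assumes "AE x in lebesgue. f x = g x"
  shows "Lp_norm p f = Lp_norm p g"
  unfolding Lp_norm_def using assms by (intro arg_cong2[where f=epowr] nn_integral_cong_AE) auto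

text \<open>For |y| > N write |y| = |y|^(1-p) |y|^p and use that 1 - p is negative. Threshold 1
  gives local integrability; a large threshold gives absolute continuity.\<close>

lemma abs_le_one_plus_powr:
  assumes "1 < p" "0 < N"
  shows "\<bar>y\<bar> \<le> N + N powr (1 - p) * (\<bar>y\<bar> powr p :: real)"
proof (cases "\<bar>y\<bar> \<le> N")
  case True
  then show ?thesis by (meson add_increasing2 mult_nonneg_nonneg powr_ge_zero)
next
  case False
  then have "\<bar>y\<bar> powr (1 - p) \<le> N powr (1 - p)" using assms by (intro powr_mono2') auto
  then have "\<bar>y\<bar> powr (1 - p) * \<bar>y\<bar> powr p \<le> N powr (1 - p) * \<bar>y\<bar> powr p"
    by (rule mult_right_mono) simp
  moreover have "\<bar>y\<bar> powr (1 - p) * \<bar>y\<bar> powr p = \<bar>y\<bar>"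
    using False assms by (simp flip: powr_add)
  ultimately show ?thesis using assms by linarith
qed

lemma integrable_powr_if_Lp:
  assumes "h \<in> borel_measurable lebesgue" "Lp_norm p (\<lambda>x. ennreal \<bar>h x\<bar>) < \<infinity>"
  shows "integrable lebesgue (\<lambda>x. \<bar>h x\<bar> powr p)"
  using assms by (intro integrableI_nonneg) (auto simp: Lp_norm_less_top_iff)

lemma locally_integrable_if_Lp:
  assumes p: "1 < p" and h [measurable]: "h \<in> borel_measurable lebesgue"
    and "Lp_norm p (\<lambda>x. ennreal \<bar>h x\<bar>) < \<infinity>"
  shows "locally_integrable h"
proof (rule locally_integrable_dominated[OF _ h AE_I2])
  show "\<bar>h x\<bar> \<le> 1 + \<bar>h x\<bar> powr p" for x
    using abs_le_one_plus_powr[OF p, of 1 "h x"] by simp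
  have "set_integrable lebesgue {a..b} (\<lambda>x. \<bar>h x\<bar> powr p)" for a b
    unfolding set_integrable_def
    by (rule integrable_mult_indicator) (use integrable_powr_if_Lp[OF assms(2,3)] in auto)
  then show "locally_integrable (\<lambda>x. 1 + \<bar>h x\<bar> powr p)"
    using locally_integrable_continuous[of "\<lambda>_. 1"]
    by (auto simp: locally_integrable_def intro!: set_integral_add)
qed

text \<open>Truncation in place of Hoelder's inequality: on a union of intervals of total length d,
  the integral of |h| is at most N d + N^(1-p) A. A large \<open>N\<close> controls the second term,
  then a small d the first.\<close>

lemma abs_continuous_prim:
  assumes p: "1 < p" and h [measurable]: "h \<in> borel_measurable lebesgue"
    and fin: "Lp_norm p (\<lambda>x. ennreal \<bar>h x\<bar>) < \<infinity>"
  shows "abs_continuous_on UNIV (\<lambda>x. c + prim h x)"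
  unfolding abs_continuous_on_def
proof (intro allI impI)
  fix \<epsilon> :: real assume \<epsilon>: "0 < \<epsilon>"
  have lh: "locally_integrable h" by (rule locally_integrable_if_Lp[OF p h fin])
  have ip: "integrable lebesgue (\<lambda>x. \<bar>h x\<bar> powr p)" by (rule integrable_powr_if_Lp[OF h fin])
  define A where "A = (LINT x|lebesgue. \<bar>h x\<bar> powr p)"
  have A: "A \<ge> 0" by (simp add: A_def)
  \<comment> \<open>Solves N^(1-p) (A + 1) = \<epsilon> / 2; with A + 1 in place of A the threshold
    stays positive when A = 0 and the estimate becomes strict.\<close>
  define N where "N = (2 * (A + 1) / \<epsilon>) powr (1 / (p - 1))"
  have N: "N > 0" using \<epsilon> A by (simp add: N_def)
  have NA: "N powr (1 - p) * A < \<epsilon> / 2"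
  proof -
    have "1 / (p - 1) * (1 - p) = - 1" using p by (simp add: field_simps)
    then have "N powr (1 - p) = (2 * (A + 1) / \<epsilon>) powr (- 1)"
      by (simp add: N_def powr_powr)
    also have "\<dots> = \<epsilon> / (2 * (A + 1))" using \<epsilon> A by (simp add: powr_minus)
    finally have "N powr (1 - p) * (A + 1) = \<epsilon> / 2" using \<epsilon> A by (simp add: field_simps)
    moreover have "N powr (1 - p) > 0" using N by simp
    ultimately show ?thesis by (simp only: distrib_left mult_1_right)
  qed
  define \<delta> where "\<delta> = \<epsilon> / (2 * N)"
  show "\<exists>\<delta>>0. \<forall>I. finite I \<and> (\<forall>(a, b)\<in>I. a < b \<and> {a..b} \<subseteq> UNIV) \<and>
     disjoint_family_on (\<lambda>(a, b). {a<..<b}) I \<and> (\<Sum>(a, b)\<in>I. b - a) < \<delta> \<longrightarrow>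
       (\<Sum>(a, b)\<in>I. \<bar>c + prim h b - (c + prim h a)\<bar>) < \<epsilon>"
  proof (intro exI[of _ \<delta>] conjI allI impI)
    show "\<delta> > 0" using \<epsilon> N by (simp add: \<delta>_def)
    fix I :: "(real \<times> real) set"
    assume "finite I \<and> (\<forall>(a, b)\<in>I. a < b \<and> {a..b} \<subseteq> UNIV) \<and>
     disjoint_family_on (\<lambda>(a, b). {a<..<b}) I \<and> (\<Sum>(a, b)\<in>I. b - a) < \<delta>"
    then have I: "finite I" "\<And>a b. (a, b) \<in> I \<Longrightarrow> a < b"
      "disjoint_family_on (\<lambda>(a, b). {a<..<b}) I" "(\<Sum>(a, b)\<in>I. b - a) < \<delta>" by auto
    \<comment> \<open>Open intervals, because the definition only makes these disjoint; the
      endpoints are null sets.\<close>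
    define J where "J i = {fst i<..<snd i}" for i :: "real \<times> real"
    have [measurable]: "J i \<in> sets lebesgue" for i by (simp add: J_def)
    have iJ: "integrable lebesgue (\<lambda>x. indicator (J i) x * \<bar>h x\<bar> powr p)" for i
      using integrable_mult_indicator[OF _ ip, of "J i"] by simp
    have step: "\<bar>c + prim h b - (c + prim h a)\<bar> \<le>
        N * (b - a) + N powr (1 - p) * (LINT x|lebesgue. indicator (J (a, b)) x * \<bar>h x\<bar> powr p)"
      if "(a, b) \<in> I" for a b
    proof -
      have ab: "a < b" using I(2)[OF that] .
      have ih: "integrable lebesgue (\<lambda>x. indicator (J (a, b)) x * h x)"
      proof -
        have "set_integrable lebesgue {a..b} h" using lh by (simp add: locally_integrable_def)
        from set_integrable_subset[OF this, of "J (a, b)"] show ?thesis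
          by (simp add: set_integrable_def J_def subset_iff)
      qed
      have ii: "integrable lebesgue (\<lambda>x. indicat_real (J (a, b)) x)"
        using ab by (simp add: J_def)
      have "prim h b - prim h a = integral {a..b} h"
        using ab by (intro prim_diff locally_integrable_imp_integrable_on lh) auto
      also have "\<dots> = (LINT x|lebesgue. indicator {a..b} x * h x)"
        using lh set_lebesgue_integral_eq_integral(2)[of "{a..b}" h]
        by (simp add: locally_integrable_def set_lebesgue_integral_def)
      also have "\<dots> = (LINT x|lebesgue. indicator (J (a, b)) x * h x)"
      proof (rule integral_cong_AE)
        have "AE x in lebesgue. x \<noteq> a" "AE x in lebesgue. x \<noteq> b"
          by (intro AE_completion AE_lborel_singleton)+
        then show "AE x in lebesgue. indicator {a..b} x * h x = indicator (J (a, b)) x * h x"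
          by eventually_elim (auto simp: J_def indicator_def)
        have "integrable lebesgue (\<lambda>x. indicat_real {a..b} x * h x)"
          using lh by (simp add: locally_integrable_def set_integrable_def)
        then show "(\<lambda>x. indicat_real {a..b} x * h x) \<in> borel_measurable lebesgue" by auto
      qed (use ih in auto)
      also have "\<bar>\<dots>\<bar> \<le> (LINT x|lebesgue. N * indicator (J (a, b)) x + N powr (1 - p) * (indicator (J (a, b)) x * \<bar>h x\<bar> powr p))"
      proof (rule integral_abs_bound_integral[OF ih])
        show "integrable lebesgue (\<lambda>x. N * indicator (J (a, b)) x + N powr (1 - p) * (indicator (J (a, b)) x * \<bar>h x\<bar> powr p))"
          by (intro Bochner_Integration.integrable_add integrable_mult_right ii iJ)
        show "\<bar>indicator (J (a, b)) x * h x\<bar> \<le> N * indicator (J (a, b)) x + N powr (1 - p) * (indicator (J (a, b)) x * \<bar>h x\<bar> powr p)" for x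
          using abs_le_one_plus_powr[OF p N, of "h x"] by (simp add: indicator_def)
      qed
      also have "\<dots> = N * (b - a) + N powr (1 - p) * (LINT x|lebesgue. indicator (J (a, b)) x * \<bar>h x\<bar> powr p)"
        using ab by (subst Bochner_Integration.integral_add[OF integrable_mult_right[OF ii] integrable_mult_right[OF iJ]])
          (simp add: J_def)
      finally show ?thesis by simp
    qed
    have "(\<Sum>(a, b)\<in>I. \<bar>c + prim h b - (c + prim h a)\<bar>) \<le>
        (\<Sum>(a, b)\<in>I. N * (b - a) + N powr (1 - p) * (LINT x|lebesgue. indicator (J (a, b)) x * \<bar>h x\<bar> powr p))"
      by (intro sum_mono) (use step in auto)
    also have "\<dots> = N * (\<Sum>(a, b)\<in>I. b - a) + N powr (1 - p) * (\<Sum>i\<in>I. LINT x|lebesgue. indicator (J i) x * \<bar>h x\<bar> powr p)"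
      by (simp add: sum.distrib sum_distrib_left case_prod_unfold)
    also have "(\<Sum>i\<in>I. LINT x|lebesgue. indicator (J i) x * \<bar>h x\<bar> powr p)
        = (LINT x|lebesgue. (\<Sum>i\<in>I. indicator (J i) x * \<bar>h x\<bar> powr p))"
      using iJ by (intro Bochner_Integration.integral_sum[symmetric]) auto
    also have "\<dots> = (LINT x|lebesgue. indicator (\<Union>i\<in>I. J i) x * \<bar>h x\<bar> powr p)"
    proof (rule Bochner_Integration.integral_cong)
      fix x
      have "disjoint_family_on J I" using I(3) by (simp add: J_def[abs_def] case_prod_unfold)
      from indicator_UN_disjoint[OF I(1) this, of x]
      have "indicat_real (\<Union>i\<in>I. J i) x = (\<Sum>i\<in>I. indicator (J i) x)" by (simp add: comp_def)
      then show "(\<Sum>i\<in>I. indicator (J i) x * \<bar>h x\<bar> powr p) = indicator (\<Union>i\<in>I. J i) x * \<bar>h x\<bar> powr p"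
        by (simp add: sum_distrib_right)
    qed simp
    also have "\<dots> \<le> A"
    proof -
      have "(\<Union>i\<in>I. J i) \<in> sets lebesgue" using I(1) by (intro sets.finite_UN) auto
      from integrable_mult_indicator[OF this ip] show ?thesis
        unfolding A_def by (intro integral_mono ip) (auto simp: indicator_def)
    qed
    finally have "(\<Sum>(a, b)\<in>I. \<bar>c + prim h b - (c + prim h a)\<bar>) \<le> N * (\<Sum>(a, b)\<in>I. b - a) + N powr (1 - p) * A"
      by (simp add: mult_left_mono)
    also have "\<dots> < \<epsilon> / 2 + \<epsilon> / 2"
      using mult_strict_left_mono[OF I(4) N] N NA by (intro add_strict_mono) (auto simp: \<delta>_def)
    finally show "(\<Sum>(a, b)\<in>I. \<bar>c + prim h b - (c + prim h a)\<bar>) < \<epsilon>" by simp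
  qed
qed

lemma abs_continuous_on_imp_continuous_on:
  assumes "abs_continuous_on UNIV g"
  shows "continuous_on UNIV g"
  unfolding continuous_on_iff
proof (intro ballI allI impI)
  fix x e :: real assume "0 < e"
  with assms obtain d where d: "d > 0" and "\<forall>I. finite I \<and> (\<forall>(a, b)\<in>I. a < b \<and> {a..b} \<subseteq> UNIV) \<and>
     disjoint_family_on (\<lambda>(a, b). {a<..<b}) I \<and> (\<Sum>(a, b)\<in>I. b - a) < d \<longrightarrow>
       (\<Sum>(a, b)\<in>I. \<bar>g b - g a\<bar>) < e"
    unfolding abs_continuous_on_def by blast
  then have less: "\<bar>g b - g a\<bar> < e" if "a < b" "b - a < d" for a b
    using that by (elim allE[of _ "{(a, b)}"]) (simp add: disjoint_family_on_def)
  have "dist (g y) (g x) < e" if "dist y x < d" for y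
    using less[of x y] less[of y x] that \<open>0 < e\<close>
    by (cases x y rule: linorder_cases) (auto simp: dist_real_def abs_minus_commute)
  with d show "\<exists>d>0. \<forall>y\<in>UNIV. dist y x < d \<longrightarrow> dist (g y) (g x) < e" by blast
qed

section \<open>Necessity: domination by the maximal function\<close>

lemma divided_diff_cong_values:
  "(\<And>i. i \<le> k \<Longrightarrow> f (z i) = g (z i)) \<Longrightarrow> divided_diff k f z = divided_diff k g z"
  unfolding divided_diff_def by (intro sum.cong) auto

text \<open>The interval [z 0, z m] competes in \<open>hl_max h x\<close> with the same denominator,
  so only numerators have to be compared.\<close>

lemma sharp_maximal_le_hl_max:
  assumes m: "1 \<le> m" and F: "times_differentiable (m - 1) F" "\<forall>x\<in>E. F x = f x"
    and lh: "locally_integrable h"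
    and g: "\<And>a b. a \<le> b \<Longrightarrow> (deriv ^^ (m - 1)) F b - (deriv ^^ (m - 1)) F a = integral {a..b} h"
  shows "sharp_maximal m E f x \<le> hl_max h x"
  unfolding sharp_maximal_def
proof (rule SUP_least, clarify)
  fix z assume z: "strict_mono_on {..m} z" "z ` {..m} \<subseteq> E"
  have zE: "z i \<in> E" if "i \<le> m" for i using z(2) that by auto
  have zm: "z 0 < z m" using z(1) m by (auto simp: strict_mono_on_def)
  have "\<bar>divided_diff (m - 1) F z - divided_diff (m - 1) F (\<lambda>i. z (Suc i))\<bar>
      \<le> integral {z 0..z m} (\<lambda>x. \<bar>h x\<bar>)"
    using divided_diff_increment_le_integral[of m "\<lambda>j. (deriv ^^ j) F" z h]
      times_differentiable_DERIV[OF F(1)] m z(1) g lh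
    by (simp add: locally_integrable_def)
  moreover have "divided_diff (m - 1) F z = divided_diff (m - 1) f z"
    by (rule divided_diff_cong_values) (use zE F(2) in simp)
  moreover have "divided_diff (m - 1) F (\<lambda>i. z (Suc i)) = divided_diff (m - 1) f (\<lambda>i. z (Suc i))"
    by (rule divided_diff_cong_values) (use zE F(2) m in auto)
  ultimately have "ennreal (\<bar>divided_diff (m - 1) f z - divided_diff (m - 1) f (\<lambda>i. z (Suc i))\<bar> / (\<bar>x - z 0\<bar> + \<bar>x - z m\<bar>))
      \<le> ennreal (integral {z 0..z m} (\<lambda>x. \<bar>h x\<bar>) / (\<bar>x - z 0\<bar> + \<bar>x - z m\<bar>))"
    by (intro ennreal_leI divide_right_mono) auto
  also have "\<dots> \<le> hl_max h x"
    unfolding hl_max_def by (rule SUP_upper2[of "(z 0, z m)"]) (use zm in auto)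
  finally show "ennreal (\<bar>divided_diff (m - 1) f z - divided_diff (m - 1) f (\<lambda>i. z (Suc i))\<bar> / (\<bar>x - z 0\<bar> + \<bar>x - z m\<bar>))
      \<le> hl_max h x" .
qed

text \<open>\<open>h\<close> is an arbitrary weak derivative: the one of finite norm from the
  definition of \<open>sobolev\<close> gives membership in L_p, and the chosen
  \<open>weak_deriv\<close> gives the seminorm estimate.\<close>

lemma Lp_norm_sharp_maximal_le:
  assumes m: "1 \<le> m" and p: "1 < p" and F: "F \<in> sobolev m p" "\<forall>x\<in>E. F x = f x"
    and wd: "has_weak_deriv ((deriv ^^ (m - 1)) F) h"
  shows "Lp_norm p (sharp_maximal m E f) \<le>
    ennreal ((20 * p * 2 powr (p - 1) / (p - 1)) powr (1 / p)) * Lp_norm p (\<lambda>x. ennreal \<bar>h x\<bar>)"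
proof (cases "Lp_norm p (\<lambda>x. ennreal \<bar>h x\<bar>) < \<infinity>")
  case False
  then show ?thesis using p by (simp add: less_top[symmetric] ennreal_mult_top)
next
  case True
  let ?g = "(deriv ^^ (m - 1)) F"
  define C where "C = 20 * p * 2 powr (p - 1) / (p - 1)"
  have C: "C > 0" using p by (simp add: C_def)
  have lh: "locally_integrable h" using wd by (simp add: has_weak_deriv_def)
  obtain v where v [measurable]: "v \<in> borel_measurable borel" and hv: "AE x in lebesgue. h x = v x"
    and "\<forall>a b. set_integrable lborel {a..b} v"
    using locally_integrable_borel_representative[OF lh] by blast
  have lv: "locally_integrable v"
    by (rule locally_integrable_dominated[where g="\<lambda>x. \<bar>h x\<bar>"])
      (use lh hv in \<open>auto simp: locally_integrable_def intro!: measurable_completion set_integrable_abs elim: eventually_mono\<close>)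
  have "(\<integral>\<^sup>+x. epowr (ennreal \<bar>h x\<bar>) p \<partial>lebesgue) = (\<integral>\<^sup>+x. ennreal (\<bar>v x\<bar> powr p) \<partial>lebesgue)"
    using hv by (intro nn_integral_cong_AE) (auto elim: eventually_mono)
  then have hv_int: "(\<integral>\<^sup>+x. epowr (ennreal \<bar>h x\<bar>) p \<partial>lebesgue) = (\<integral>\<^sup>+x. ennreal (\<bar>v x\<bar> powr p) \<partial>lborel)"
    by (simp add: nn_integral_completion)
  have fin: "(\<integral>\<^sup>+x. ennreal (\<bar>v x\<bar> powr p) \<partial>lborel) < \<infinity>"
    using True hv_int by (simp add: Lp_norm_less_top_iff)
  have contg: "continuous_on UNIV ?g"
    using F by (intro abs_continuous_on_imp_continuous_on) (simp add: sobolev_def)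
  have "?g b - ?g a = integral {a..b} v" if "a \<le> b" for a b
    using weak_deriv_integral[OF contg wd that] AE_lebesgue_integral_cong[OF hv] by simp
  then have le: "sharp_maximal m E f x \<le> hl_max v x" for x
    using F m lv by (intro sharp_maximal_le_hl_max[where F=F]) (auto simp: sobolev_def)
  have "(\<integral>\<^sup>+x. epowr (sharp_maximal m E f x) p \<partial>lebesgue) = (\<integral>\<^sup>+x. epowr (sharp_maximal m E f x) p \<partial>lborel)"
    by (simp add: nn_integral_completion)
  also have "\<dots> \<le> (\<integral>\<^sup>+x. epowr (hl_max v x) p \<partial>lborel)"
    using p by (intro nn_integral_mono epowr_mono le) auto
  also have "\<dots> \<le> ennreal C * (\<integral>\<^sup>+x. ennreal (\<bar>v x\<bar> powr p) \<partial>lborel)"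
    unfolding C_def by (rule hl_max_strong_type[OF v p fin])
  finally have "Lp_norm p (sharp_maximal m E f) \<le> epowr (ennreal C * (\<integral>\<^sup>+x. ennreal (\<bar>v x\<bar> powr p) \<partial>lborel)) (1 / p)"
    unfolding Lp_norm_def using p by (intro epowr_mono) auto
  also have "\<dots> = ennreal (C powr (1 / p)) * Lp_norm p (\<lambda>x. ennreal \<bar>h x\<bar>)"
    using p C by (simp add: epowr_cmult Lp_norm_def hv_int del: epowr_ennreal)
  finally show ?thesis by (simp add: C_def)
qed

section \<open>Sufficiency: extension from closed sets\<close>

lemma poly_lagrange_linear: "\<exists>W. \<forall>f. poly (lagrange k f z) x = (\<Sum>i\<le>k. f (z i) * W i)"
proof -
  have "poly (lagrange k f z) x = (\<Sum>i\<le>k. f (z i) *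
      ((\<Prod>j\<in>{..k} - {i}. x - z j) / (\<Prod>j\<in>{..k} - {i}. z i - z j)))" for f
    by (simp add: lagrange_def poly_sum poly_prod)
  then show ?thesis
    by (intro exI[of _ "\<lambda>i. (\<Prod>j\<in>{..k} - {i}. x - z j) / (\<Prod>j\<in>{..k} - {i}. z i - z j)"]) blast
qed

text \<open>The directed family consists of candidates h for the m-th derivative; each determines a
  function \<open>ex h\<close> that agrees with \<open>f\<close> at m fixed nodes. The constant is
  that of \<open>finite_extension\<close>, since the limit keeps the pointwise majorant.\<close>

lemma sobolev_extension_exists:
  assumes m: "1 \<le> m"
  obtains C :: real where "C \<ge> 1"
    "\<And>p E f. \<lbrakk>1 < p; infinite E \<or> m < card E; Lp_norm p (sharp_maximal m E f) < \<infinity>\<rbrakk> \<Longrightarrow>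
      \<exists>F\<in>sobolev m p. (\<forall>x\<in>E. F x = f x) \<and>
        sobolev_seminorm m p F \<le> ennreal C * Lp_norm p (sharp_maximal m E f)"
proof -
  obtain C :: real where C: "C \<ge> 1" and ext: "\<And>E S f. \<lbrakk>finite S; S \<subseteq> E; m < card S\<rbrakk> \<Longrightarrow>
    \<exists>D. deriv_chain D \<and> (\<forall>x\<in>S. D 0 x = f x) \<and>
      (\<forall>t s. sharp_maximal m E f t \<le> ennreal s \<longrightarrow> 0 \<le> s \<longrightarrow> \<bar>D m t\<bar> \<le> C * s)"
    using finite_extension[OF m] by blast
  show thesis
  proof (rule that[OF C])
    fix p :: real and E :: "real set" and f :: "real \<Rightarrow> real"
    assume p: "1 < p" and E: "infinite E \<or> m < card E" and fin: "Lp_norm p (sharp_maximal m E f) < \<infinity>"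
    let ?s = "sharp_maximal m E f"
    have [measurable]: "?s \<in> borel_measurable borel" by (rule borel_measurable_sharp_maximal[OF m])
    then have s_leb [measurable]: "?s \<in> borel_measurable lebesgue" by (intro measurable_completion) simp
    \<comment> \<open>\<open>enn2real\<close> sends infinity to 0, so \<open>G\<close> is C times
      the sharp maximal function only where the latter is finite, which is almost everywhere by
      \<open>s_fin\<close>.\<close>
    define G where "G x = C * enn2real (?s x)" for x
    have [measurable]: "G \<in> borel_measurable borel" unfolding G_def by measurable
    then have G_leb [measurable]: "G \<in> borel_measurable lebesgue" by (intro measurable_completion) simp
    have s_fin: "AE x in lborel. ?s x \<noteq> \<infinity>"
    proof -
      have "(\<integral>\<^sup>+x. epowr (?s x) p \<partial>lborel) \<noteq> \<infinity>"
        using fin[unfolded infinity_ennreal_def Lp_norm_less_top_iff] by (simp add: nn_integral_completion)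
      from nn_integral_PInf_AE[OF _ this] show ?thesis by simp
    qed
    have G_eq: "ennreal (G x) = ennreal C * ?s x" if "?s x \<noteq> \<infinity>" for x
      using that C by (simp add: G_def ennreal_mult less_top)
    have G0: "G x \<ge> 0" for x using C by (simp add: G_def)
    have G_norm: "Lp_norm p (\<lambda>x. ennreal \<bar>u x\<bar>) \<le> ennreal C * Lp_norm p ?s"
      if "AE x in lborel. \<bar>u x\<bar> \<le> G x" for u
    proof (rule Lp_norm_le_cmult[OF _ _ s_leb])
      have "AE x in lborel. ennreal \<bar>u x\<bar> \<le> ennreal C * ?s x"
        using that s_fin
      proof eventually_elim
        case (elim x)
        show ?case using ennreal_leI[OF elim(1)] G_eq[OF elim(2)] by simp
      qed
      then show "AE x in lebesgue. ennreal \<bar>u x\<bar> \<le> ennreal C * ?s x" by (rule AE_completion)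
    qed (use p C in auto)
    have G_fin: "Lp_norm p (\<lambda>x. ennreal \<bar>u x\<bar>) < \<infinity>" if "AE x in lborel. \<bar>u x\<bar> \<le> G x" for u
      using G_norm[OF that] by (rule order_le_less_trans) (use fin in \<open>simp add: ennreal_mult_less_top\<close>)
    have lG: "locally_integrable G"
      by (rule locally_integrable_if_Lp[OF p G_leb G_fin]) (simp add: G0)
    \<comment> \<open>m + 1 points, so that adding \<open>B\<close> to any finite set makes
      \<open>finite_extension\<close> applicable; m of them serve as nodes of the correcting
      polynomial.\<close>
    obtain B where B: "finite B" "B \<subseteq> E" "card B = Suc m"
    proof (cases "finite E")
      case True
      then show ?thesis using obtain_subset_with_card_n[of "Suc m" E] E that finite_subset
        by (metis Suc_leI)
    next
      case False
      then show ?thesis using infinite_arbitrarily_large[of E "Suc m"] that by blast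
    qed
    obtain z where z: "bij_betw z {..<Suc m} B"
      using ex_bij_betw_nat_finite[OF B(1)] B(3) by (auto simp: lessThan_atLeast0)
    have zB: "z i \<in> B" if "i \<le> m - 1" for i using z that m by (auto simp: bij_betw_def)
    have zinj: "inj_on z {..m - 1}"
      using m by (intro inj_on_subset[OF bij_betw_imp_inj_on[OF z]]) auto
    \<comment> \<open>The polynomial is fixed by interpolation at \<open>z\<close>, not left free:
      this makes \<open>ex h\<close> an affine function of h, and no bound on polynomial
      coefficients is required in the limit.\<close>
    define q where "q h = lagrange (m - 1) (\<lambda>y. f y - (prim ^^ m) h y) z" for h
    define ex where "ex h x = (prim ^^ m) h x + poly (q h) x" for h x
    define K where "K S = {h. h \<in> borel_measurable lborel \<and> (AE x in lborel. \<bar>h x\<bar> \<le> G x) \<and> (\<forall>x\<in>S. ex h x = f x)}" for S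
    have leb: "h \<in> borel_measurable lebesgue" if "h \<in> borel_measurable lborel" for h :: "real \<Rightarrow> real"
      using that by (rule measurable_completion)
    have lK: "locally_integrable h" if "h \<in> K S" for h S
      using that by (intro locally_integrable_dominated[OF lG leb AE_completion]) (auto simp: K_def)
    have "\<exists>h\<in>borel_measurable lborel. (AE x in lborel. \<bar>h x\<bar> \<le> G x) \<and>
      (\<forall>i\<in>E. \<exists>g. (\<forall>n. g n \<in> K {i}) \<and> (AE x in lborel. (\<lambda>n. g n x) \<longlonglongrightarrow> h x))"
    proof (rule convex_directed_AE_limit[where K=K])
      show "sigma_finite_measure (lborel :: real measure)" by (rule lborel.sigma_finite_measure_axioms)
      fix S :: "real set" assume S: "finite S" "S \<subseteq> E"
      have "card B \<le> card (S \<union> B)" using S B by (intro card_mono) auto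
      then have "m < card (S \<union> B)" using B by simp
      with ext[of "S \<union> B" E f] S B obtain D where D: "deriv_chain D" "\<forall>x\<in>S \<union> B. D 0 x = f x"
        "\<And>t s. ?s t \<le> ennreal s \<Longrightarrow> 0 \<le> s \<Longrightarrow> \<bar>D m t\<bar> \<le> C * s" by auto
      obtain Q where Q: "\<forall>i\<ge>m. coeff Q i = 0" "\<And>x. D 0 x = (prim ^^ m) (D m) x + poly Q x"
        using deriv_chain_eq_funpow_prim[OF D(1)] by blast
      \<comment> \<open>The Taylor polynomial of \<open>D 0\<close> satisfies the same m
        interpolation conditions, since \<open>D 0\<close> equals \<open>f\<close> on
        \<open>B\<close>; thus \<open>D 0\<close> is \<open>ex (D m)\<close>.\<close>
      have "Q = q (D m)"
        unfolding q_def
      proof (rule lagrange_unique[OF zinj])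
        show "degree Q \<le> m - 1" using Q(1) m by (intro degree_le) auto
        show "poly Q (z i) = f (z i) - (prim ^^ m) (D m) (z i)" if "i \<le> m - 1" for i
          using Q(2)[of "z i"] D(2) zB[OF that] by simp
      qed
      then have "ex (D m) x = f x" if "x \<in> S" for x using Q(2)[of x] D(2) that by (simp add: ex_def)
      moreover have "D m \<in> borel_measurable lborel"
        using borel_measurable_continuous_onI[OF deriv_chain_continuous[OF D(1)]] by simp
      moreover have "AE x in lborel. \<bar>D m x\<bar> \<le> G x"
        using s_fin by eventually_elim (auto simp: G_def less_top intro!: D(3))
      ultimately show "K S \<noteq> {}" by (auto simp: K_def)
    next
      fix S h k assume hk: "h \<in> K S" "k \<in> K S"
      let ?a = "\<lambda>x. (h x + k x) / 2"
      have ex_avg: "ex ?a x = (ex h x + ex k x) / 2" for x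
      proof -
        obtain W where W: "\<And>f. poly (lagrange (m - 1) f z) x = (\<Sum>i\<le>m - 1. f (z i) * W i)"
          using poly_lagrange_linear by blast
        have "poly (q ?a) x = (poly (q h) x + poly (q k) x) / 2"
          unfolding q_def W funpow_prim_average[OF hk[THEN lK]]
          by (simp add: sum.distrib[symmetric] sum_divide_distrib field_simps)
        then show ?thesis by (simp add: ex_def funpow_prim_average[OF hk[THEN lK]] field_simps)
      qed
      have "ex ?a x = f x" if "x \<in> S" for x
        using ex_avg[of x] hk that by (simp add: K_def)
      moreover have "AE x in lborel. \<bar>?a x\<bar> \<le> G x"
      proof -
        have "AE x in lborel. \<bar>h x\<bar> \<le> G x" "AE x in lborel. \<bar>k x\<bar> \<le> G x" using hk by (auto simp: K_def)
        then show ?thesis by eventually_elim auto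
      qed
      moreover have "?a \<in> borel_measurable lborel"
        using hk unfolding K_def by (intro borel_measurable_divide borel_measurable_add) auto
      ultimately show "?a \<in> K S" by (simp add: K_def)
    qed (auto simp: K_def)
    then obtain h where h [measurable]: "h \<in> borel_measurable lborel" "AE x in lborel. \<bar>h x\<bar> \<le> G x"
      "\<And>i. i \<in> E \<Longrightarrow> \<exists>g. (\<forall>n. g n \<in> K {i}) \<and> (AE x in lborel. (\<lambda>n. g n x) \<longlonglongrightarrow> h x)" by blast
    have h_leb: "h \<in> borel_measurable lebesgue" by (rule leb[OF h(1)])
    have lh: "locally_integrable h"
      by (rule locally_integrable_dominated[OF lG h_leb AE_completion[OF h(2)]])
    have h_fin: "Lp_norm p (\<lambda>x. ennreal \<bar>h x\<bar>) < \<infinity>" by (rule G_fin[OF h(2)])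
    define F where "F = ex h"
    have F_E: "F i = f i" if i: "i \<in> E" for i
    proof -
      obtain g where g: "\<And>n. g n \<in> K {i}" "AE x in lborel. (\<lambda>n. g n x) \<longlonglongrightarrow> h x" using h(3)[OF i] by blast
      have conv: "(\<lambda>n. (prim ^^ m) (g n) y) \<longlonglongrightarrow> (prim ^^ m) h y" for y
        using g(1) m by (intro funpow_prim_tendsto[OF lK[OF g(1)] lG h_leb AE_completion AE_completion[OF g(2)]])
          (auto simp: K_def)
      obtain W where W: "\<And>f. poly (lagrange (m - 1) f z) i = (\<Sum>j\<le>m - 1. f (z j) * W j)"
        using poly_lagrange_linear by blast
      \<comment> \<open>The correcting polynomial converges as well: its value at \<open>i\<close>
        is a fixed finite combination of the values of the iterated primitives at the nodes.\<close>
      have "(\<lambda>n. ex (g n) i) \<longlonglongrightarrow> ex h i"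
        unfolding ex_def q_def W by (intro tendsto_intros conv)
      moreover have "ex (g n) i = f i" for n using g(1)[of n] by (simp add: K_def)
      ultimately show ?thesis unfolding F_def by (simp add: LIMSEQ_const_iff)
    qed
    \<comment> \<open>Classical derivatives of \<open>F\<close> up to order m - 1. There one
      primitive of \<open>h\<close> is left, and the polynomial part has become the constant
      \<open>c\<close>.\<close>
    define D where "D j x = (prim ^^ (m - j)) h x + poly ((pderiv ^^ j) (q h)) x" for j x
    have D0: "D 0 = F" by (auto simp: D_def F_def ex_def)
    have D: "(D j has_real_derivative D (Suc j) x) (at x)" if "j < m - 1" for j x
    proof -
      have "((prim ^^ Suc (m - Suc j)) h has_real_derivative (prim ^^ (m - Suc j)) h x) (at x)"
        by (rule funpow_prim_DERIV[OF lh]) (use that in auto)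
      moreover have "Suc (m - Suc j) = m - j" using that by simp
      ultimately show ?thesis unfolding D_def
        by (auto intro!: derivative_eq_intros)
    qed
    have td: "times_differentiable (m - 1) F"
      using times_differentiable_chain[of "m - 1" D] D by (simp add: D0)
    obtain c where c: "(deriv ^^ (m - 1)) F = (\<lambda>x. c + prim h x)"
    proof -
      have "degree ((pderiv ^^ (m - 1)) (q h)) = 0"
        using degree_lagrange[of "m - 1"] by (simp add: degree_higher_pderiv q_def)
      then obtain c where "(pderiv ^^ (m - 1)) (q h) = [:c:]" by (auto elim: degree_eq_zeroE)
      moreover have "(deriv ^^ (m - 1)) F = D (m - 1)"
        using funpow_deriv_eq[of "m - 1" D "m - 1"] D by (simp add: D0)
      moreover have "D (m - 1) x = (prim ^^ 1) h x + poly ((pderiv ^^ (m - 1)) (q h)) x" for x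
        unfolding D_def using m by simp
      ultimately have "(deriv ^^ (m - 1)) F = (\<lambda>x. c + prim h x)" by (simp add: fun_eq_iff)
      then show thesis by (rule that)
    qed
    have wd: "has_weak_deriv ((deriv ^^ (m - 1)) F) h"
      unfolding c by (rule has_weak_deriv_prim[OF lh])
    have ac: "abs_continuous_on UNIV ((deriv ^^ (m - 1)) F)"
      unfolding c by (rule abs_continuous_prim[OF p h_leb h_fin])
    have "in_Lp p (\<lambda>x. ennreal \<bar>h x\<bar>)" using h_fin h_leb by (simp add: in_Lp_def)
    with td wd ac have "F \<in> sobolev m p" by (auto simp: sobolev_def)
    moreover have "sobolev_seminorm m p F \<le> ennreal C * Lp_norm p ?s"
    proof -
      have "has_weak_deriv ((deriv ^^ (m - 1)) F) (weak_deriv ((deriv ^^ (m - 1)) F))"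
        using wd by (rule has_weak_deriv_weak_deriv)
      moreover have "continuous_on UNIV ((deriv ^^ (m - 1)) F)"
        unfolding c by (intro continuous_intros continuous_on_prim locally_integrable_imp_integrable_on lh)
      ultimately have "AE x in lebesgue. weak_deriv ((deriv ^^ (m - 1)) F) x = h x"
        using wd has_weak_deriv_unique by blast
      then have "sobolev_seminorm m p F = Lp_norm p (\<lambda>x. ennreal \<bar>h x\<bar>)"
        unfolding sobolev_seminorm_def by (intro Lp_norm_AE_cong) (auto elim: eventually_mono)
      then show ?thesis using G_norm[OF h(2)] by simp
    qed
    ultimately show "\<exists>F\<in>sobolev m p. (\<forall>x\<in>E. F x = f x) \<and>
        sobolev_seminorm m p F \<le> ennreal C * Lp_norm p ?s" using F_E by blast
  qed
qed

theorem theorem1p4: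
  fixes p :: real and m :: nat
  assumes "1 < p" and "1 \<le> m"
  shows
    "(\<forall>(E :: real set) (f :: real \<Rightarrow> real). closed E \<and> (infinite E \<or> m < card E) \<longrightarrow>
        ((\<exists>F\<in>sobolev m p. \<forall>x\<in>E. F x = f x) \<longleftrightarrow> in_Lp p (sharp_maximal m E f))) \<and>
     (\<exists>C::real. 1 \<le> C \<and>
        (\<forall>(E :: real set) (f :: real \<Rightarrow> real). closed E \<and> (infinite E \<or> m < card E) \<longrightarrow>
           ennreal (1 / C) * Lp_norm p (sharp_maximal m E f) \<le> trace_seminorm m p E f \<and>
           trace_seminorm m p E f \<le> ennreal C * Lp_norm p (sharp_maximal m E f)))"
proof -
  obtain C2 :: real where C2: "C2 \<ge> 1"
    "\<And>p E f. \<lbrakk>1 < p; infinite E \<or> m < card E; Lp_norm p (sharp_maximal m E f) < \<infinity>\<rbrakk> \<Longrightarrow>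
      \<exists>F\<in>sobolev m p. (\<forall>x\<in>E. F x = f x) \<and>
        sobolev_seminorm m p F \<le> ennreal C2 * Lp_norm p (sharp_maximal m E f)"
    using sobolev_extension_exists[OF assms(2)] by blast
  define C1 where "C1 = (20 * p * 2 powr (p - 1) / (p - 1)) powr (1 / p)"
  have lower: "Lp_norm p (sharp_maximal m E f) \<le> ennreal C1 * Lp_norm p (\<lambda>x. ennreal \<bar>h x\<bar>)"
    if "F \<in> sobolev m p" "\<forall>x\<in>E. F x = f x" "has_weak_deriv ((deriv ^^ (m - 1)) F) h" for E f F h
    unfolding C1_def by (rule Lp_norm_sharp_maximal_le[OF assms(2,1) that])
  have meas: "sharp_maximal m E f \<in> borel_measurable lebesgue" for E f
    using borel_measurable_sharp_maximal[OF assms(2)] by (intro measurable_completion) simp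
  define C where "C = max C1 C2"
  have C: "1 \<le> C" "C1 \<le> C" "C2 \<le> C" using C2 by (auto simp: C_def)
  show ?thesis
  proof (intro conjI allI impI exI[of _ C])
    fix E :: "real set" and f :: "real \<Rightarrow> real"
    assume E: "closed E \<and> (infinite E \<or> m < card E)"
    show "(\<exists>F\<in>sobolev m p. \<forall>x\<in>E. F x = f x) \<longleftrightarrow> in_Lp p (sharp_maximal m E f)"
    proof
      assume "\<exists>F\<in>sobolev m p. \<forall>x\<in>E. F x = f x"
      then obtain F h where "F \<in> sobolev m p" "\<forall>x\<in>E. F x = f x"
        "has_weak_deriv ((deriv ^^ (m - 1)) F) h" "in_Lp p (\<lambda>x. ennreal \<bar>h x\<bar>)"
        by (auto simp: sobolev_def)
      note h = this
      have "ennreal C1 * Lp_norm p (\<lambda>x. ennreal \<bar>h x\<bar>) < top"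
        using h(4) by (simp add: in_Lp_def ennreal_mult_less_top)
      with lower[OF h(1-3)] have "Lp_norm p (sharp_maximal m E f) < top"
        by (rule order_le_less_trans)
      then show "in_Lp p (sharp_maximal m E f)" using meas by (simp add: in_Lp_def)
    next
      assume "in_Lp p (sharp_maximal m E f)"
      then show "\<exists>F\<in>sobolev m p. \<forall>x\<in>E. F x = f x"
        using C2(2)[OF assms(1), of E f] E by (auto simp: in_Lp_def)
    qed
    show "ennreal (1 / C) * Lp_norm p (sharp_maximal m E f) \<le> trace_seminorm m p E f"
      unfolding trace_seminorm_def
    proof (rule INF_greatest)
      fix F assume F: "F \<in> {F \<in> sobolev m p. \<forall>x\<in>E. F x = f x}"
      then obtain h where "has_weak_deriv ((deriv ^^ (m - 1)) F) h" by (auto simp: sobolev_def)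
      \<comment> \<open>The seminorm is computed with the chosen representative, which is a weak
        derivative because one exists; so the lower bound applies to it directly.\<close>
      then have "has_weak_deriv ((deriv ^^ (m - 1)) F) (weak_deriv ((deriv ^^ (m - 1)) F))"
        by (rule has_weak_deriv_weak_deriv)
      from lower[OF _ _ this, of E f] F
      have "Lp_norm p (sharp_maximal m E f) \<le> ennreal C1 * sobolev_seminorm m p F"
        by (simp add: sobolev_seminorm_def)
      also have "\<dots> \<le> ennreal C * sobolev_seminorm m p F"
        using C by (intro mult_right_mono ennreal_leI) auto
      finally have "ennreal (1 / C) * Lp_norm p (sharp_maximal m E f) \<le> ennreal (1 / C) * (ennreal C * sobolev_seminorm m p F)"
        by (rule mult_left_mono) simp
      also have "\<dots> = sobolev_seminorm m p F"
        using C by (simp flip: mult.assoc ennreal_mult)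
      finally show "ennreal (1 / C) * Lp_norm p (sharp_maximal m E f) \<le> sobolev_seminorm m p F" .
    qed
    show "trace_seminorm m p E f \<le> ennreal C * Lp_norm p (sharp_maximal m E f)"
    proof (cases "Lp_norm p (sharp_maximal m E f) < \<infinity>")
      case True
      with C2(2)[OF assms(1), of E f] E obtain F where F: "F \<in> sobolev m p" "\<forall>x\<in>E. F x = f x"
        "sobolev_seminorm m p F \<le> ennreal C2 * Lp_norm p (sharp_maximal m E f)" by blast
      have "trace_seminorm m p E f \<le> sobolev_seminorm m p F"
        unfolding trace_seminorm_def by (rule INF_lower) (use F in auto)
      also note F(3)
      also have "ennreal C2 * Lp_norm p (sharp_maximal m E f) \<le> ennreal C * Lp_norm p (sharp_maximal m E f)"
        using C by (intro mult_right_mono ennreal_leI) auto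
      finally show ?thesis .
    next
      case False
      then show ?thesis using C by (simp add: less_top[symmetric] ennreal_mult_top)
    qed
  qed (rule C)
qed

end
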